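(* Let $q=p^e$ be a prime power, $\lambda\in\mathbb{F}_q^*$ of order $g$, and $N=p^vn$ a positive integer with $v=v_p(N)\geq0$ and $\gcd(n,p)=1$. Let $\lambda'\in\mathbb{F}_q^*$ be the element with $(\lambda')^{p^v}=\lambda$ (namely $\lambda'=\lambda^b$ with $bp^v\equiv1\pmod g$), and let $h$ be an integer coprime to $ng$ with $\zeta_{ng}^{hn}=\lambda'$. Write $g=g_1^{e_1}\cdots g_u^{e_u}$ and $n=g_1^{f_1}\cdots g_u^{f_u}p_1^{j_1}\cdots p_s^{j_s}$, where $g_1,\dots,g_u,p_1,\dots,p_s$ are pairwise distinct primes different from $p$, $g_1<\cdots<g_u$, $p_1<\cdots<p_s$, the $e_k,j_k$ are positive integers and the $f_k$ are nonnegative integers; put $n_1=g_1^{f_1}\cdots g_u^{f_u}$. Then the $\lambda$-constacyclic codes of length $N$ over $\mathbb{F}_q$ are the ideals $$\mathcal{C}_\Omega=\Bigl(\prod_{\mathbf{x}\in[0,g_1^{y_1}-1]\times\cdots\times[0,g_u^{y_u}-1]}\ \prod_{I\in\mathcal{I}_{ng/n_1g}(\gamma_{\mathbf{x}})}M_{h\gamma_{\mathbf{x},I}}(X)^{\Omega_{\mathbf{x},I}}\Bigr)\subseteq\mathcal{R}_{N,\lambda},$$ where for each $\mathbf{x}\in[0,g_1^{y_1}-1]\times\cdots\times[0,g_u^{y_u}-1]$ and each $I=(\mathfrak{m},\mathfrak{a},\mathfrak{t})\in\mathcal{I}_{ng/n_1g}(\gamma_{\mathbf{x}})$ the exponent $\Omega_{\mathbf{x},I}$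 ranges over the integer interval $[0,p^v]$.
   Context: Constacyclic codes. $\mathcal{R}_{N,\lambda}=\mathbb{F}_q[X]/(X^N-\lambda)$. A $\lambda$-constacyclic code of length $N$ over $\mathbb{F}_q$ is a subspace of $\mathbb{F}_q^N$ closed under $(c_0,\dots,c_{N-1})\mapsto(\lambda c_{N-1},c_0,\dots,c_{N-2})$; via $(c_0,\dots,c_{N-1})\mapsto c_0+c_1X+\cdots+c_{N-1}X^{N-1}$ such codes are identified with the ideals of $\mathcal{R}_{N,\lambda}$. Notation: $\mathbb{N}=\{0,1,\dots\}$; $[a,b]$ is the set of integers from $a$ to $b$; $v_\ell$ is the $\ell$-adic valuation; $\overline{[0,j_k-1]}=[0,j_k-1]\cup\{\infty\}$. The cases $u=0$ and $s=0$ are allowed, with empty products $1$ and empty tuples. A family $\{\zeta_M:\gcd(M,q)=1\}$ of primitive $M$-th roots of unity in an algebraic closure of $\mathbb{F}_q$ is fixed, with $\zeta_M^{M/M'}=\zeta_{M'}$ whenever $M'\mid M$. For $M\geq1$ coprime to $q$, $c_M(\gamma)=\{\gamma,\gamma q,\dots,\gamma q^{\tau-1}\}\subseteq\mathbb{Z}/M\mathbb{Z}$ is the $q$-cyclotomic coset containing $\gamma$, $\tau$ the least positive integer with $\gamma q^\tau\equiv\gamma\pmod M$, called its size. For $\delta\in\mathbb{Z}$, $M_\delta(X)=\prod_{i\in c_{ng}(\delta)}(X-\zeta_{ng}^i)\in\mathbb{F}_q[X]$. The exponents $y_k$ and integers $\gamma_{\mathbf{x}}$. If $g_1=2$ and $q\equiv3\pmod4$,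 $y_1=\max\{0,\min\{f_1-1,v_{g_1}(q+1)-e_1\}\}$; otherwise $y_1=\min\{f_1,v_{g_1}(q-1)-e_1\}$. For $2\leq k\leq u$, $y_k=\min\{f_k,v_{g_k}(q-1)-e_k\}$. For $\mathbf{x}=(x_1,\dots,x_u)$ with $x_k\in[0,g_k^{y_k}-1]$: $\gamma_{\mathbf{x}}=1+g(g_1x_1+g_1^{f_1}x_2+\cdots+g_1^{f_1}\cdots g_{u-1}^{f_{u-1}}x_u)$ if $g_1=2$ and $q\equiv3\pmod4$, and $\gamma_{\mathbf{x}}=1+g(x_1+g_1^{f_1}x_2+\cdots+g_1^{f_1}\cdots g_{u-1}^{f_{u-1}}x_u)$ otherwise. The general construction below is applied with base modulus $N_0=n_1g$, $\gamma=\gamma_{\mathbf{x}}$ and $n'=p_1^{j_1}\cdots p_s^{j_s}$ (so $N_0n'=ng$); $\gamma_{\mathbf{x},I}:=(\gamma_{\mathbf{x}})_I$. For $s=0$, $\mathcal{I}$ has one element $I$ and $\gamma_I=\gamma$. Let $N_0$ be a positive integer coprime to $q$ and to $p_1\cdots p_s$, $\gamma\in\mathbb{Z}$, $\tau=|c_{N_0}(\gamma)|$. For $\mathfrak{m}=(m_1,\dots,m_s)$ with $m_k\in\overline{[0,j_k-1]}$, write $\mathfrak{m}_{\leq k}=(m_1,\dots,m_k)$ and define recursively: $\bullet$ $k=1$: $r_1=[(\mathbb{Z}/p_1\mathbb{Z})^*:\langle q^\tau\rangle]$; $v_1=v_2(q^\tau+1)$ if $p_1=2$ and $q^\tau\equiv3\pmod4$,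 and $v_1=v_{p_1}(q^{\tau(p_1-1)/r_1}-1)$ otherwise. If $p_1=2$ and $q^\tau\equiv3\pmod 4$: $\tau_1(\mathfrak{m}_{\leq1})=\tau$ if $m_1\in\{j_1-1,\infty\}$ and $2^{\max\{1,j_1-m_1-v_1\}}\tau$ if $0\leq m_1\leq j_1-2$. Otherwise: $\tau_1(\mathfrak{m}_{\leq1})=\tau$ if $m_1=\infty$ and $p_1^{\max\{0,j_1-m_1-v_1\}}\frac{p_1-1}{r_1}\tau$ if $0\leq m_1\leq j_1-1$. $\bullet$ $2\leq k\leq s$: $r_k(\mathfrak{m}_{\leq k-1})=[(\mathbb{Z}/p_k\mathbb{Z})^*:\langle q^{\tau_{k-1}(\mathfrak{m}_{\leq k-1})}\rangle]$, $\widetilde\tau_k=\frac{\tau_{k-1}(\mathfrak{m}_{\leq k-1})(p_k-1)}{r_k(\mathfrak{m}_{\leq k-1})}$, $v_k(\mathfrak{m}_{\leq k-1})=v_{p_k}(q^{\widetilde\tau_k}-1)$; $\tau_k(\mathfrak{m}_{\leq k})=\tau_{k-1}(\mathfrak{m}_{\leq k-1})$ if $m_k=\infty$, and $\tau_k(\mathfrak{m}_{\leq k})=p_k^{\max\{0,j_k-m_k-v_k(\mathfrak{m}_{\leq k-1})\}}\frac{p_k-1}{r_k(\mathfrak{m}_{\leq k-1})}\tau_{k-1}(\mathfrak{m}_{\leq k-1})$ if $0\leq m_k\leq j_k-1$. Index set. $\mathcal{I}_{N_0n'/N_0}(\gamma)$ is the set of triples $(\mathfrak{m},\mathfrak{a},\mathfrak{t})$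 with $\mathfrak{m}\in\overline{[0,j_1-1]}\times\cdots\times\overline{[0,j_s-1]}$ and $\mathfrak{a},\mathfrak{t}\in\mathbb{N}^s$ such that: (i) for every $k$, if $m_k=\infty$ then $a_k=t_k=0$; (ii) if $m_1\in[0,j_1-1]$: when $p_1=2$ and $q^\tau\equiv3\pmod4$, $a_1=1$ and $t_1\in[0,2^{\max\{0,\min\{v_1-1,j_1-m_1-2\}\}}-1]$; otherwise $a_1\in[1,r_1]$ and $t_1\in[0,p_1^{\min\{v_1,j_1-m_1\}-1}-1]$; (iii) for $2\leq k\leq s$, if $m_k\in[0,j_k-1]$ then $a_k\in[1,r_k(\mathfrak{m}_{\leq k-1})]$ and $t_k\in[0,p_k^{\min\{v_k(\mathfrak{m}_{\leq k-1}),j_k-m_k\}-1}-1]$. The integers $\varphi$ and $U$. For a positive integer $B$, a prime $\ell\nmid B$, $\ell\neq p$, and $\delta\in\mathbb{Z}$, let $\varphi_B^\ell(\delta)=-\delta/B=\sum_{k\geq0}\phi_k\ell^k\in\mathbb{Z}_\ell$ ($\phi_k\in[0,\ell-1]$) and $\varphi_B^\ell(\delta)_{\leq i}=\sum_{k=0}^i\phi_k\ell^k$. Let $\theta$ be the size of $c_B(\delta)$ and $r=[(\mathbb{Z}/\ell\mathbb{Z})^*:\langle q^\theta\rangle]$. For $m\in\mathbb{N}$, $a\in[1,r]$, put $U_B^\ell(\delta;m,a)=\sum_{k=0}^{m-1}\phi_k\ell^k+u\,\ell^m$, where: if $\ell\mid q^\theta-1$ (so $r=\ell-1$), $u=\sigma^m_a$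 with $[0,\ell-1]\setminus\{\phi_m\}=\{\sigma_1^m<\cdots<\sigma_{\ell-1}^m\}$; if $\ell\nmid q^\theta-1$, $u\in[0,\ell-1]$ with $u\equiv\phi_m+\sigma_a\pmod\ell$, where $\{\sigma_1<\dots<\sigma_r\}\subseteq[1,\ell-1]$ is a fixed full set of representatives of $(\mathbb{Z}/\ell\mathbb{Z})^*/\langle q^\theta\rangle$. For $\ell=2$ write $U_B^2(\delta;m)=U_B^2(\delta;m,1)=\sum_{k<m}\phi_k2^k+(1-\phi_m)2^m$. The representative $\gamma_I$. For $I=(\mathfrak{m},\mathfrak{a},\mathfrak{t})$ put $\gamma_I=\gamma_{I,s}$, where: $\bullet$ $\gamma_{I,1}=\gamma+N_0\,\varphi_{N_0}^{p_1}(\gamma)_{\leq j_1-1}$ if $m_1=\infty$; $\gamma_{I,1}=\gamma+N_0(U_{N_0}^2(\gamma;m_1)+2^{m_1+2}t_1)$ if $0\leq m_1\leq j_1-1$, $p_1=2$ and $q^\tau\equiv3\pmod4$; $\gamma_{I,1}=\gamma+N_0(U_{N_0}^{p_1}(\gamma;m_1,a_1)+p_1^{m_1+1}t_1)$ otherwise. $\bullet$ For $2\leq k\leq s$, with $B_k=p_1^{j_1}\cdots p_{k-1}^{j_{k-1}}N_0$: $\gamma_{I,k}=\gamma_{I,k-1}+B_k\,\varphi_{B_k}^{p_k}(\gamma_{I,k-1})_{\leq j_k-1}$ if $m_k=\infty$; $\gamma_{I,k}=\gamma_{I,k-1}+B_k\bigl(U_{B_k}^{p_k}(\gamma_{I,k-1};m_k,a_k)+p_k^{m_k+1}t_k\bigr)$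 if $0\leq m_k\leq j_k-1$. (Here the size $\theta$ of $c_{B_k}(\gamma_{I,k-1})$ used in forming $U$ is $\tau_{k-1}(\mathfrak{m}_{\leq k-1})$.) *)

theory Defs
  imports
    "HOL-Library.Extended_Nat"
    "HOL-Library.FuncSet"
    "HOL-Number_Theory.Number_Theory"
    "HOL-Algebra.Algebraic_Closure_Type"
    "HOL-Algebra.Coset"
    "HOL-Algebra.QuotRing"
    "HOL-Algebra.Generated_Groups"
    "Jordan_Normal_Form.VS_Connect"
begin

hide_const (open) Divisibility.prime

section \<open>Constacyclic codes\<close>

definition constacyclic_shift :: "'a::field \<Rightarrow> 'a Matrix.vec \<Rightarrow> 'a Matrix.vec" where
  "constacyclic_shift lam c =
     Matrix.vec (dim_vec c) (\<lambda>i. if i = 0 then lam * c $ (dim_vec c - 1) else c $ (i - 1))"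

definition constacyclic_code :: "nat \<Rightarrow> 'a::field \<Rightarrow> 'a Matrix.vec set \<Rightarrow> bool" where
  "constacyclic_code N lam C \<longleftrightarrow>
     subspace class_ring C (module_vec TYPE('a) N) \<and> constacyclic_shift lam ` C \<subseteq> C"

text \<open>Here \<open>class_ring\<close> at type \<^typ>\<open>'a poly\<close> is \<open>F\<^sub>q[X]\<close>.\<close>

definition modulus_ideal :: "nat \<Rightarrow> 'a::field \<Rightarrow> 'a poly set" where
  "modulus_ideal N lam = PIdl\<^bsub>class_ring\<^esub> (Polynomial.monom 1 N - [:lam:])"

definition constacyclic_ring :: "nat \<Rightarrow> 'a::field \<Rightarrow> 'a poly set ring" where
  "constacyclic_ring N lam = class_ring Quot (modulus_ideal N lam)"

definition residue_class :: "nat \<Rightarrow> 'a::field \<Rightarrow> 'a poly \<Rightarrow> 'a poly set" where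
  "residue_class N lam f = modulus_ideal N lam +>\<^bsub>class_ring\<^esub> f"

text \<open>The identification of \<open>F\<^sub>q\<^sup>N\<close> with the quotient ring.\<close>

definition vec_class :: "nat \<Rightarrow> 'a::field \<Rightarrow> 'a Matrix.vec \<Rightarrow> 'a poly set" where
  "vec_class N lam c = residue_class N lam (\<Sum>i<N. Polynomial.monom (c $ i) i)"


section \<open>Roots of unity and cyclotomic cosets\<close>

definition primitive_root_of_unity :: "nat \<Rightarrow> 'a::monoid_mult \<Rightarrow> bool" where
  "primitive_root_of_unity M z \<longleftrightarrow> M > 0 \<and> z ^ M = 1 \<and> (\<forall>k. 0 < k \<and> k < M \<longrightarrow> z ^ k \<noteq> 1)"

definition compatible_roots_of_unity :: "nat \<Rightarrow> (nat \<Rightarrow> 'a::monoid_mult) \<Rightarrow> bool" where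
  "compatible_roots_of_unity q zeta \<longleftrightarrow>
     (\<forall>M. coprime M q \<longrightarrow> primitive_root_of_unity M (zeta M)) \<and>
     (\<forall>M M'. coprime M q \<and> M' dvd M \<longrightarrow> zeta M ^ (M div M') = zeta M')"

definition coset_size :: "nat \<Rightarrow> nat \<Rightarrow> int \<Rightarrow> nat" where
  "coset_size q M \<gamma> = (LEAST \<tau>. \<tau> > 0 \<and> [\<gamma> * int q ^ \<tau> = \<gamma>] (mod int M))"

text \<open>Residue classes modulo \<open>M\<close> are represented by the integers in \<open>{0..<M}\<close>.\<close>

definition cyclotomic_coset :: "nat \<Rightarrow> nat \<Rightarrow> int \<Rightarrow> int set" where
  "cyclotomic_coset q M \<gamma> = (\<lambda>i. (\<gamma> * int q ^ i) mod int M) ` {0..<coset_size q M \<gamma>}"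

text \<open>The product over a cyclotomic coset, as the polynomial over the base field which maps to it.\<close>

definition coset_poly ::
    "(nat \<Rightarrow> 'a::field alg_closure) \<Rightarrow> nat \<Rightarrow> nat \<Rightarrow> int \<Rightarrow> 'a poly" where
  "coset_poly zeta q M \<delta> =
     (THE f. map_poly to_ac f = (\<Prod>i\<in>cyclotomic_coset q M \<delta>. [: - (zeta M ^ nat i), 1 :]))"


section \<open>Subgroups of the unit group modulo a prime\<close>

definition unit_group :: "nat \<Rightarrow> int monoid" where
  "unit_group l = units_of (residue_ring (int l))"

definition power_subgroup :: "nat \<Rightarrow> nat \<Rightarrow> int set" where
  "power_subgroup l a = generate (unit_group l) {int a mod int l}"

definition unit_index :: "nat \<Rightarrow> nat \<Rightarrow> nat" where
  "unit_index l a = card (rcosets\<^bsub>unit_group l\<^esub> (power_subgroup l a))"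

definition full_rep_set :: "nat \<Rightarrow> nat \<Rightarrow> nat set \<Rightarrow> bool" where
  "full_rep_set l a S \<longleftrightarrow> S \<subseteq> {1..l - 1} \<and>
     (\<forall>K \<in> rcosets\<^bsub>unit_group l\<^esub> (power_subgroup l a). \<exists>!x. x \<in> S \<and> int x \<in> K)"

text \<open>
  A choice of representatives for every \<open>B\<close>, \<open>l\<close>, \<open>\<delta>\<close> for which the integers \<open>U\<close> below are formed.
  It may depend on all three, which covers in particular choices depending only on the quotient group.
\<close>

definition rep_choice :: "nat \<Rightarrow> nat \<Rightarrow> (nat \<Rightarrow> nat \<Rightarrow> int \<Rightarrow> nat set) \<Rightarrow> bool" where
  "rep_choice p q \<sigma> \<longleftrightarrow>
     (\<forall>B l \<delta>. B > 0 \<and> coprime B q \<and> prime l \<and> \<not> l dvd B \<and> l \<noteq> p \<longrightarrow>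
        full_rep_set l (q ^ coset_size q B \<delta>) (\<sigma> B l \<delta>))"


section \<open>The integers \<open>\<phi>\<close> and \<open>U\<close>\<close>

text \<open>
  The \<open>l\<close>-adic digits of \<open>-\<delta>/B\<close>: the digit sequence whose partial sums, multiplied by \<open>B\<close>,
  approximate \<open>-\<delta>\<close> modulo every power of \<open>l\<close>.
\<close>

definition padic_digits :: "nat \<Rightarrow> nat \<Rightarrow> int \<Rightarrow> nat \<Rightarrow> nat" where
  "padic_digits B l \<delta> = (THE d. (\<forall>k. d k < l) \<and>
     (\<forall>i. [int B * int (\<Sum>k\<le>i. d k * l ^ k) = - \<delta>] (mod int l ^ (i + 1))))"

definition phi_trunc :: "nat \<Rightarrow> nat \<Rightarrow> int \<Rightarrow> nat \<Rightarrow> nat" where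
  "phi_trunc B l \<delta> i = (\<Sum>k\<le>i. padic_digits B l \<delta> k * l ^ k)"

text \<open>\<open>nth_smallest S a\<close> is the \<open>a\<close>-th smallest element of \<open>S\<close>, counting from \<open>1\<close>.\<close>

definition nth_smallest :: "nat set \<Rightarrow> nat \<Rightarrow> nat" where
  "nth_smallest S a = sorted_list_of_set S ! (a - 1)"

definition U_int ::
    "nat \<Rightarrow> (nat \<Rightarrow> nat \<Rightarrow> int \<Rightarrow> nat set) \<Rightarrow> nat \<Rightarrow> nat \<Rightarrow> int \<Rightarrow> nat \<Rightarrow> nat \<Rightarrow> nat" where
  "U_int q \<sigma> B l \<delta> m a =
     (let d = padic_digits B l \<delta>;
          w = (if l dvd q ^ coset_size q B \<delta> - 1
               then nth_smallest ({0..l - 1} - {d m}) a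
               else (d m + nth_smallest (\<sigma> B l \<delta>) a) mod l)
      in (\<Sum>k<m. d k * l ^ k) + w * l ^ m)"


section \<open>The index set\<close>

text \<open>
  Tuples indexed by \<open>1, \<dots>, s\<close> are extensional functions on \<open>{1..s}\<close>. Wherever a truncated
  subtraction of natural numbers occurs inside an exponent below, the truncation is the
  \<open>max {0, _}\<close> of the formula, or the difference is nonnegative.
\<close>

definition exceptional :: "nat \<Rightarrow> nat \<Rightarrow> bool" where
  "exceptional l Q \<longleftrightarrow> l = 2 \<and> Q mod 4 = 3"

text \<open>
  \<open>tau_seq q P j \<tau> m k\<close> is \<open>\<tau>\<^sub>k(m\<^sub>1, \<dots>, m\<^sub>k)\<close> for \<open>k \<ge> 1\<close>, with \<open>\<tau>\<^sub>0 = \<tau>\<close>. The functions \<open>r_of\<close>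
  and \<open>v_of\<close> give \<open>r\<^sub>k\<close> and \<open>v\<^sub>k\<close> at a prime \<open>l\<close> in terms of \<open>\<theta> = \<tau>\<^bsub>k-1\<^esub>\<close>; the exceptional value
  of \<open>v\<^sub>1\<close> is \<open>v1_exc\<close>.
\<close>

definition r_of :: "nat \<Rightarrow> nat \<Rightarrow> nat \<Rightarrow> nat" where
  "r_of q l \<theta> = unit_index l (q ^ \<theta>)"

definition v_of :: "nat \<Rightarrow> nat \<Rightarrow> nat \<Rightarrow> nat" where
  "v_of q l \<theta> = multiplicity l (q ^ (\<theta> * (l - 1) div r_of q l \<theta>) - 1)"

definition v1_exc :: "nat \<Rightarrow> nat \<Rightarrow> nat" where
  "v1_exc q \<tau> = multiplicity 2 (q ^ \<tau> + 1)"

fun tau_seq ::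
    "nat \<Rightarrow> (nat \<Rightarrow> nat) \<Rightarrow> (nat \<Rightarrow> nat) \<Rightarrow> nat \<Rightarrow> (nat \<Rightarrow> enat) \<Rightarrow> nat \<Rightarrow> nat" where
  "tau_seq q P j \<tau> m 0 = \<tau>"
| "tau_seq q P j \<tau> m (Suc 0) =
     (if exceptional (P 1) (q ^ \<tau>)
      then (case m 1 of
              \<infinity> \<Rightarrow> \<tau>
            | enat i \<Rightarrow> if i = j 1 - 1 then \<tau> else 2 ^ max 1 (j 1 - i - v1_exc q \<tau>) * \<tau>)
      else (case m 1 of
              \<infinity> \<Rightarrow> \<tau>
            | enat i \<Rightarrow> P 1 ^ (j 1 - i - v_of q (P 1) \<tau>) * ((P 1 - 1) div r_of q (P 1) \<tau>) * \<tau>))"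
| "tau_seq q P j \<tau> m (Suc (Suc k)) =
     (let \<theta> = tau_seq q P j \<tau> m (Suc k); l = P (Suc (Suc k))
      in case m (Suc (Suc k)) of
           \<infinity> \<Rightarrow> \<theta>
         | enat i \<Rightarrow> l ^ (j (Suc (Suc k)) - i - v_of q l \<theta>) * ((l - 1) div r_of q l \<theta>) * \<theta>)"

type_synonym index = "(nat \<Rightarrow> enat) \<times> (nat \<Rightarrow> nat) \<times> (nat \<Rightarrow> nat)"

definition index_set ::
    "nat \<Rightarrow> nat \<Rightarrow> (nat \<Rightarrow> nat) \<Rightarrow> (nat \<Rightarrow> nat) \<Rightarrow> nat \<Rightarrow> int \<Rightarrow> index set" where
  "index_set q s P j N\<^sub>0 \<gamma> =
     (let \<tau> = coset_size q N\<^sub>0 \<gamma> in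
      {(m, a, t).
         m \<in> (\<Pi>\<^sub>E k\<in>{1..s}. enat ` {0..j k - 1} \<union> {\<infinity>}) \<and>
         a \<in> (\<Pi>\<^sub>E k\<in>{1..s}. UNIV) \<and> t \<in> (\<Pi>\<^sub>E k\<in>{1..s}. UNIV) \<and>
         (\<forall>k\<in>{1..s}. m k = \<infinity> \<longrightarrow> a k = 0 \<and> t k = 0) \<and>
         (\<forall>i. s \<ge> 1 \<and> m 1 = enat i \<longrightarrow>
            (if exceptional (P 1) (q ^ \<tau>)
             then a 1 = 1 \<and> t 1 \<in> {0..2 ^ min (v1_exc q \<tau> - 1) (j 1 - i - 2) - 1}
             else a 1 \<in> {1..r_of q (P 1) \<tau>} \<and>
                  t 1 \<in> {0..P 1 ^ (min (v_of q (P 1) \<tau>) (j 1 - i) - 1) - 1})) \<and>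
         (\<forall>k\<in>{2..s}. \<forall>i. m k = enat i \<longrightarrow>
            (let \<theta> = tau_seq q P j \<tau> m (k - 1) in
             a k \<in> {1..r_of q (P k) \<theta>} \<and>
             t k \<in> {0..P k ^ (min (v_of q (P k) \<theta>) (j k - i) - 1) - 1}))})"


section \<open>The representatives\<close>

fun gamma_seq ::
    "nat \<Rightarrow> (nat \<Rightarrow> nat \<Rightarrow> int \<Rightarrow> nat set) \<Rightarrow> (nat \<Rightarrow> nat) \<Rightarrow> (nat \<Rightarrow> nat) \<Rightarrow> nat \<Rightarrow> int \<Rightarrow> index
       \<Rightarrow> nat \<Rightarrow> int" where
  "gamma_seq q \<sigma> P j N\<^sub>0 \<gamma> (m, a, t) 0 = \<gamma>"
| "gamma_seq q \<sigma> P j N\<^sub>0 \<gamma> (m, a, t) (Suc 0) =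
     (case m 1 of
        \<infinity> \<Rightarrow> \<gamma> + int N\<^sub>0 * int (phi_trunc N\<^sub>0 (P 1) \<gamma> (j 1 - 1))
      | enat i \<Rightarrow>
          if exceptional (P 1) (q ^ coset_size q N\<^sub>0 \<gamma>)
          then \<gamma> + int N\<^sub>0 * int (U_int q \<sigma> N\<^sub>0 2 \<gamma> i 1 + 2 ^ (i + 2) * t 1)
          else \<gamma> + int N\<^sub>0 * int (U_int q \<sigma> N\<^sub>0 (P 1) \<gamma> i (a 1) + P 1 ^ (i + 1) * t 1))"
| "gamma_seq q \<sigma> P j N\<^sub>0 \<gamma> (m, a, t) (Suc (Suc k)) =
     (let \<delta> = gamma_seq q \<sigma> P j N\<^sub>0 \<gamma> (m, a, t) (Suc k);
          k' = Suc (Suc k);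
          B = (\<Prod>i=1..<k'. P i ^ j i) * N\<^sub>0
      in case m k' of
           \<infinity> \<Rightarrow> \<delta> + int B * int (phi_trunc B (P k') \<delta> (j k' - 1))
         | enat i \<Rightarrow> \<delta> + int B * int (U_int q \<sigma> B (P k') \<delta> i (a k') + P k' ^ (i + 1) * t k'))"

definition y_exp :: "nat \<Rightarrow> (nat \<Rightarrow> nat) \<Rightarrow> (nat \<Rightarrow> nat) \<Rightarrow> (nat \<Rightarrow> nat) \<Rightarrow> nat \<Rightarrow> nat" where
  "y_exp q G e f k =
     (if k = 1 \<and> exceptional (G 1) q
      then nat (max 0 (min (int (f 1) - 1) (int (multiplicity (G 1) (q + 1)) - int (e 1))))
      else nat (min (int (f k)) (int (multiplicity (G k) (q - 1)) - int (e k))))"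

definition x_tuples ::
    "nat \<Rightarrow> nat \<Rightarrow> (nat \<Rightarrow> nat) \<Rightarrow> (nat \<Rightarrow> nat) \<Rightarrow> (nat \<Rightarrow> nat) \<Rightarrow> (nat \<Rightarrow> nat) set" where
  "x_tuples q u G e f = (\<Pi>\<^sub>E k\<in>{1..u}. {0..G k ^ y_exp q G e f k - 1})"

definition gamma_x ::
    "nat \<Rightarrow> nat \<Rightarrow> nat \<Rightarrow> (nat \<Rightarrow> nat) \<Rightarrow> (nat \<Rightarrow> nat) \<Rightarrow> (nat \<Rightarrow> nat) \<Rightarrow> int" where
  "gamma_x q g u G f x =
     1 + int g * int (\<Sum>k=1..u.
       (if k = 1 \<and> exceptional (G 1) q then G 1 else \<Prod>i=1..<k. G i ^ f i) * x k)"


section \<open>The ideals \<open>C\<^sub>\<Omega>\<close>\<close>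

definition code_ideal ::
    "nat \<Rightarrow> 'a::field \<Rightarrow> ((nat \<Rightarrow> nat) \<Rightarrow> index \<Rightarrow> 'a poly) \<Rightarrow> (nat \<Rightarrow> nat) set \<Rightarrow>
     ((nat \<Rightarrow> nat) \<Rightarrow> index set) \<Rightarrow> ((nat \<Rightarrow> nat) \<Rightarrow> index \<Rightarrow> nat) \<Rightarrow> 'a poly set set" where
  "code_ideal N lam M A J \<Omega> =
     PIdl\<^bsub>constacyclic_ring N lam\<^esub> (residue_class N lam (\<Prod>x\<in>A. \<Prod>I\<in>J x. M x I ^ \<Omega> x I))"

end

(*
  Over the algebraic closure, X^N - lambda is the p^v-th power of the separable polynomial
  X^n - lambda', whose roots are the zeta_{ng}^(h delta) with delta = 1 (mod g). Each
  M_{h gamma} is the product over one Frobenius orbit of such roots, hence prime in F_q[X].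
  A code corresponds to the ideal of a divisor d of X^N - lambda. Once every q-cyclotomic coset
  in 1 + gZ modulo ng contains some gamma_{x,I}, X^N - lambda divides the product of all
  M_{h gamma_{x,I}}^(p^v), so d is a unit times a product of powers of these primes with
  exponents at most p^v. Conversely every polynomial generates an ideal, which is a code. So only
  the covering property of the gamma_{x,I} matters: repetitions among them would do no harm.

  The covering property is proved one prime at a time. As B phi = -delta in Z_l, the valuation of
  z - phi is that of the integer delta + B z itself; stripping l^m leaves a unit w, whose orbit
  under q^theta is determined by w modulo l (up to powers of q^theta) and then by w modulo l^v,
  because R = q^(theta ord), with R - 1 of exact valuation v, generates 1 + l^v Z_l topologically.
  The size of the new coset, which governs r and v at the next prime, is the order of q^theta
  modulo l^(j-m) times theta.
*)

theory Submission
  imports Defs "Jordan_Normal_Form.Char_Poly"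
begin

section \<open>Powers of an integer close to 1\<close>

text \<open>The prime 2 shapes much of the proof. The group 1 + 2Z_2 is not procyclic, only 1 + 4Z_2
  is, so lifting exponents at 2 requires valuation at least 2. If Q = q^\<theta> is 3 modulo 4, the
  argument runs with Q^2, whose distance from 1 has valuation v_2(Q + 1) + 1, after at most one
  factor Q (which is -1 modulo 4) has matched residues modulo 4. This is the origin of the step
  2^(m+2), of the maximum with 1 in \<tau>_1, and of the extra factor g_1 in front of x_1. As the
  primes increase, 2 can occur only at the first position. The primes dividing g are treated in
  parallel: q is 1 modulo each of them, so its powers modulo a power of such a prime depend on the
  exponent modulo a power of the same prime, and exponents found separately are glued by the Chinese
  remainder theorem. For the primes p_k the orders of q may share factors, so exponents cannot be
  chosen independently; instead each stage multiplies only by powers of q that fix the class already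
  reached.\<close>

definition exact_at :: "nat \<Rightarrow> nat \<Rightarrow> int \<Rightarrow> bool" where
  "exact_at l v R \<longleftrightarrow> int l ^ v dvd R - 1 \<and> \<not> int l ^ Suc v dvd R - 1"

lemma exact_at_mono_dvd:
  assumes "exact_at l v R"
  shows "int l ^ k dvd R - 1 \<longleftrightarrow> k \<le> v"
proof
  assume "int l ^ k dvd R - 1"
  then show "k \<le> v"
    using assms unfolding exact_at_def by (meson dvd_trans le_imp_power_dvd not_less_eq_eq)
next
  assume "k \<le> v"
  then show "int l ^ k dvd R - 1"
    using assms unfolding exact_at_def by (meson dvd_trans le_imp_power_dvd)
qed

lemma exact_atI:
  assumes "prime l" "R - 1 = int l ^ v * c" "\<not> int l dvd c"
  shows "exact_at l v R"
  using assms by (auto simp: exact_at_def mult.commute[of "int l"])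

lemma exact_atE:
  assumes "prime l" "exact_at l v R"
  obtains c where "R - 1 = int l ^ v * c" "\<not> int l dvd c"
proof -
  obtain c where c: "R - 1 = int l ^ v * c"
    using assms by (auto simp: exact_at_def)
  moreover have "\<not> int l dvd c"
  proof
    assume "int l dvd c"
    then have "int l ^ v * int l dvd R - 1" using c by (simp add: mult_dvd_mono)
    then show False using assms by (simp add: exact_at_def mult.commute)
  qed
  ultimately show ?thesis using that by blast
qed

section \<open>Lifting the exponent: valuations of R^y - 1\<close>

lemma geometric_factor_int: "(x::int) ^ n - 1 = (x - 1) * (\<Sum>i<n. x ^ i)"
  by (simp add: power_diff_1_eq)

text \<open>The cofactor of R - 1 in R^y - 1 is a sum of y terms, each congruent to 1 modulo l; it
  is congruent to y, hence prime to l.\<close>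

lemma exact_at_power_coprime:
  assumes l: "prime l" and "v \<ge> 1" and R: "exact_at l v R" and y: "\<not> l dvd y"
  shows "exact_at l v (R ^ y)"
proof -
  obtain c where c: "R - 1 = int l ^ v * c" "\<not> int l dvd c"
    using exact_atE[OF l R] .
  have "[R = 1] (mod int l)"
    using R \<open>v \<ge> 1\<close> exact_at_mono_dvd[OF R, of 1] by (simp add: cong_iff_dvd_diff)
  then have "[(\<Sum>i<y. R ^ i) = (\<Sum>i<y. 1)] (mod int l)"
    by (intro cong_sum) (metis cong_pow power_one)
  then have "\<not> int l dvd (\<Sum>i<y. R ^ i)"
    using y by (simp add: cong_dvd_iff)
  then have "\<not> int l dvd c * (\<Sum>i<y. R ^ i)"
    using c(2) l by (simp add: prime_dvd_mult_iff)
  then show ?thesis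
    using c(1) by (intro exact_atI[OF l]) (simp_all add: geometric_factor_int[of R y])
qed

text \<open>The cofactor 1 + R + ... + R^(l-1) is congruent to l modulo l^2, so it contributes
  exactly one factor l. For l = 2 this relies on R being 1 modulo 4: with R = 3 and v = 1 the
  valuation jumps from 1 to 3.\<close>

lemma exact_at_power_prime:
  assumes l: "prime l" and v: "v \<ge> 1" and v2: "l = 2 \<longrightarrow> v \<ge> 2" and R: "exact_at l v R"
  shows "exact_at l (Suc v) (R ^ l)"
proof -
  obtain c where c: "R - 1 = int l ^ v * c" "\<not> int l dvd c"
    using exact_atE[OF l R] .
  have l0: "l > 0" using l by (simp add: prime_gt_0_nat)
  define z where "z = int l ^ v * c"
  have R_eq: "R = 1 + z" using c(1) by (simp add: z_def)
  have vv: "int l ^ 2 dvd z ^ 2"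
  proof -
    have "int l ^ 2 dvd int l ^ (v * 2)" using v by (intro le_imp_power_dvd) simp
    then show ?thesis by (simp add: z_def power_mult_distrib power_mult)
  qed
  \<comment> \<open>The binomial expansion stops at the linear term, since l^2 divides z^2.\<close>
  have pw: "[R ^ i = 1 + int i * z] (mod int l ^ 2)" for i
  proof (induction i)
    case (Suc i)
    have "[R ^ Suc i = (1 + int i * z) * (1 + z)] (mod int l ^ 2)"
      using cong_mult[OF Suc cong_refl[of "1 + z"]] R_eq by (simp add: mult.commute)
    also have "(1 + int i * z) * (1 + z) = 1 + int (Suc i) * z + int i * z ^ 2"
      by (simp add: algebra_simps power2_eq_square)
    also have "[\<dots> = 1 + int (Suc i) * z + 0] (mod int l ^ 2)"
      using vv by (intro cong_add cong_refl) (simp add: cong_0_iff)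
    finally show ?case by simp
  qed simp
  have "[(\<Sum>i<l. R ^ i) = (\<Sum>i<l. 1 + int i * z)] (mod int l ^ 2)"
    by (intro cong_sum pw)
  also have "(\<Sum>i<l. 1 + int i * z) = int l + z * int (\<Sum>i<l. i)"
    by (simp add: sum.distrib sum_distrib_left mult.commute)
  also have "[\<dots> = int l + 0] (mod int l ^ 2)"
  proof (intro cong_add cong_refl)
    show "[z * int (\<Sum>i<l. i) = 0] (mod int l ^ 2)"
    \<comment> \<open>The triangular number l(l-1)/2 is divisible by l only for odd l; for l = 2 the
      missing factor comes from z, which is divisible by 4.\<close>
    proof (cases "l = 2")
      case True
      then have "int l ^ 2 dvd z"
        using v2 unfolding z_def by (metis dvd_mult2 le_imp_power_dvd)
      then show ?thesis by (simp add: cong_0_iff)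
    next
      case False
      then have "odd l" using l prime_odd_nat[of l] prime_ge_2_nat[of l] by linarith
      have "(\<Sum>i<l. i) * 2 = l * (l - 1)"
        using gauss_sum_nat[of "l - 1"] l0 
        by (simp add: lessThan_Suc_atMost[symmetric] atMost_atLeast0[symmetric] mult.commute)
      then have "l dvd (\<Sum>i<l. i) * 2" by simp
      then have "l dvd (\<Sum>i<l. i)"
        using \<open>odd l\<close> by (simp add: coprime_dvd_mult_left_iff)
      moreover have "int l dvd z" using v by (simp add: z_def dvd_power)
      ultimately have "int l * int l dvd z * int (\<Sum>i<l. i)"
        by (intro mult_dvd_mono) (simp_all only: int_dvd_int_iff)
      then show ?thesis by (simp add: cong_0_iff power2_eq_square)
    qed
  qed
  finally have "int l ^ 2 dvd (\<Sum>i<l. R ^ i) - int l"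
    by (simp add: cong_iff_dvd_diff)
  then obtain b where b: "(\<Sum>i<l. R ^ i) - int l = int l ^ 2 * b" ..
  then have S: "(\<Sum>i<l. R ^ i) = int l * (1 + int l * b)"
    by (simp add: algebra_simps power2_eq_square)
  have "\<not> int l dvd 1 + int l * b"
  proof
    assume "int l dvd 1 + int l * b"
    then have "int l dvd 1" by (metis dvd_add_left_iff dvd_triv_left)
    then show False using l by (auto simp: prime_nat_iff)
  qed
  then have "\<not> int l dvd c * (1 + int l * b)"
    using c(2) l by (simp add: prime_dvd_mult_iff)
  then show ?thesis
    using c(1) S by (intro exact_atI[OF l]) (simp_all add: geometric_factor_int[of R l])
qed

lemma exact_at_power_prime_power:
  assumes "prime l" "v \<ge> 1" "l = 2 \<longrightarrow> v \<ge> 2" "exact_at l v R"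
  shows "exact_at l (v + n) (R ^ (l ^ n))"
proof (induction n)
  case (Suc n)
  have "exact_at l (Suc (v + n)) ((R ^ (l ^ n)) ^ l)"
    using Suc assms by (intro exact_at_power_prime) auto
  then show ?case by (simp add: power_mult[symmetric] mult.commute)
qed (use assms in simp)

text \<open>Writing y = l^n y' with y' prime to l, R^y - 1 has valuation v + n. So R has order
  l^(k-v) modulo l^k; the truncated difference covers k \<le> v, where the order is 1.\<close>

lemma power_cong_1_iff:
  assumes l: "prime l" and v: "v \<ge> 1" and v2: "l = 2 \<longrightarrow> v \<ge> 2" and R: "exact_at l v R"
  shows "int l ^ k dvd R ^ y - 1 \<longleftrightarrow> l ^ (k - v) dvd y"
proof (cases "y = 0")
  case False
  obtain n y' where y: "y = l ^ n * y'" "\<not> l dvd y'"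
    using multiplicity_decompose'[OF False, of l] l
    by (metis False multiplicity_decompose' not_prime_unit)
  have "exact_at l (v + n) ((R ^ (l ^ n)) ^ y')"
    by (rule exact_at_power_coprime[OF l _ exact_at_power_prime_power[OF assms] y(2)]) (use v in simp)
  then have "exact_at l (v + n) (R ^ y)"
    by (simp add: y(1) power_mult)
  then have "int l ^ k dvd R ^ y - 1 \<longleftrightarrow> k \<le> v + n" by (rule exact_at_mono_dvd)
  also have "\<dots> \<longleftrightarrow> k - v \<le> n" by auto
  also have "\<dots> \<longleftrightarrow> l ^ (k - v) dvd y"
  proof -
    have "multiplicity l y = n"
      using y l by (simp add: prime_elem_multiplicity_eq_zero_iff multiplicity_eqI)
    then show ?thesis using False l
      by (metis multiplicity_dvd' not_prime_unit power_dvd_iff_le_multiplicity)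
  qed
  finally show ?thesis .
qed simp

text \<open>Successive approximation in the exponent: a solution modulo l^(v+n) is corrected by a
  power of S = R^(l^n), which is 1 modulo l^(v+n) but not modulo the next power of l.\<close>

lemma orbit_prime_power:
  assumes l: "prime l" and v: "v \<ge> 1" and v2: "l = 2 \<longrightarrow> v \<ge> 2" and R: "exact_at l v R"
    and w: "\<not> int l dvd w" and ww: "[w = w'] (mod int l ^ v)"
  shows "\<exists>i. [R ^ i * w = w'] (mod int l ^ n)"
proof -
  have "\<exists>i. [R ^ i * w = w'] (mod int l ^ (v + n))"
  proof (induction n)
    case 0
    show ?case using ww by (intro exI[of _ 0]) simp
  next
    case (Suc n)
    then obtain i where i: "[R ^ i * w = w'] (mod int l ^ (v + n))" by blast
    then obtain a where a: "R ^ i * w - w' = int l ^ (v + n) * a"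
      by (auto simp: cong_iff_dvd_diff)
    define S where "S = R ^ (l ^ n)"
    obtain c where c: "S - 1 = int l ^ (v + n) * c" "\<not> int l dvd c"
      using exact_atE[OF l exact_at_power_prime_power[OF l v v2 R, of n]] unfolding S_def .
    have "[R = 1] (mod int l)"
      using R v exact_at_mono_dvd[OF R, of 1] by (simp add: cong_iff_dvd_diff)
    then have "[R ^ i = 1] (mod int l)" by (metis cong_pow power_one)
    then have "\<not> int l dvd R ^ i"
      using l by (metis cong_dvd_iff int_dvd_int_iff not_prime_unit of_nat_1)
    then have "coprime (c * (R ^ i * w)) (int l)"
      using w c(2) l prime_imp_coprime[of "int l"]
      by (metis coprime_commute prime_dvd_mult_iff prime_nat_int_transfer)
    \<comment> \<open>To first order, the factor S^k adds k c R^i w to the error coefficient a. As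
      c, R^i and w are units modulo l, some k cancels it.\<close>
    then obtain x where x: "[c * (R ^ i * w) * x = - a] (mod int l)"
      using cong_solve_coprime_int[of "c * (R ^ i * w)" "int l"] 
      by (metis cong_scalar_right mult.assoc mult.commute mult.right_neutral)
    define k where "k = nat (x mod int l)"
    have "int k = x mod int l" using l by (simp add: k_def prime_gt_0_nat)
    then have "[int k = x] (mod int l)" by simp
    then have k: "[c * (R ^ i * w) * int k = - a] (mod int l)"
      using x by (meson cong_scalar_left cong_trans)
    let ?M = "int l ^ (v + n)"
    have MM: "int l ^ (v + Suc n) = int l * ?M" by simp
    have dM: "int l dvd ?M" using v by (simp add: dvd_power)
    \<comment> \<open>The quadratic term carries l^(2(v+n)), which is divisible by l^(v+n+1) because
      v \<ge> 1.\<close>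
    have Sk: "[S ^ y = 1 + int y * (?M * c)] (mod int l * ?M)" for y
    proof (induction y)
      case (Suc y)
      have "[S ^ Suc y = (1 + int y * (?M * c)) * (1 + ?M * c)] (mod int l * ?M)"
        using cong_mult[OF Suc cong_refl[of "1 + ?M * c"]] c(1) by (simp add: mult.commute algebra_simps)
      also have "(1 + int y * (?M * c)) * (1 + ?M * c)
          = 1 + int (Suc y) * (?M * c) + ?M * ?M * (int y * c * c)"
        by (simp add: algebra_simps)
      also have "[\<dots> = 1 + int (Suc y) * (?M * c) + 0] (mod int l * ?M)"
        using dM by (intro cong_add cong_refl) (simp add: cong_0_iff mult_dvd_mono)
      finally show ?case by simp
    qed simp
    have "[R ^ (i + l ^ n * k) * w = (1 + int k * (?M * c)) * (R ^ i * w)] (mod int l * ?M)"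
    proof -
      have "R ^ (i + l ^ n * k) * w = S ^ k * (R ^ i * w)"
        by (simp only: S_def power_add power_mult) (simp only: mult_ac)
      then show ?thesis using cong_scalar_right[OF Sk[of k], of "R ^ i * w"] by (simp only:)
    qed
    also have "(1 + int k * (?M * c)) * (R ^ i * w) = w' + ?M * (a + c * (R ^ i * w) * int k)"
      using a by (simp add: algebra_simps)
    also have "[\<dots> = w' + 0] (mod int l * ?M)"
    proof (intro cong_add cong_refl)
      have "int l dvd a + c * (R ^ i * w) * int k"
        using k by (simp add: cong_iff_dvd_diff algebra_simps)
      then show "[?M * (a + c * (R ^ i * w) * int k) = 0] (mod int l * ?M)"
        by (simp add: cong_0_iff mult.commute[of "int l"] mult_dvd_mono)
    qed
    finally show ?case unfolding MM by (intro exI[of _ "i + l ^ n * k"]) simp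
  qed
  then show ?thesis
    by (meson cong_dvd_modulus le_add2 le_imp_power_dvd)
qed

text \<open>Here q - 1 is twice an odd number, so passing from q + 1 to q^2 - 1 raises the valuation
  by exactly one. This is the source of v + 1 in the exceptional case.\<close>

lemma exact_at_square:
  assumes "q mod 4 = 3"
  shows "multiplicity 2 (q + 1) \<ge> 2" "exact_at 2 (multiplicity 2 (q + 1) + 1) (int q ^ 2)"
proof -
  define v where "v = multiplicity 2 (q + 1)"
  have "2 ^ 2 dvd q + 1" using assms by simp presburger
  then show "multiplicity 2 (q + 1) \<ge> 2" by (subst (asm) power_dvd_iff_le_multiplicity) auto
  obtain c where c: "q + 1 = 2 ^ v * c" "\<not> 2 dvd c"
    using multiplicity_decompose'[of "q + 1" 2] unfolding v_def by auto
  obtain b where b: "q = 4 * b + 3" using assms by (metis div_mult_mod_eq mult.commute)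
  have "int q ^ 2 - 1 = (int q - 1) * (int q + 1)" by (simp add: algebra_simps power2_eq_square)
  also have "int q - 1 = 2 * (2 * int b + 1)" using b by simp
  also have "int q + 1 = 2 ^ v * int c"
    using c(1) by (metis of_nat_1 of_nat_add of_nat_mult of_nat_numeral of_nat_power)
  finally have "int q ^ 2 - 1 = int 2 ^ (v + 1) * ((2 * int b + 1) * int c)" by simp
  moreover have "\<not> int 2 dvd (2 * int b + 1) * int c" using c(2) by simp
  ultimately show "exact_at 2 (multiplicity 2 (q + 1) + 1) (int q ^ 2)"
    unfolding v_def by (intro exact_atI) auto
qed

lemma exact_at_multiplicity:
  assumes "prime l" "R > (1::nat)"
  shows "exact_at l (multiplicity l (R - 1)) (int R)"
proof -
  have "int R - 1 = int (R - 1)" using assms by simp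
  moreover have "l ^ multiplicity l (R - 1) dvd R - 1" by (rule multiplicity_dvd)
  moreover have "\<not> l ^ Suc (multiplicity l (R - 1)) dvd R - 1"
    using assms by (subst power_dvd_iff_le_multiplicity) (auto simp: prime_gt_1_nat)
  ultimately show ?thesis
    unfolding exact_at_def by (metis int_dvd_int_iff of_nat_power)
qed

section \<open>Digits, coset sizes and unit indices\<close>

lemma padic_digits_unique:
  fixes d d' :: "nat \<Rightarrow> nat"
  assumes l: "l > 1" and B: "coprime B l"
    and d: "\<And>k. d k < l" "\<And>i. [int B * int (\<Sum>k\<le>i. d k * l ^ k) = - \<delta>] (mod int l ^ (i + 1))"
    and d': "\<And>k. d' k < l" "\<And>i. [int B * int (\<Sum>k\<le>i. d' k * l ^ k) = - \<delta>] (mod int l ^ (i + 1))"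
  shows "d = d'"
proof
  fix k
  show "d k = d' k"
  proof (induction k rule: less_induct)
    case (less k)
    have "[int B * int (\<Sum>k\<le>k. d k * l ^ k) = int B * int (\<Sum>k\<le>k. d' k * l ^ k)] (mod int (l ^ (k + 1)))"
      unfolding of_nat_power by (rule cong_trans[OF d(2) cong_sym[OF d'(2)]])
    then have "[B * (\<Sum>k\<le>k. d k * l ^ k) = B * (\<Sum>k\<le>k. d' k * l ^ k)] (mod (l ^ (k + 1)))"
      by (simp only: of_nat_mult[symmetric] cong_int_iff)
    then have "[\<Sum>k\<le>k. d k * l ^ k = (\<Sum>k\<le>k. d' k * l ^ k)] (mod (l ^ (k + 1)))"
      using B by (subst (asm) cong_mult_lcancel_nat) (simp_all only: coprime_power_right_iff simp_thms)
    moreover have "(\<Sum>k<k. d k * l ^ k) = (\<Sum>k<k. d' k * l ^ k)"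
      using less by (intro sum.cong) auto
    ultimately have "[d k * l ^ k = d' k * l ^ k] (mod (l ^ k * l))"
      by (simp add: lessThan_Suc_atMost[symmetric] cong_add_lcancel_nat mult.commute)
    then have "[d k = d' k] (mod l)"
      using l by (simp add: cong_def mult.commute[of _ "l ^ k"] mult_mod_right[symmetric])
    then show ?case using d(1) d'(1) by (simp add: cong_less_modulus_unique_nat)
  qed
qed

text \<open>Solving B x = -\<delta> modulo each power of l and reducing to least residues gives
  compatible approximations \<open>xr\<close>, whose digits are read off by division. Together with
  uniqueness this gives meaning to the \<open>THE\<close> in \<open>padic_digits\<close>.\<close>

lemma padic_digits_exist:
  assumes l: "l > 1" and B: "coprime B l"
  shows "\<exists>d. (\<forall>k. d k < l) \<and>
     (\<forall>i. [int B * int (\<Sum>k\<le>i. d k * l ^ k) = - \<delta>] (mod int l ^ (i + 1)))"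
proof -
  have "\<exists>x. [int B * x = - \<delta>] (mod int l ^ i)" for i
    using cong_solve_coprime_int[of "int B" "int l ^ i"] B
    by (metis cong_scalar_right coprime_int_iff coprime_power_right_iff mult.assoc mult.left_neutral of_nat_power)
  then obtain x where x: "\<And>i. [int B * x i = - \<delta>] (mod int l ^ i)" by metis
  define xr where "xr i = nat (x i mod int l ^ i)" for i
  have xr_int: "int (xr i) = x i mod int l ^ i" for i
    using l by (simp add: xr_def)
  have xr_less: "xr i < l ^ i" for i
  proof -
    have "int (xr i) < int (l ^ i)" using l by (simp add: xr_int)
    then show ?thesis by (simp only: of_nat_less_iff)
  qed
  have Bxr: "[int B * int (xr i) = - \<delta>] (mod int l ^ i)" for i
    unfolding xr_int using x[of i] by (metis cong_mod_left cong_def mod_mult_right_eq)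
  have xrxr: "xr (Suc i) mod l ^ i = xr i" for i
  proof -
    have "[int B * int (xr (Suc i)) = int B * int (xr i)] (mod int (l ^ i))"
      unfolding of_nat_power
      by (rule cong_trans[OF cong_dvd_modulus[OF Bxr[of "Suc i"]] cong_sym[OF Bxr[of i]]]) simp
    then have "[B * xr (Suc i) = B * xr i] (mod l ^ i)"
      by (simp only: of_nat_mult[symmetric] cong_int_iff)
    then have "[xr (Suc i) = xr i] (mod l ^ i)"
      using B by (subst (asm) cong_mult_lcancel_nat) (simp_all only: coprime_power_right_iff simp_thms)
    then show ?thesis using xr_less[of i] by (simp add: cong_def)
  qed
  define d where "d k = xr (Suc k) div l ^ k" for k
  have "d k < l" for k
    using xr_less[of "Suc k"] by (simp add: d_def less_mult_imp_div_less)
  moreover have sumxr: "(\<Sum>k\<le>i. d k * l ^ k) = xr (Suc i)" for i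
  proof (induction i)
    case 0
    then show ?case by (simp add: d_def)
  next
    case (Suc i)
    have "(\<Sum>k\<le>Suc i. d k * l ^ k) = xr (Suc i) + d (Suc i) * l ^ Suc i"
      using Suc by simp
    also have "\<dots> = xr (Suc (Suc i))"
      using xrxr[of "Suc i"] unfolding d_def by (metis add.commute div_mult_mod_eq)
    finally show ?case .
  qed
  ultimately show ?thesis
    using Bxr[of "Suc i" for i] by (intro exI[of _ d]) (simp del: of_nat_sum power_Suc)
qed

lemma padic_digits:
  assumes "l > 1" "coprime B l"
  shows padic_digits_less: "padic_digits B l \<delta> k < l"
    and padic_digits_dvd: "int l ^ (i + 1) dvd \<delta> + int B * int (\<Sum>k\<le>i. padic_digits B l \<delta> k * l ^ k)"
proof -
  let ?P = "\<lambda>d. (\<forall>k. d k < l) \<and>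
     (\<forall>i. [int B * int (\<Sum>k\<le>i. d k * l ^ k) = - \<delta>] (mod int l ^ (i + 1)))"
  have "\<exists>!d. ?P d"
    using padic_digits_exist[OF assms] padic_digits_unique[OF assms] by blast
  then have *: "?P (padic_digits B l \<delta>)"
    unfolding padic_digits_def by (rule theI')
  then show "padic_digits B l \<delta> k < l" by blast
  have "[int B * int (\<Sum>k\<le>i. padic_digits B l \<delta> k * l ^ k) = - \<delta>] (mod int l ^ (i + 1))"
    using * by blast
  then show "int l ^ (i + 1) dvd \<delta> + int B * int (\<Sum>k\<le>i. padic_digits B l \<delta> k * l ^ k)"
    by (simp add: cong_iff_dvd_diff add.commute)
qed

text \<open>The least period divides every period, by division with remainder, and the order of q
  modulo M shows that a period exists. For \<gamma> not prime to M the size may be a proper divisor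
  of that order.\<close>

lemma coset_size_props:
  assumes M: "coprime M q"
  shows coset_size_pos: "coset_size q M \<gamma> > 0"
    and cong_power_iff_coset_size_dvd: "[\<gamma> * int q ^ \<tau> = \<gamma>] (mod int M) \<longleftrightarrow> coset_size q M \<gamma> dvd \<tau>"
proof -
  let ?P = "\<lambda>\<tau>. [\<gamma> * int q ^ \<tau> = \<gamma>] (mod int M)"
  define \<theta> where "\<theta> = coset_size q M \<gamma>"
  have "ord M q > 0 \<and> ?P (ord M q)"
    using M ord[of q M] by (metis cong_int_iff cong_scalar_left mult.right_neutral of_nat_1 of_nat_power ord_gt_0_iff)
  then have \<theta>: "\<theta> > 0" "?P \<theta>"
    unfolding \<theta>_def coset_size_def by (rule LeastI2; blast)+
  have mult: "?P (\<theta> * k)" for k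
  proof (induction k)
    case (Suc k)
    have "\<gamma> * int q ^ (\<theta> * Suc k) = \<gamma> * int q ^ \<theta> * int q ^ (\<theta> * k)"
      by (simp add: power_add)
    also have "[\<dots> = \<gamma> * int q ^ (\<theta> * k)] (mod int M)"
      using \<theta>(2) by (rule cong_scalar_right)
    finally show ?case using Suc by (rule cong_trans)
  qed simp
  have "?P \<tau> \<longleftrightarrow> \<theta> dvd \<tau>"
  proof
    assume P: "?P \<tau>"
    have "[\<gamma> * int q ^ (\<theta> * (\<tau> div \<theta>)) * int q ^ (\<tau> mod \<theta>) = \<gamma> * int q ^ (\<tau> mod \<theta>)] (mod int M)"
      using mult by (rule cong_scalar_right)
    then have "[\<gamma> * int q ^ \<tau> = \<gamma> * int q ^ (\<tau> mod \<theta>)] (mod int M)"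
      by (simp add: mult.assoc power_add[symmetric])
    then have P': "?P (\<tau> mod \<theta>)" using P by (rule cong_trans[OF cong_sym])
    have "\<tau> mod \<theta> < \<theta>" using \<theta>(1) by simp
    have "\<theta> \<le> \<tau> mod \<theta>" if "\<tau> mod \<theta> > 0"
      using that P' unfolding \<theta>_def coset_size_def by (intro Least_le conjI)
    with \<open>\<tau> mod \<theta> < \<theta>\<close> have "\<tau> mod \<theta> = 0" by linarith
    then show "\<theta> dvd \<tau>" by auto
  qed (use mult in auto)
  then show "coset_size q M \<gamma> > 0" "?P \<tau> \<longleftrightarrow> coset_size q M \<gamma> dvd \<tau>"
    using \<theta>(1) unfolding \<theta>_def by auto
qed

text \<open>A natural number is determined by its multiples. Sizes are computed below by describing
  all periods at once instead of arguing with minimality.\<close>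

lemma coset_size_eqI:
  assumes "coprime M q" "\<And>\<tau>. [\<gamma> * int q ^ \<tau> = \<gamma>] (mod int M) \<longleftrightarrow> d dvd \<tau>"
  shows "coset_size q M \<gamma> = d"
  using assms cong_power_iff_coset_size_dvd[OF assms(1)] by (intro dvd_antisym) (meson dvd_refl)+

lemma coset_size_cong:
  assumes "[\<gamma> = \<gamma>'] (mod int M)"
  shows "coset_size q M \<gamma> = coset_size q M \<gamma>'"
proof -
  have "[\<gamma> * x = \<gamma>] (mod int M) \<longleftrightarrow> [\<gamma>' * x = \<gamma>'] (mod int M)" for x
    using assms by (meson cong_scalar_right cong_sym cong_trans)
  then show ?thesis by (simp add: coset_size_def)
qed

section \<open>The unit group modulo a prime and the subgroup generated by one element\<close>

context
  fixes l :: nat assumes l: "prime l"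
begin

interpretation RP: residues_prime l "residue_ring (int l)"
  by unfold_locales (use l in auto)

interpretation UG: comm_group "unit_group l"
  unfolding unit_group_def by (rule RP.units_comm_group)

lemma carrier_unit_group: "carrier (unit_group l) = {1..int l - 1}"
  unfolding unit_group_def using RP.res_prime_units_eq prime_gt_1_nat[OF l] by (simp add: units_of_def)

lemma mult_unit_group: "x \<otimes>\<^bsub>unit_group l\<^esub> y = (x * y) mod int l"
  by (simp add: unit_group_def units_of_def RP.res_mult_eq)

lemma mod_in_unit_group: "\<not> int l dvd w \<Longrightarrow> w mod int l \<in> carrier (unit_group l)"
  using prime_gt_0_nat[OF l] pos_mod_bound[of "int l" w] pos_mod_sign[of "int l" w]
  by (auto simp: carrier_unit_group dvd_eq_mod_eq_0 simp del: pos_mod_sign pos_mod_bound)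

lemma pow_unit_group:
  "(w mod int l) [^]\<^bsub>unit_group l\<^esub> (n::nat) = w ^ n mod int l"
proof (induction n)
  case 0
  then show ?case using prime_gt_1_nat[OF l] by (simp add: unit_group_def units_of_def RP.res_one_eq)
next
  case (Suc n)
  then show ?case by (simp add: mult_unit_group mod_mult_eq mult.commute)
qed

lemma one_unit_group: "\<one>\<^bsub>unit_group l\<^esub> = 1"
  by (simp add: unit_group_def units_of_def RP.res_one_eq)

lemma unit_group_ord:
  assumes "\<not> l dvd a"
  shows "UG.ord (int a mod int l) = ord l a"
proof -
  have a: "int a mod int l \<in> carrier (unit_group l)"
    using assms mod_in_unit_group by simp
  have "UG.ord (int a mod int l) dvd n \<longleftrightarrow> ord l a dvd n" for n
  proof -
    have "UG.ord (int a mod int l) dvd n \<longleftrightarrow> (int a mod int l) [^]\<^bsub>unit_group l\<^esub> n = \<one>\<^bsub>unit_group l\<^esub>"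
      using UG.pow_eq_id[OF a] by simp
    also have "\<dots> \<longleftrightarrow> int a ^ n mod int l = 1 mod int l"
      using prime_gt_1_nat[OF l] by (simp add: pow_unit_group one_unit_group)
    also have "\<dots> \<longleftrightarrow> [a ^ n = 1] (mod l)"
      unfolding cong_int_iff[symmetric] by (simp add: cong_def)
    also have "\<dots> \<longleftrightarrow> ord l a dvd n" by (rule ord_divides)
    finally show ?thesis .
  qed
  then show ?thesis by (meson dvd_antisym dvd_refl)
qed

lemma power_subgroup_subgroup:
  assumes "\<not> l dvd a"
  shows "subgroup (power_subgroup l a) (unit_group l)"
  unfolding power_subgroup_def using mod_in_unit_group[of "int a"] assms
  by (intro UG.generate_is_subgroup) simp

lemma finite_unit_group: "finite (carrier (unit_group l))"
  by (simp add: carrier_unit_group)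

text \<open>In a finite group inverses are themselves powers with natural exponents.\<close>

lemma power_subgroup_eq:
  assumes "\<not> l dvd a"
  shows "power_subgroup l a = {int a ^ n mod int l | n. True}"
proof -
  have a: "int a mod int l \<in> carrier (unit_group l)"
    using assms mod_in_unit_group by simp
  have "generate (unit_group l) {int a mod int l} = {(int a mod int l) [^]\<^bsub>unit_group l\<^esub> k | k::nat. k \<in> UNIV}"
    using UG.generate_pow_nat[OF a] UG.ord_ge_1[OF finite_unit_group a] by simp
  then show ?thesis unfolding power_subgroup_def by (simp add: pow_unit_group)
qed

text \<open>Lagrange's theorem. It identifies (l - 1)/r, which occurs in the formulas for \<tau>_k
  and v_k, as the order of q^\<theta> modulo l.\<close>

lemma unit_index_mult_ord:
  assumes "\<not> l dvd a"
  shows "unit_index l a * ord l a = l - 1"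
proof -
  have a: "int a mod int l \<in> carrier (unit_group l)"
    using assms mod_in_unit_group by simp
  have "card (rcosets\<^bsub>unit_group l\<^esub> (power_subgroup l a)) * card (power_subgroup l a) = Coset.order (unit_group l)"
    using UG.lagrange[OF power_subgroup_subgroup[OF assms]] .
  moreover have "card (power_subgroup l a) = ord l a"
    using UG.generate_pow_card[OF a] unit_group_ord[OF assms] by (simp add: power_subgroup_def)
  moreover have "Coset.order (unit_group l) = l - 1"
    by (simp add: Coset.order_def carrier_unit_group)
  ultimately show ?thesis by (simp add: unit_index_def)
qed

text \<open>Sending x to its coset is a bijection from S to the set of cosets, so S has exactly r
  elements, and the positions 1, ..., r in its sorted list exhaust it.\<close>

lemma full_rep_setD:
  assumes a: "\<not> l dvd a" and S: "full_rep_set l a S"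
  shows "finite S" "card S = unit_index l a"
    and "\<not> int l dvd w \<Longrightarrow> \<exists>x\<in>S. \<exists>i. [int x = int a ^ i * w] (mod int l)"
proof -
  let ?H = "power_subgroup l a" and ?G = "unit_group l"
  have sub: "S \<subseteq> {1..l - 1}" using S by (simp add: full_rep_set_def)
  then show "finite S" using finite_subset by blast
  have cosets: "\<exists>!x. x \<in> S \<and> int x \<in> K" if "K \<in> rcosets\<^bsub>?G\<^esub> ?H" for K
    using S that by (simp add: full_rep_set_def)
  have carr: "int x \<in> carrier ?G" if "x \<in> S" for x
  proof -
    have "x \<in> {1..l - 1}" using sub that by blast
    then show ?thesis using prime_gt_0_nat[OF l] by (auto simp: carrier_unit_group)
  qed
  have HG: "subgroup ?H ?G" using power_subgroup_subgroup[OF a] .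
  have "bij_betw (\<lambda>x. ?H #>\<^bsub>?G\<^esub> int x) S (rcosets\<^bsub>?G\<^esub> ?H)"
    unfolding bij_betw_def
  proof
    show "inj_on (\<lambda>x. ?H #>\<^bsub>?G\<^esub> int x) S"
    proof
      fix x y assume xy: "x \<in> S" "y \<in> S" "?H #>\<^bsub>?G\<^esub> int x = ?H #>\<^bsub>?G\<^esub> int y"
      then have "int x \<in> ?H #>\<^bsub>?G\<^esub> int x" "int y \<in> ?H #>\<^bsub>?G\<^esub> int x"
        using UG.rcos_self[OF carr HG] by auto
      moreover have K: "?H #>\<^bsub>?G\<^esub> int x \<in> rcosets\<^bsub>?G\<^esub> ?H"
        using carr[OF xy(1)] unfolding RCOSETS_def by blast
      ultimately show "x = y" using cosets[OF K] xy(1,2) by blast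
    qed
    show "(\<lambda>x. ?H #>\<^bsub>?G\<^esub> int x) ` S = rcosets\<^bsub>?G\<^esub> ?H"
    proof
      show "(\<lambda>x. ?H #>\<^bsub>?G\<^esub> int x) ` S \<subseteq> rcosets\<^bsub>?G\<^esub> ?H"
        using carr unfolding RCOSETS_def by blast
      show "rcosets\<^bsub>?G\<^esub> ?H \<subseteq> (\<lambda>x. ?H #>\<^bsub>?G\<^esub> int x) ` S"
      proof
        fix K assume K: "K \<in> rcosets\<^bsub>?G\<^esub> ?H"
        then obtain x where x: "x \<in> S" "int x \<in> K" using cosets[OF K] by blast
        obtain z where z: "z \<in> carrier ?G" "K = ?H #>\<^bsub>?G\<^esub> z" using K unfolding RCOSETS_def by blast
        then have "K = ?H #>\<^bsub>?G\<^esub> int x"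
          using UG.repr_independence[OF _ z(1) HG] x(2) by simp
        then show "K \<in> (\<lambda>x. ?H #>\<^bsub>?G\<^esub> int x) ` S" using x by blast
      qed
    qed
  qed
  then show "card S = unit_index l a"
    unfolding unit_index_def by (rule bij_betw_same_card)
  assume w: "\<not> int l dvd w"
  then have K: "?H #>\<^bsub>?G\<^esub> (w mod int l) \<in> rcosets\<^bsub>?G\<^esub> ?H"
    using mod_in_unit_group[OF w] unfolding RCOSETS_def by blast
  then obtain x where x: "x \<in> S" "int x \<in> ?H #>\<^bsub>?G\<^esub> (w mod int l)"
    using cosets[OF K] by blast
  then obtain i where "int x = (int a ^ i mod int l) \<otimes>\<^bsub>?G\<^esub> (w mod int l)"
    unfolding power_subgroup_eq[OF a] r_coset_def by blast
  then have "[int x = int a ^ i * w] (mod int l)"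
    by (simp add: mult_unit_group mod_mult_eq cong_def)
  then show "\<exists>x\<in>S. \<exists>i. [int x = int a ^ i * w] (mod int l)" using x(1) by blast
qed

end

section \<open>Leading digits realised by the integers U\<close>

lemma nth_smallest_surj:
  assumes "finite S" "x \<in> S"
  shows "\<exists>a\<in>{1..card S}. nth_smallest S a = x"
proof -
  have "x \<in> set (sorted_list_of_set S)" using assms by simp
  then obtain i where "i < card S" "sorted_list_of_set S ! i = x"
    unfolding in_set_conv_nth using length_sorted_list_of_set[of S] by auto
  then show ?thesis by (intro bexI[of _ "Suc i"]) (auto simp: nth_smallest_def)
qed

text \<open>The parameter a selects the digit u at position m, and w is the wanted value of u -
  \<phi>_m. If l divides Q - 1, the subgroup generated by Q is trivial and a runs through all digits
  different from \<phi>_m, so w is met exactly. Otherwise the differences run through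
  representatives of the cosets, and w is met up to a power of Q.\<close>

lemma U_int_surj:
  fixes q B l :: nat and \<delta> w :: int
  defines "Q \<equiv> q ^ coset_size q B \<delta>"
  assumes l: "prime l" and B: "\<not> l dvd B" and q: "\<not> l dvd q" "q > 0"
    and S: "full_rep_set l Q (\<sigma> B l \<delta>)" and w: "\<not> int l dvd w"
  shows "\<exists>a\<in>{1..unit_index l Q}. \<exists>u i.
    U_int q \<sigma> B l \<delta> m a = (\<Sum>k<m. padic_digits B l \<delta> k * l ^ k) + u * l ^ m \<and>
    [int u - int (padic_digits B l \<delta> m) = int Q ^ i * w] (mod int l)"
proof -
  let ?d = "padic_digits B l \<delta>"
  have l1: "l > 1" using l by (rule prime_gt_1_nat)
  have dl: "?d m < l"
    using padic_digits_less[OF l1] prime_imp_coprime[OF l B] by (simp add: coprime_commute)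
  have Q: "\<not> l dvd Q" "Q > 0"
    using q prime_dvd_power[OF l] unfolding Q_def by (blast, simp)
  show ?thesis
  proof (cases "l dvd Q - 1")
    case True
    define u where "u = nat ((int (?d m) + w) mod int l)"
    have u: "int u = (int (?d m) + w) mod int l" using l1 by (simp add: u_def)
    have "u < l" using u l1 by (simp add: u_def nat_less_iff)
    have "[Q = 1] (mod l)" unfolding cong_def
      by (rule iffD2[OF mod_eq_dvd_iff_nat]) (use True Q(2) in auto)
    then have "unit_index l Q = l - 1"
      using unit_index_mult_ord[OF l Q(1)] by (simp add: ord_eq_Suc_0_iff[THEN iffD2])
    have cong: "[int u - int (?d m) = w] (mod int l)"
      unfolding u by (simp add: cong_def mod_simps)
    have "u \<noteq> ?d m"
    proof
      assume "u = ?d m"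
      then have "[0 = w] (mod int l)" using cong by simp
      then show False using w by (metis cong_0_iff cong_sym)
    qed
    then have "u \<in> {0..l - 1} - {?d m}" using \<open>u < l\<close> by auto
    then obtain a where a: "a \<in> {1..card ({0..l - 1} - {?d m})}" "nth_smallest ({0..l - 1} - {?d m}) a = u"
      using nth_smallest_surj[of "{0..l - 1} - {?d m}" u] by auto
    moreover have "card ({0..l - 1} - {?d m}) = unit_index l Q"
      using dl \<open>unit_index l Q = l - 1\<close> by (subst card_Diff_singleton) auto
    ultimately show ?thesis
      using True cong
      by (intro bexI[of _ a] exI[of _ u] exI[of _ 0]) (auto simp: U_int_def Let_def Q_def[symmetric])
  next
    case False
    obtain x i where x: "x \<in> \<sigma> B l \<delta>" "[int x = int Q ^ i * w] (mod int l)"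
      using full_rep_setD(3)[OF l Q(1) S w] by blast
    then obtain a where a: "a \<in> {1..unit_index l Q}" "nth_smallest (\<sigma> B l \<delta>) a = x"
      using nth_smallest_surj[of "\<sigma> B l \<delta>" x] full_rep_setD(1,2)[OF l Q(1) S] by auto
    define u where "u = (?d m + x) mod l"
    have "[int u - int (?d m) = int x] (mod int l)"
      by (simp add: u_def cong_def zmod_int mod_simps)
    then have "[int u - int (?d m) = int Q ^ i * w] (mod int l)" using x(2) by (rule cong_trans)
    then show ?thesis
      using False a
      by (intro bexI[of _ a] exI[of _ u] exI[of _ i]) (auto simp: U_int_def Let_def Q_def[symmetric] u_def)
  qed
qed

section \<open>Extending a coset by one prime\<close>

text \<open>As B is invertible modulo l^K, the K digits from position a on can be prescribed by l^K
  values of t. The ranges of the t_k, and those of the x_k for the primes dividing g, are shown to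
  be large enough in this way.\<close>

lemma solve_prime_power:
  assumes l: "prime l" and B: "\<not> l dvd B" and xy: "[x = y] (mod int l ^ a)"
  shows "\<exists>t\<in>{0..l ^ K - 1}. [x + int B * (int l ^ a * int t) = y] (mod int l ^ (a + K))"
proof -
  obtain z where z: "y - x = int l ^ a * z"
    using xy by (metis cong_iff_dvd_diff cong_sym dvdE)
  have "coprime (int B) (int l ^ K)"
    using prime_imp_coprime[OF l B] by (simp add: coprime_commute)
  then obtain c where c: "[int B * c = 1] (mod int l ^ K)"
    using cong_solve_coprime_int by blast
  define t where "t = nat ((c * z) mod int l ^ K)"
  have lK: "int l ^ K > 0" using l by (simp add: prime_gt_0_nat)
  have t: "int t = (c * z) mod int l ^ K" using lK by (simp add: t_def)
  have "int t < int l ^ K" unfolding t using lK by simp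
  then have "t < l ^ K" by (metis of_nat_less_iff of_nat_power)
  have "[int B * int t = int B * (c * z)] (mod int l ^ K)"
    unfolding t by (intro cong_scalar_left) simp
  also have "[int B * (c * z) = z] (mod int l ^ K)"
    using cong_scalar_right[OF c, of z] by (simp add: mult.assoc)
  finally have "int l ^ K dvd int B * int t - z" by (simp add: cong_iff_dvd_diff)
  then have "int l ^ a * int l ^ K dvd int l ^ a * (int B * int t - z)" by simp
  also have "int l ^ a * (int B * int t - z) = x + int B * (int l ^ a * int t) - y"
    using z by (simp add: algebra_simps)
  finally show ?thesis
    using \<open>t < l ^ K\<close> by (intro bexI[of _ t]) (auto simp: cong_iff_dvd_diff power_add)
qed

lemma cong_prime_power_mult_iff:
  assumes "prime l" "\<not> l dvd B"
  shows "[x = y] (mod int (B * l ^ j)) \<longleftrightarrow> [x = y] (mod int B) \<and> [x = y] (mod int l ^ j)"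
proof -
  have "coprime (int B) (int l ^ j)"
    using prime_imp_coprime[OF assms] by (simp add: coprime_commute)
  then have "int B * int l ^ j dvd x - y \<longleftrightarrow> int B dvd x - y \<and> int l ^ j dvd x - y"
    by (meson divides_mult dvd_mult_left dvd_mult_right)
  then show ?thesis by (simp add: cong_iff_dvd_diff)
qed

text \<open>One stage of the tower: \<delta> represents a coset modulo B, and an integer \<epsilon>
  congruent to \<delta> modulo B has to be carried to a prescribed representative modulo B l^j. The
  powers of q that fix \<delta> modulo B are exactly the powers of \<open>Q\<close>, up to the
  modulus.\<close>

locale coset_extension =
  fixes q B l j :: nat and \<delta> :: int
  assumes l: "prime l" and B: "\<not> l dvd B" and q: "\<not> l dvd q" "q > 1" and Bq: "coprime B q"
    and j: "j > 0"
begin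

definition \<theta> where "\<theta> = coset_size q B \<delta>"

definition Q where "Q = q ^ \<theta>"

lemma l1: "l > 1"
  using l by (rule prime_gt_1_nat)

lemma theta_pos: "\<theta> > 0"
  unfolding \<theta>_def using coset_size_pos[OF Bq] .

lemma coprime_Bl: "coprime B l"
  using prime_imp_coprime[OF l B] by (simp add: coprime_commute)

lemma coprime_mult: "coprime (B * l ^ j) q"
  using Bq prime_imp_coprime[OF l q(1)] by simp

lemma Q_not_dvd: "\<not> l dvd Q"
  using q prime_dvd_power[OF l] unfolding Q_def by blast

lemma Q_gt_1: "Q > 1"
  unfolding Q_def using q theta_pos by (intro one_less_power)

lemma coset_iff:
  assumes "[\<epsilon> = \<delta>] (mod int B)"
  shows "[\<epsilon> * int q ^ c = \<epsilon>] (mod int B) \<longleftrightarrow> \<theta> dvd c"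
  using cong_power_iff_coset_size_dvd[OF Bq] coset_size_cong[OF assms] by (simp add: \<theta>_def)

text \<open>Modulo l^j the element is 0 and imposes no condition, so only the period modulo B
  remains.\<close>

lemma coset_size_infinite:
  assumes "[\<epsilon> = \<delta>] (mod int B)" "int l ^ j dvd \<epsilon>"
  shows "coset_size q (B * l ^ j) \<epsilon> = \<theta>"
proof (rule coset_size_eqI[OF coprime_mult])
  fix c
  have "[\<epsilon> * int q ^ c = \<epsilon>] (mod int l ^ j)"
    using assms(2) by (simp add: cong_iff_dvd_diff)
  then show "[\<epsilon> * int q ^ c = \<epsilon>] (mod int (B * l ^ j)) \<longleftrightarrow> \<theta> dvd c"
    using coset_iff[OF assms(1)] cong_prime_power_mult_iff[OF l B] by blast
qed

text \<open>Cancelling l^m and the unit w leaves q^c = 1 modulo l^(j-m), while the modulus B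
  restricts c to multiples of \<theta>. The order of Q modulo l^(j-m) is kept as a parameter D, so
  that the ordinary and the exceptional case share the lemma.\<close>

lemma coset_size_finite:
  assumes \<epsilon>: "[\<epsilon> = \<delta>] (mod int B)" "\<epsilon> = int l ^ m * w" "\<not> int l dvd w" "m < j"
    and D: "\<And>y. int l ^ (j - m) dvd int Q ^ y - 1 \<longleftrightarrow> D dvd y"
  shows "coset_size q (B * l ^ j) \<epsilon> = D * \<theta>"
proof (rule coset_size_eqI[OF coprime_mult])
  fix c
  have "[\<epsilon> * int q ^ c = \<epsilon>] (mod int l ^ j) \<longleftrightarrow> int l ^ m * int l ^ (j - m) dvd int l ^ m * (w * (int q ^ c - 1))"
    using \<open>m < j\<close> by (simp add: cong_iff_dvd_diff \<epsilon>(2) algebra_simps power_add[symmetric])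
  also have "\<dots> \<longleftrightarrow> int l ^ (j - m) dvd w * (int q ^ c - 1)"
    using l1 by simp
  also have "\<dots> \<longleftrightarrow> int l ^ (j - m) dvd int q ^ c - 1"
  proof -
    have "coprime (int l ^ (j - m)) w"
      using l \<epsilon>(3) by (simp add: prime_imp_coprime)
    then show ?thesis by (rule coprime_dvd_mult_right_iff)
  qed
  finally have *: "[\<epsilon> * int q ^ c = \<epsilon>] (mod int l ^ j) \<longleftrightarrow> int l ^ (j - m) dvd int q ^ c - 1" .
  have "\<theta> dvd c \<and> int l ^ (j - m) dvd int q ^ c - 1 \<longleftrightarrow> D * \<theta> dvd c"
  proof
    assume "\<theta> dvd c \<and> int l ^ (j - m) dvd int q ^ c - 1"
    then obtain y where "c = \<theta> * y" "int l ^ (j - m) dvd int q ^ c - 1" by blast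
    then have "D dvd y" using D[of y] by (simp add: Q_def power_mult)
    then show "D * \<theta> dvd c" using \<open>c = \<theta> * y\<close> by (simp add: mult.commute)
  next
    assume "D * \<theta> dvd c"
    then obtain y where "c = D * \<theta> * y" ..
    then have "c = \<theta> * (D * y)" by simp
    then show "\<theta> dvd c \<and> int l ^ (j - m) dvd int q ^ c - 1"
      using D[of "D * y"] by (simp add: Q_def power_mult)
  qed
  then show "[\<epsilon> * int q ^ c = \<epsilon>] (mod int (B * l ^ j)) \<longleftrightarrow> D * \<theta> dvd c"
    using coset_iff[OF \<epsilon>(1)] cong_prime_power_mult_iff[OF l B] * by blast
qed

text \<open>Unless both elements already agree modulo l^j, division by l^m leaves units that agree
  modulo l^v, hence lie in one orbit under powers of Q. The exponents used are multiples of
  \<theta>, so the class modulo B is untouched. The exponent \<open>o'\<close> will be the order of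
  Q modulo l in the ordinary case and 2 in the exceptional one.\<close>

lemma orbit_finite:
  assumes R: "exact_at l v (int Q ^ o')" "v \<ge> 1" "l = 2 \<longrightarrow> v \<ge> 2"
    and \<epsilon>: "[\<epsilon> = \<delta>] (mod int B)" "\<epsilon> = int l ^ m * w" "\<not> int l dvd w" "m < j"
    and \<gamma>: "[\<gamma> = \<delta>] (mod int B)" "[\<gamma> = \<epsilon>] (mod int l ^ min (m + v) j)"
  shows "\<exists>c. [\<epsilon> * int q ^ c = \<gamma>] (mod int (B * l ^ j))"
proof (cases "m + v \<ge> j")
  case True
  then have "[\<epsilon> = \<gamma>] (mod int l ^ j)" using \<gamma>(2) by (simp add: cong_sym)
  moreover have "[\<epsilon> = \<gamma>] (mod int B)" using \<epsilon>(1) \<gamma>(1) by (meson cong_sym cong_trans)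
  ultimately show ?thesis
    by (intro exI[of _ 0]) (simp only: cong_prime_power_mult_iff[OF l B] power_0 mult_1_right)
next
  case False
  then have \<gamma>\<epsilon>: "int l ^ (m + v) dvd \<gamma> - \<epsilon>" using \<gamma>(2) by (simp add: cong_iff_dvd_diff)
  then obtain b where "\<gamma> - \<epsilon> = int l ^ (m + v) * b" ..
  define w' where "w' = w + int l ^ v * b"
  have \<gamma>_eq: "\<gamma> = int l ^ m * w'"
    using \<open>\<gamma> - \<epsilon> = _\<close> \<epsilon>(2) by (simp add: w'_def algebra_simps power_add)
  have "[w = w'] (mod int l ^ v)" by (simp add: w'_def cong_iff_dvd_diff)
  then obtain i where i: "[(int Q ^ o') ^ i * w = w'] (mod int l ^ (j - m))"
    using orbit_prime_power[OF l R(2,3,1) \<epsilon>(3)] by blast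
  define c where "c = \<theta> * (o' * i)"
  have qc: "int q ^ c = (int Q ^ o') ^ i" by (simp add: c_def Q_def power_mult)
  have "int l ^ m * int l ^ (j - m) dvd int l ^ m * ((int Q ^ o') ^ i * w - w')"
    using i by (simp add: cong_iff_dvd_diff)
  also have "int l ^ m * ((int Q ^ o') ^ i * w - w') = \<epsilon> * int q ^ c - \<gamma>"
    by (simp add: qc \<gamma>_eq \<epsilon>(2) algebra_simps)
  finally have "[\<epsilon> * int q ^ c = \<gamma>] (mod int l ^ j)"
    using \<open>m < j\<close> by (simp add: cong_iff_dvd_diff power_add[symmetric])
  moreover have "[\<epsilon> * int q ^ c = \<gamma>] (mod int B)"
  proof -
    have "[\<epsilon> * int q ^ c = \<epsilon>] (mod int B)" using coset_iff[OF \<epsilon>(1)] by (simp add: c_def)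
    then show ?thesis using \<epsilon>(1) \<gamma>(1) by (meson cong_sym cong_trans)
  qed
  ultimately show ?thesis using cong_prime_power_mult_iff[OF l B] by blast
qed

lemma phi_trunc_dvd: "int l ^ j dvd \<delta> + int B * int (phi_trunc B l \<delta> (j - 1))"
  using padic_digits_dvd[OF l1 coprime_Bl, of "j - 1" \<delta>] j by (simp add: phi_trunc_def)

lemma extension_infinite:
  assumes \<epsilon>: "[\<epsilon> = \<delta>] (mod int B)" "int l ^ j dvd \<epsilon>"
  defines "\<gamma> \<equiv> \<delta> + int B * int (phi_trunc B l \<delta> (j - 1))"
  shows "[\<epsilon> = \<gamma>] (mod int (B * l ^ j))" "coset_size q (B * l ^ j) \<gamma> = \<theta>"
proof -
  have \<gamma>: "[\<gamma> = \<delta>] (mod int B)" "int l ^ j dvd \<gamma>"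
    using phi_trunc_dvd by (simp_all add: \<gamma>_def cong_iff_dvd_diff)
  then show "coset_size q (B * l ^ j) \<gamma> = \<theta>" by (rule coset_size_infinite)
  have "[\<epsilon> = \<gamma>] (mod int B)" using \<epsilon>(1) \<gamma>(1) by (meson cong_sym cong_trans)
  moreover have "[\<epsilon> = \<gamma>] (mod int l ^ j)" using \<epsilon>(2) \<gamma>(2) by (simp add: cong_iff_dvd_diff)
  ultimately show "[\<epsilon> = \<gamma>] (mod int (B * l ^ j))" using cong_prime_power_mult_iff[OF l B] by blast
qed

text \<open>Truncating \<phi> after position m makes \<delta> + B\<phi> divisible by l^(m+1);
  changing the digit there from \<phi>_m to u adds B(u - \<phi>_m) l^m. So the leading unit is B(u -
  \<phi>_m) modulo l.\<close>

lemma U_leading: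
  assumes \<sigma>: "full_rep_set l Q (\<sigma> B l \<delta>)" and w: "\<not> int l dvd w"
  obtains a i w' where "a \<in> {1..r_of q l \<theta>}"
    "\<delta> + int B * int (U_int q \<sigma> B l \<delta> m a) = int l ^ m * w'"
    "[int Q ^ i * w = w'] (mod int l)"
proof -
  let ?d = "padic_digits B l \<delta>"
  have "coprime (int B) (int l)" using coprime_Bl by simp
  \<comment> \<open>The factor B in the leading unit is compensated in advance: the difference of
    digits asked for is w/B.\<close>
  then obtain b where b: "[int B * b = 1] (mod int l)" using cong_solve_coprime_int by blast
  have "\<not> int l dvd b"
  proof
    assume "int l dvd b"
    then have "[0 = 1] (mod int l)"
      using b by (metis cong_0_iff cong_sym cong_trans dvd_mult)
    then show False using l1 by (simp add: cong_iff_dvd_diff)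
  qed
  then have bw: "\<not> int l dvd b * w" using w l by (simp add: prime_dvd_mult_iff)
  have QQ: "q ^ coset_size q B \<delta> = Q" by (simp add: Q_def \<theta>_def)
  have q0: "q > 0" using q(2) by simp
  have S: "full_rep_set l (q ^ coset_size q B \<delta>) (\<sigma> B l \<delta>)" using \<sigma> by (simp only: QQ)
  obtain a u i where a: "a \<in> {1..unit_index l Q}"
    and U: "U_int q \<sigma> B l \<delta> m a = (\<Sum>k<m. ?d k * l ^ k) + u * l ^ m"
    and u: "[int u - int (?d m) = int Q ^ i * (b * w)] (mod int l)"
    using U_int_surj[where \<sigma> = \<sigma>, OF l B q(1) q0 S bw, of m] unfolding QQ by blast
  define S where "S = (\<Sum>k\<le>m. ?d k * l ^ k)"
  obtain c where c: "\<delta> + int B * int S = int l ^ (m + 1) * c"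
    using padic_digits_dvd[OF l1 coprime_Bl, of m \<delta>] unfolding S_def by blast
  define w' where "w' = int B * (int u - int (?d m)) + int l * c"
  have "S = (\<Sum>k<m. ?d k * l ^ k) + ?d m * l ^ m"
    by (simp add: S_def lessThan_Suc_atMost[symmetric])
  then have "U_int q \<sigma> B l \<delta> m a + ?d m * l ^ m = S + u * l ^ m"
    using U by simp
  then have "int (U_int q \<sigma> B l \<delta> m a) + int (?d m) * int l ^ m = int S + int u * int l ^ m"
    by (metis of_nat_add of_nat_mult of_nat_power)
  then have U': "int (U_int q \<sigma> B l \<delta> m a) = int S + (int u - int (?d m)) * int l ^ m"
    by (simp add: algebra_simps)
  have "\<delta> + int B * int (U_int q \<sigma> B l \<delta> m a)
      = (\<delta> + int B * int S) + int B * ((int u - int (?d m)) * int l ^ m)"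
    unfolding U' by (simp add: algebra_simps)
  also have "\<dots> = int l ^ m * w'"
    unfolding c w'_def by (simp add: algebra_simps)
  finally have "\<delta> + int B * int (U_int q \<sigma> B l \<delta> m a) = int l ^ m * w'" .
  moreover have "[int Q ^ i * w = w'] (mod int l)"
  proof -
    have "[w' = int B * (int u - int (?d m))] (mod int l)"
      by (simp add: w'_def cong_iff_dvd_diff)
    also have "[int B * (int u - int (?d m)) = int B * (int Q ^ i * (b * w))] (mod int l)"
      using u by (rule cong_scalar_left)
    also have "int B * (int Q ^ i * (b * w)) = int B * b * (int Q ^ i * w)" by simp
    also have "[\<dots> = 1 * (int Q ^ i * w)] (mod int l)"
      using b by (rule cong_scalar_right)
    finally show ?thesis by (simp add: cong_sym)
  qed
  moreover have "a \<in> {1..r_of q l \<theta>}" using a by (simp add: r_of_def Q_def)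
  ultimately show ?thesis using that by blast
qed

lemma shift_power:
  assumes \<epsilon>: "[\<epsilon> = \<delta>] (mod int B)" "\<epsilon> = int l ^ m * w" "\<not> int l dvd w"
  shows "[\<epsilon> * int Q ^ i = \<delta>] (mod int B)" "\<epsilon> * int Q ^ i = int l ^ m * (int Q ^ i * w)"
    "\<not> int l dvd int Q ^ i * w"
proof -
  have "\<epsilon> * int Q ^ i = \<epsilon> * int q ^ (\<theta> * i)" by (simp add: Q_def power_mult)
  also have "[\<dots> = \<epsilon>] (mod int B)" using coset_iff[OF \<epsilon>(1)] by simp
  finally show "[\<epsilon> * int Q ^ i = \<delta>] (mod int B)" using \<epsilon>(1) by (rule cong_trans)
  show "\<epsilon> * int Q ^ i = int l ^ m * (int Q ^ i * w)" by (simp add: \<epsilon>(2))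
  show "\<not> int l dvd int Q ^ i * w"
    using \<epsilon>(3) Q_not_dvd l prime_dvd_power[of "int l" "int Q"] by (auto simp: prime_dvd_mult_iff)
qed

lemma r_of_mult_ord: "r_of q l \<theta> * ord l Q = l - 1"
  unfolding r_of_def Q_def[symmetric] using unit_index_mult_ord[OF l Q_not_dvd] .

lemma ord_eq_div: "ord l Q = (l - 1) div r_of q l \<theta>" "r_of q l \<theta> > 0" "ord l Q > 0"
proof -
  have "r_of q l \<theta> * ord l Q > 0" using r_of_mult_ord l1 by simp
  then show "r_of q l \<theta> > 0" "ord l Q > 0" by simp_all
  then show "ord l Q = (l - 1) div r_of q l \<theta>"
    unfolding r_of_mult_ord[symmetric] by simp
qed

text \<open>Since (l - 1)/r is the order of Q modulo l, \<open>v_of\<close> is the valuation of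
  \<open>Q ^ ord l Q - 1\<close>. For l = 2 the order is 1, and an odd Q that is not 3 modulo 4 is 1
  modulo 4; this supplies the stronger bound at 2.\<close>

lemma exact_at_ord:
  assumes "\<not> exceptional l Q"
  shows "exact_at l (v_of q l \<theta>) (int Q ^ ord l Q)" "v_of q l \<theta> \<ge> 1" "l = 2 \<longrightarrow> v_of q l \<theta> \<ge> 2"
proof -
  have "\<theta> * (l - 1) div r_of q l \<theta> = \<theta> * ord l Q"
    unfolding r_of_mult_ord[symmetric] using ord_eq_div(2)
    by (simp add: mult.left_commute[of \<theta>])
  then have v: "v_of q l \<theta> = multiplicity l (Q ^ ord l Q - 1)"
    by (simp add: v_of_def Q_def power_mult)
  have gt: "Q ^ ord l Q > 1" using Q_gt_1 ord_eq_div(3) by (intro one_less_power)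
  then show ex: "exact_at l (v_of q l \<theta>) (int Q ^ ord l Q)"
    unfolding v using exact_at_multiplicity[OF l gt] by simp
  have "[Q ^ ord l Q = 1] (mod l)" by (rule ord)
  then have "int l ^ 1 dvd int Q ^ ord l Q - 1"
    by (simp add: cong_int_iff[symmetric] cong_iff_dvd_diff)
  then show "v_of q l \<theta> \<ge> 1" using exact_at_mono_dvd[OF ex] by blast
  show "l = 2 \<longrightarrow> v_of q l \<theta> \<ge> 2"
  proof
    assume "l = 2"
    then have "ord l Q = 1" using r_of_mult_ord by simp
    have "Q mod 4 = 1"
      using assms Q_not_dvd \<open>l = 2\<close> unfolding exceptional_def by presburger
    then have "int Q mod 4 = 1" by presburger
    then have "(4::int) dvd int Q - 1" by presburger
    then have "int l ^ 2 dvd int Q ^ ord l Q - 1" using \<open>l = 2\<close> \<open>ord l Q = 1\<close> by simp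
    then show "v_of q l \<theta> \<ge> 2" using exact_at_mono_dvd[OF ex] by blast
  qed
qed

lemma extension_finite:
  assumes \<sigma>: "full_rep_set l Q (\<sigma> B l \<delta>)" and exc: "\<not> exceptional l Q"
    and \<epsilon>: "[\<epsilon> = \<delta>] (mod int B)" "\<epsilon> = int l ^ m * w" "\<not> int l dvd w" and m: "m < j"
  shows "\<exists>a\<in>{1..r_of q l \<theta>}. \<exists>t\<in>{0..l ^ (min (v_of q l \<theta>) (j - m) - 1) - 1}. \<exists>c.
    let \<gamma> = \<delta> + int B * int (U_int q \<sigma> B l \<delta> m a + l ^ (m + 1) * t) in
    [\<epsilon> * int q ^ c = \<gamma>] (mod int (B * l ^ j)) \<and>
    coset_size q (B * l ^ j) \<gamma> = l ^ (j - m - v_of q l \<theta>) * ((l - 1) div r_of q l \<theta>) * \<theta>"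
proof -
  note ex = exact_at_ord[OF exc]
  let ?v = "v_of q l \<theta>"
  obtain a i w' where a: "a \<in> {1..r_of q l \<theta>}"
    and U: "\<delta> + int B * int (U_int q \<sigma> B l \<delta> m a) = int l ^ m * w'"
    and i: "[int Q ^ i * w = w'] (mod int l)"
    using U_leading[where \<sigma> = \<sigma>, OF \<sigma> \<epsilon>(3)] by blast
  define \<epsilon>' where "\<epsilon>' = \<epsilon> * int Q ^ i"
  \<comment> \<open>The leading digit is settled by a, so t supplies one digit less than the
    relative precision min(v, j - m).\<close>
  define K where "K = min ?v (j - m) - 1"
  note \<epsilon>' = shift_power[OF \<epsilon>, of i, folded \<epsilon>'_def]
  have "[int l ^ m * w' = \<epsilon>'] (mod int l ^ (m + 1))"
    using i unfolding \<epsilon>'(2)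
    by (simp add: cong_iff_dvd_diff right_diff_distrib[symmetric] mult.commute[of "int l"] dvd_diff_commute)
  from solve_prime_power[OF l B this, of K] obtain t where t: "t \<in> {0..l ^ K - 1}"
    and c: "[int l ^ m * w' + int B * (int l ^ (m + 1) * int t) = \<epsilon>'] (mod int l ^ (m + 1 + K))"
    by blast
  define \<gamma> where "\<gamma> = \<delta> + int B * int (U_int q \<sigma> B l \<delta> m a + l ^ (m + 1) * t)"
  have \<gamma>_eq: "\<gamma> = int l ^ m * w' + int B * (int l ^ (m + 1) * int t)"
    using U by (simp add: \<gamma>_def algebra_simps)
  have \<gamma>B: "[\<gamma> = \<delta>] (mod int B)" by (simp add: \<gamma>_def cong_iff_dvd_diff)
  have "m + 1 + K = min (m + ?v) j" using m ex(2) unfolding K_def by arith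
  then have "[\<gamma> = \<epsilon>'] (mod int l ^ min (m + ?v) j)" using c by (simp add: \<gamma>_eq)
  then obtain c' where "[\<epsilon>' * int q ^ c' = \<gamma>] (mod int (B * l ^ j))"
    using orbit_finite[OF ex \<epsilon>' m \<gamma>B] by blast
  then have orb: "[\<epsilon> * int q ^ (\<theta> * i + c') = \<gamma>] (mod int (B * l ^ j))"
    by (simp add: \<epsilon>'_def Q_def power_mult power_add mult.assoc)
  define w'' where "w'' = w' + int l * (int B * int t)"
  have \<gamma>w: "\<gamma> = int l ^ m * w''" by (simp add: \<gamma>_eq w''_def algebra_simps)
  have "[int Q ^ i * w = w''] (mod int l)"
    using i unfolding w''_def by (simp add: cong_iff_dvd_diff diff_diff_eq[symmetric])
  then have w'': "\<not> int l dvd w''" using \<epsilon>'(3) by (simp add: cong_dvd_iff)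
  \<comment> \<open>Reduction modulo l forces y to be a multiple of \<open>ord l Q\<close>; the
    remaining factor is the order of \<open>Q ^ ord l Q\<close> modulo l^(j-m), a power of
    l.\<close>
  have D: "int l ^ (j - m) dvd int Q ^ y - 1 \<longleftrightarrow> l ^ (j - m - ?v) * ord l Q dvd y" for y
  proof
    assume *: "int l ^ (j - m) dvd int Q ^ y - 1"
    have "int l dvd int l ^ (j - m)" using m by (simp add: dvd_power)
    then have "int l dvd int Q ^ y - 1" using * by (rule dvd_trans)
    then have "[Q ^ y = 1] (mod l)"
      by (simp add: cong_int_iff[symmetric] cong_iff_dvd_diff)
    then have "ord l Q dvd y" by (simp only: ord_divides)
    then obtain y' where y': "y = ord l Q * y'" ..
    then have "int l ^ (j - m) dvd (int Q ^ ord l Q) ^ y' - 1" using * by (simp add: power_mult)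
    then have "l ^ (j - m - ?v) dvd y'" using power_cong_1_iff[OF l ex(2,3,1)] by blast
    then show "l ^ (j - m - ?v) * ord l Q dvd y" using y' by (simp add: mult.commute)
  next
    assume "l ^ (j - m - ?v) * ord l Q dvd y"
    then obtain y' where "y = l ^ (j - m - ?v) * ord l Q * y'" ..
    then have "y = ord l Q * (l ^ (j - m - ?v) * y')" by simp
    then show "int l ^ (j - m) dvd int Q ^ y - 1"
      using power_cong_1_iff[OF l ex(2,3,1), of "j - m" "l ^ (j - m - ?v) * y'"]
      by (simp add: power_mult)
  qed
  have "coset_size q (B * l ^ j) \<gamma> = l ^ (j - m - ?v) * ord l Q * \<theta>"
    using coset_size_finite[OF \<gamma>B \<gamma>w w'' m D] .
  then show ?thesis
    unfolding Let_def using a t orb unfolding K_def \<gamma>_def ord_eq_div(1) by blast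
qed

text \<open>Modulo 2 there is one unit class, so r = 1 and the digit chosen by a is forced; the unit
  part of \<epsilon> can still differ from that of the representative by a sign modulo 4. One factor
  Q, which is -1 modulo 4, removes the sign. Then Q^2 acts, with valuation v + 1, and t enters at
  position m + 2.\<close>

lemma extension_finite_exceptional:
  assumes \<sigma>: "full_rep_set l Q (\<sigma> B l \<delta>)" and exc: "exceptional l Q"
    and \<epsilon>: "[\<epsilon> = \<delta>] (mod int B)" "\<epsilon> = int l ^ m * w" "\<not> int l dvd w" and m: "m < j"
  shows "\<exists>t\<in>{0..2 ^ min (v1_exc q \<theta> - 1) (j - m - 2) - 1}. \<exists>c.
    let \<gamma> = \<delta> + int B * int (U_int q \<sigma> B 2 \<delta> m 1 + 2 ^ (m + 2) * t) in
    [\<epsilon> * int q ^ c = \<gamma>] (mod int (B * l ^ j)) \<and>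
    coset_size q (B * l ^ j) \<gamma> = (if m = j - 1 then \<theta> else 2 ^ max 1 (j - m - v1_exc q \<theta>) * \<theta>)"
proof -
  have l2: "l = 2" and Q3: "Q mod 4 = 3" using exc by (auto simp: exceptional_def)
  define v where "v = v1_exc q \<theta>"
  have v: "v = multiplicity 2 (Q + 1)" by (simp add: v_def v1_exc_def Q_def)
  note v2 = exact_at_square(1)[OF Q3, folded v] and ex = exact_at_square(2)[OF Q3, folded v]
  obtain a i w' where a: "a \<in> {1..r_of q l \<theta>}"
    and U: "\<delta> + int B * int (U_int q \<sigma> B l \<delta> m a) = int l ^ m * w'"
    and i: "[int Q ^ i * w = w'] (mod int l)"
    using U_leading[where \<sigma> = \<sigma>, OF \<sigma> \<epsilon>(3)] by blast
  have "r_of q l \<theta> = 1" using r_of_mult_ord l2 by simp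
  then have a1: "a = 1" using a by simp
  have "odd (int Q)" using Q_not_dvd l2 by simp
  have "odd w" using \<epsilon>(3) l2 by simp
  then have "odd w'" using i \<open>odd (int Q)\<close> l2 by (simp add: cong_iff_dvd_diff)
  have "\<exists>i. [int Q ^ i * w = w'] (mod 4)"
  proof (cases "[w = w'] (mod 4)")
    case True
    then show ?thesis by (intro exI[of _ 0]) simp
  next
    case False
    have "[int Q = - 1] (mod 4)" using Q3 by (simp add: cong_def) presburger
    then have "[int Q * w = - 1 * w] (mod 4)" by (rule cong_scalar_right)
    moreover have "[- 1 * w = w'] (mod 4)"
      using False \<open>odd w\<close> \<open>odd w'\<close> unfolding cong_def by presburger
    ultimately have "[int Q * w = w'] (mod 4)" by (rule cong_trans)
    then show ?thesis by (intro exI[of _ 1]) simp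
  qed
  then obtain i where i: "[int Q ^ i * w = w'] (mod 4)" by blast
  define \<epsilon>' where "\<epsilon>' = \<epsilon> * int Q ^ i"
  \<comment> \<open>Two digits are settled by the congruence modulo 4, while Q^2 asks for v + 1 of
    them; v - 1 remain. For m = j - 1 the truncated difference is 0, and the precision m + 2 then
    exceeds j.\<close>
  define K where "K = min (v - 1) (j - m - 2)"
  note \<epsilon>' = shift_power[OF \<epsilon>, of i, folded \<epsilon>'_def]
  have "[int l ^ m * w' = \<epsilon>'] (mod int l ^ (m + 2))"
    using i l2 unfolding \<epsilon>'(2)
    by (simp add: cong_iff_dvd_diff right_diff_distrib[symmetric] mult.commute[of 4] dvd_diff_commute)
  from solve_prime_power[OF l B this, of K] obtain t where t: "t \<in> {0..l ^ K - 1}"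
    and c: "[int l ^ m * w' + int B * (int l ^ (m + 2) * int t) = \<epsilon>'] (mod int l ^ (m + 2 + K))"
    by blast
  define \<gamma> where "\<gamma> = \<delta> + int B * int (U_int q \<sigma> B 2 \<delta> m 1 + 2 ^ (m + 2) * t)"
  have \<gamma>_eq: "\<gamma> = int l ^ m * w' + int B * (int l ^ (m + 2) * int t)"
    using U l2 a1 by (simp add: \<gamma>_def algebra_simps)
  have \<gamma>B: "[\<gamma> = \<delta>] (mod int B)" by (simp add: \<gamma>_def cong_iff_dvd_diff)
  have "min (m + (v + 1)) j \<le> m + 2 + K" using m v2 by (auto simp: K_def min_def)
  then have "[\<gamma> = \<epsilon>'] (mod int l ^ min (m + (v + 1)) j)"
    using c unfolding \<gamma>_eq by (meson cong_dvd_modulus le_imp_power_dvd)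
  then obtain c' where "[\<epsilon>' * int q ^ c' = \<gamma>] (mod int (B * l ^ j))"
    using orbit_finite[of "v + 1" 2, OF _ _ _ \<epsilon>' m \<gamma>B] ex v2 l2 by auto
  then have orb: "[\<epsilon> * int q ^ (\<theta> * i + c') = \<gamma>] (mod int (B * l ^ j))"
    by (simp add: \<epsilon>'_def Q_def power_mult power_add mult.assoc)
  define w'' where "w'' = w' + 4 * (int B * int t)"
  have \<gamma>w: "\<gamma> = int l ^ m * w''" using l2 by (simp add: \<gamma>_eq w''_def algebra_simps)
  have w'': "\<not> int l dvd w''" using \<open>odd w'\<close> l2 by (simp add: w''_def)
  have size: "coset_size q (B * l ^ j) \<gamma> = (if m = j - 1 then \<theta> else 2 ^ max 1 (j - m - v) * \<theta>)"
  \<comment> \<open>For m = j - 1 only a congruence modulo 2 is left, which every power of the odd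
    number Q satisfies.\<close>
  proof (cases "m = j - 1")
    case True
    then have "j - m = 1" using j by simp
    then have D: "int l ^ (j - m) dvd int Q ^ y - 1 \<longleftrightarrow> 1 dvd y" for y
      using l2 \<open>odd (int Q)\<close> by simp
    show ?thesis using coset_size_finite[OF \<gamma>B \<gamma>w w'' m D] True by simp
  next
    case False
    then have jm: "j - m \<ge> 2" using m by simp
    \<comment> \<open>The factor 2 accounts for passing from Q to Q^2, whose order modulo 2^(j-m) is
      2^(j-m-(v+1)); the truncation in this exponent turns into the maximum with 1.\<close>
    have "max 1 (j - m - v) = 1 + (j - m - (v + 1))" by simp
    then have pw: "(2::nat) ^ max 1 (j - m - v) = 2 * 2 ^ (j - m - (v + 1))" by simp
    have D: "int l ^ (j - m) dvd int Q ^ y - 1 \<longleftrightarrow> 2 ^ max 1 (j - m - v) dvd y" for y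
    proof -
      have iff: "int l ^ (j - m) dvd (int Q ^ 2) ^ y' - 1 \<longleftrightarrow> 2 ^ (j - m - (v + 1)) dvd y'" for y'
        using power_cong_1_iff[OF two_is_prime_nat _ _ ex, of "j - m" y'] v2 l2 by simp
      show ?thesis
      proof
        assume *: "int l ^ (j - m) dvd int Q ^ y - 1"
        \<comment> \<open>Modulo 4 the powers of Q alternate between 1 and -1, so y is even.\<close>
        have "(2::int) ^ 2 dvd 2 ^ (j - m)" using jm by (rule le_imp_power_dvd)
        then have "2 ^ 2 dvd int Q ^ y - 1" by (rule dvd_trans) (use * l2 in simp)
        then have "4 dvd int Q ^ y - 1" by simp
        then have "[int Q ^ y = 1] (mod 4)" by (simp add: cong_iff_dvd_diff)
        moreover have "[int Q ^ y = (- 1) ^ y] (mod 4)"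
          using Q3 by (intro cong_pow) (simp add: cong_def, presburger)
        ultimately have "[(- 1) ^ y = (1::int)] (mod 4)" by (metis cong_sym cong_trans)
        then have "even y" by (cases "even y") (auto simp: cong_iff_dvd_diff)
        then obtain y' where "y = 2 * y'" ..
        then show "2 ^ max 1 (j - m - v) dvd y"
          using * iff[of y'] unfolding pw by (simp add: power_mult)
      next
        assume "2 ^ max 1 (j - m - v) dvd y"
        then obtain y' where "y = 2 * (2 ^ (j - m - (v + 1)) * y')"
          unfolding pw by (auto simp: mult.assoc)
        then show "int l ^ (j - m) dvd int Q ^ y - 1"
          using iff[of "2 ^ (j - m - (v + 1)) * y'"] by (simp add: power_mult)
      qed
    qed
    show ?thesis using coset_size_finite[OF \<gamma>B \<gamma>w w'' m D] False by simp
  qed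
  show ?thesis
    unfolding Let_def using t orb size l2 unfolding K_def \<gamma>_def v_def by blast
qed

end

section \<open>Iterating over the primes\<close>

text \<open>One recursion in place of separate clauses for the first and the later primes, so that a
  single induction covers both; the exceptional branch is tied to k = 0.\<close>

lemma tau_seq_Suc:
  "tau_seq q P j \<tau> m (Suc k) =
     (case m (Suc k) of
        \<infinity> \<Rightarrow> tau_seq q P j \<tau> m k
      | enat i \<Rightarrow>
          if k = 0 \<and> exceptional (P 1) (q ^ \<tau>)
          then (if i = j 1 - 1 then \<tau> else 2 ^ max 1 (j 1 - i - v1_exc q \<tau>) * \<tau>)
          else P (Suc k) ^ (j (Suc k) - i - v_of q (P (Suc k)) (tau_seq q P j \<tau> m k)) *
            ((P (Suc k) - 1) div r_of q (P (Suc k)) (tau_seq q P j \<tau> m k)) * tau_seq q P j \<tau> m k)"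
  by (cases k) (simp_all add: Let_def split: enat.split)

lemma gamma_seq_Suc:
  fixes q \<sigma> P j N\<^sub>0 \<gamma> m a t k
  defines "\<delta> \<equiv> gamma_seq q \<sigma> P j N\<^sub>0 \<gamma> (m, a, t) k"
    and "B \<equiv> (\<Prod>i=1..<Suc k. P i ^ j i) * N\<^sub>0"
  shows "gamma_seq q \<sigma> P j N\<^sub>0 \<gamma> (m, a, t) (Suc k) =
     (case m (Suc k) of
        \<infinity> \<Rightarrow> \<delta> + int B * int (phi_trunc B (P (Suc k)) \<delta> (j (Suc k) - 1))
      | enat i \<Rightarrow>
          if k = 0 \<and> exceptional (P 1) (q ^ coset_size q N\<^sub>0 \<gamma>)
          then \<delta> + int B * int (U_int q \<sigma> B 2 \<delta> i 1 + 2 ^ (i + 2) * t 1)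
          else \<delta> + int B * int (U_int q \<sigma> B (P (Suc k)) \<delta> i (a (Suc k)) + P (Suc k) ^ (i + 1) * t (Suc k)))"
  unfolding \<delta>_def B_def by (cases k) (simp_all add: Let_def split: enat.split)

text \<open>Stage k reads only the entries 1, ..., k, so entry k + 1 can be filled in later without
  disturbing what has been established.\<close>

lemma tau_seq_cong:
  assumes "\<And>i. i \<in> {1..k} \<Longrightarrow> m i = m' i"
  shows "tau_seq q P j \<tau> m k = tau_seq q P j \<tau> m' k"
  using assms
proof (induction k)
  case (Suc k)
  then have "tau_seq q P j \<tau> m k = tau_seq q P j \<tau> m' k" "m (Suc k) = m' (Suc k)" by auto
  then show ?case unfolding tau_seq_Suc by (simp split: enat.split)
qed simp

lemma gamma_seq_cong:
  assumes "\<And>i. i \<in> {1..k} \<Longrightarrow> m i = m' i \<and> a i = a' i \<and> t i = t' i"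
  shows "gamma_seq q \<sigma> P j N\<^sub>0 \<gamma> (m, a, t) k = gamma_seq q \<sigma> P j N\<^sub>0 \<gamma> (m', a', t') k"
  using assms
proof (induction k)
  case (Suc k)
  then have "gamma_seq q \<sigma> P j N\<^sub>0 \<gamma> (m, a, t) k = gamma_seq q \<sigma> P j N\<^sub>0 \<gamma> (m', a', t') k"
    "m (Suc k) = m' (Suc k)" "a (Suc k) = a' (Suc k)" "t (Suc k) = t' (Suc k)" "t 1 = t' 1" by auto
  then show ?case unfolding gamma_seq_Suc by (simp split: enat.split)
qed simp

locale extension_tower =
  fixes q s N\<^sub>0 :: nat and P j :: "nat \<Rightarrow> nat" and \<sigma> and \<gamma> :: int
  assumes q: "q > 1" and N0: "N\<^sub>0 > 0" "coprime N\<^sub>0 q"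
    and P: "\<And>k. k \<in> {1..s} \<Longrightarrow> prime (P k) \<and> \<not> P k dvd q \<and> \<not> P k dvd N\<^sub>0 \<and> j k > 0"
    and P_mono: "strict_mono_on {1..s} P"
    and \<sigma>: "\<And>B l \<delta>. B > 0 \<Longrightarrow> coprime B q \<Longrightarrow> prime l \<Longrightarrow> \<not> l dvd B \<Longrightarrow> \<not> l dvd q \<Longrightarrow>
      full_rep_set l (q ^ coset_size q B \<delta>) (\<sigma> B l \<delta>)"
begin

definition \<tau> where "\<tau> = coset_size q N\<^sub>0 \<gamma>"

definition B where "B k = (\<Prod>i=1..<Suc k. P i ^ j i) * N\<^sub>0"

abbreviation "Tau \<equiv> tau_seq q P j \<tau>"

abbreviation "Gam \<equiv> gamma_seq q \<sigma> P j N\<^sub>0 \<gamma>"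

text \<open>The conditions of \<open>index_set\<close> at a single position, with the first and the
  later positions in one formula. Earlier entries enter only through \<open>Tau\<close>, so tuples
  can be built from left to right.\<close>

definition admissible :: "(nat \<Rightarrow> enat) \<Rightarrow> (nat \<Rightarrow> nat) \<Rightarrow> (nat \<Rightarrow> nat) \<Rightarrow> nat \<Rightarrow> bool" where
  "admissible m a t k \<longleftrightarrow> m k \<in> enat ` {0..j k - 1} \<union> {\<infinity>} \<and> (m k = \<infinity> \<longrightarrow> a k = 0 \<and> t k = 0) \<and>
    (\<forall>i. m k = enat i \<longrightarrow>
      (if k = 1 \<and> exceptional (P 1) (q ^ \<tau>)
       then a 1 = 1 \<and> t 1 \<in> {0..2 ^ min (v1_exc q \<tau> - 1) (j 1 - i - 2) - 1}
       else a k \<in> {1..r_of q (P k) (Tau m (k - 1))} \<and>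
         t k \<in> {0..P k ^ (min (v_of q (P k) (Tau m (k - 1))) (j k - i) - 1) - 1}))"

lemma admissible_cong:
  assumes "\<And>i. i \<in> {1..k} \<Longrightarrow> m i = m' i \<and> a i = a' i \<and> t i = t' i" "k \<ge> 1"
  shows "admissible m a t k \<longleftrightarrow> admissible m' a' t' k"
proof -
  have "Tau m (k - 1) = Tau m' (k - 1)" using assms(1) by (intro tau_seq_cong) auto
  moreover have "m k = m' k \<and> a k = a' k \<and> t k = t' k \<and> a 1 = a' 1 \<and> t 1 = t' 1"
    using assms by auto
  ultimately show ?thesis unfolding admissible_def by simp
qed

lemma index_setI:
  assumes "m \<in> extensional {1..s}" "a \<in> extensional {1..s}" "t \<in> extensional {1..s}"
    and adm: "\<And>k. k \<in> {1..s} \<Longrightarrow> admissible m a t k"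
  shows "(m, a, t) \<in> index_set q s P j N\<^sub>0 \<gamma>"
proof -
  have "m \<in> (\<Pi>\<^sub>E k\<in>{1..s}. enat ` {0..j k - 1} \<union> {\<infinity>})" "a \<in> (\<Pi>\<^sub>E k\<in>{1..s}. UNIV)"
    "t \<in> (\<Pi>\<^sub>E k\<in>{1..s}. UNIV)"
    using assms(1-3) adm unfolding admissible_def PiE_def by auto
  moreover have "\<forall>k\<in>{1..s}. m k = \<infinity> \<longrightarrow> a k = 0 \<and> t k = 0"
    using adm unfolding admissible_def by blast
  moreover have "if exceptional (P 1) (q ^ \<tau>)
             then a 1 = 1 \<and> t 1 \<in> {0..2 ^ min (v1_exc q \<tau> - 1) (j 1 - i - 2) - 1}
             else a 1 \<in> {1..r_of q (P 1) \<tau>} \<and>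
                  t 1 \<in> {0..P 1 ^ (min (v_of q (P 1) \<tau>) (j 1 - i) - 1) - 1}"
    if "s \<ge> 1 \<and> m 1 = enat i" for i
    using adm[of 1] that unfolding admissible_def by auto
  moreover have "a k \<in> {1..r_of q (P k) (Tau m (k - 1))} \<and>
             t k \<in> {0..P k ^ (min (v_of q (P k) (Tau m (k - 1))) (j k - i) - 1) - 1}"
    if "k \<in> {2..s}" "m k = enat i" for k i
  proof -
    have "k \<in> {1..s}" "k \<noteq> 1" using that(1) by auto
    then show ?thesis using adm[of k] that(2) unfolding admissible_def by simp
  qed
  ultimately show ?thesis
    unfolding index_set_def Let_def \<tau>_def[symmetric] mem_Collect_eq prod.case by blast
qed

lemma B_0: "B 0 = N\<^sub>0"
  by (simp add: B_def)

lemma B_Suc: "B (Suc k) = B k * P (Suc k) ^ j (Suc k)"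
  by (simp add: B_def mult_ac prod.atLeastLessThan_Suc)

lemma B_props:
  assumes "k \<le> s"
  shows "coprime (B k) q" "B k > 0" and "i \<in> {k<..s} \<Longrightarrow> \<not> P i dvd B k"
proof -
  have "coprime (B k) q \<and> B k > 0 \<and> (\<forall>i\<in>{k<..s}. \<not> P i dvd B k)"
    using assms
  proof (induction k)
    case 0
    then show ?case using N0 P by (simp add: B_0)
  next
    case (Suc k)
    then have pk: "prime (P (Suc k))" "\<not> P (Suc k) dvd q" using P by auto
    then have "coprime (P (Suc k)) q" by (simp add: prime_imp_coprime)
    moreover have "\<not> P i dvd B (Suc k)" if i: "i \<in> {Suc k<..s}" for i
    proof
      assume *: "P i dvd B (Suc k)"
      have "prime (P i)" using P i by auto
      moreover have "\<not> P i dvd B k" using Suc i by auto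
      ultimately have "P i dvd P (Suc k)"
        using * prime_dvd_power by (auto simp: B_Suc prime_dvd_mult_iff)
      then have "P i = P (Suc k)" using pk \<open>prime (P i)\<close> primes_dvd_imp_eq by blast
      moreover have "P (Suc k) < P i" using i Suc.prems by (intro strict_mono_onD[OF P_mono]) auto
      ultimately show False by simp
    qed
    ultimately show ?case using Suc pk by (auto simp: B_Suc prime_gt_0_nat)
  qed
  then show "coprime (B k) q" "B k > 0" "i \<in> {k<..s} \<Longrightarrow> \<not> P i dvd B k" by auto
qed

text \<open>The claim on sizes has to travel with the induction: the index set is phrased in terms
  of \<open>Tau\<close>, whereas the extension step yields ranges in terms of the size of the coset
  just reached. Their equality makes the two fit at the next prime.\<close>

lemma covering_step:
  assumes \<delta>: "[\<delta> = \<gamma>] (mod int N\<^sub>0)" and "k \<le> s"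
  shows "\<exists>m a t. (\<forall>i\<in>{1..k}. admissible m a t i) \<and>
    (\<exists>c. [\<delta> * int q ^ c = Gam (m, a, t) k] (mod int (B k))) \<and>
    coset_size q (B k) (Gam (m, a, t) k) = Tau m k"
  using \<open>k \<le> s\<close>
proof (induction k)
  case 0
  have "\<exists>c. [\<delta> * int q ^ c = \<gamma>] (mod int N\<^sub>0)" by (intro exI[of _ 0]) (use \<delta> in simp)
  then show ?case by (simp add: B_0 \<tau>_def)
next
  case (Suc k)
  define l where "l = P (Suc k)"
  define J where "J = j (Suc k)"
  have "k \<le> s" using Suc.prems by simp
  then obtain m a t c where adm: "\<And>i. i \<in> {1..k} \<Longrightarrow> admissible m a t i"
    and c: "[\<delta> * int q ^ c = Gam (m, a, t) k] (mod int (B k))"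
    and size: "coset_size q (B k) (Gam (m, a, t) k) = Tau m k"
    using Suc.IH by blast
  define \<gamma>' where "\<gamma>' = Gam (m, a, t) k"
  define \<epsilon> where "\<epsilon> = \<delta> * int q ^ c"
  have size': "coset_size q (B k) \<gamma>' = Tau m k" using size by (simp only: \<gamma>'_def)
  have \<epsilon>: "[\<epsilon> = \<gamma>'] (mod int (B k))" using c by (simp add: \<epsilon>_def \<gamma>'_def)
  have k: "k \<le> s" "Suc k \<in> {1..s}" using Suc.prems by auto
  interpret E: coset_extension q "B k" l J \<gamma>'
    using P[OF k(2)] B_props[OF k(1)] q Suc.prems by unfold_locales (auto simp: l_def J_def)
  have \<theta>: "E.\<theta> = Tau m k" using size' by (simp only: E.\<theta>_def)
  have Q: "E.Q = q ^ Tau m k" by (simp add: E.Q_def \<theta>)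
  have rep: "full_rep_set l E.Q (\<sigma> (B k) l \<gamma>')"
    using \<sigma>[of "B k" l \<gamma>'] B_props[OF k(1)] E.l E.B E.q(1) by (simp add: E.Q_def E.\<theta>_def)
  \<comment> \<open>It suffices to name the new entries x, y, z of the three tuples. The premise
    speaks of all tuples that extend the old ones, so that the cases below need not unfold function
    updates.\<close>
  have extend: ?case
    if x: "\<And>m'. (\<And>i. i \<in> {1..k} \<Longrightarrow> m' i = m i) \<Longrightarrow> m' (Suc k) = x \<Longrightarrow>
        (\<And>a' t'. (\<And>i. i \<in> {1..k} \<Longrightarrow> a' i = a i \<and> t' i = t i) \<Longrightarrow> a' (Suc k) = y \<Longrightarrow> t' (Suc k) = z \<Longrightarrow>
          admissible m' a' t' (Suc k) \<and> (\<exists>c. [\<epsilon> * int q ^ c = Gam (m', a', t') (Suc k)] (mod int (B (Suc k)))) \<and>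
          coset_size q (B (Suc k)) (Gam (m', a', t') (Suc k)) = Tau m' (Suc k))"
    for x y z
  proof -
    define m' where "m' = m(Suc k := x)"
    define a' where "a' = a(Suc k := y)"
    define t' where "t' = t(Suc k := z)"
    have *: "admissible m' a' t' (Suc k) \<and> (\<exists>c. [\<epsilon> * int q ^ c = Gam (m', a', t') (Suc k)] (mod int (B (Suc k)))) \<and>
          coset_size q (B (Suc k)) (Gam (m', a', t') (Suc k)) = Tau m' (Suc k)"
      by (rule x) (auto simp: m'_def a'_def t'_def)
    moreover have "admissible m' a' t' i" if "i \<in> {1..Suc k}" for i
    proof (cases "i = Suc k")
      case False
      then have "i \<in> {1..k}" using that by auto
      then show ?thesis using adm[of i] admissible_cong[of i m' m a' a t' t]
        by (auto simp: m'_def a'_def t'_def)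
    qed (use * in simp)
    moreover obtain c' where "[\<epsilon> * int q ^ c' = Gam (m', a', t') (Suc k)] (mod int (B (Suc k)))" using * by blast
    then have "[\<delta> * int q ^ (c + c') = Gam (m', a', t') (Suc k)] (mod int (B (Suc k)))"
      by (simp add: \<epsilon>_def power_add mult.assoc)
    ultimately show ?case by blast
  qed
  have Gam_eq: "Gam (m', a', t') k = \<gamma>'"
    if "\<And>i. i \<in> {1..k} \<Longrightarrow> m' i = m i" "\<And>i. i \<in> {1..k} \<Longrightarrow> a' i = a i \<and> t' i = t i" for m' a' t'
    unfolding \<gamma>'_def by (rule gamma_seq_cong) (use that in blast)
  have Tau_eq: "Tau m' k = E.\<theta>" if "\<And>i. i \<in> {1..k} \<Longrightarrow> m' i = m i" for m'
    unfolding \<theta> by (rule tau_seq_cong) (use that in blast)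
  have BS: "B (Suc k) = B k * l ^ J" by (simp add: B_Suc l_def J_def)
  \<comment> \<open>Beyond the first position the primes exceed 2, so the exceptional case cannot
    recur.\<close>
  have exc: "k = 0 \<and> exceptional (P 1) (q ^ \<tau>) \<longleftrightarrow> exceptional l E.Q"
  proof (cases "k = 0")
    case True
    then show ?thesis using Q by (simp add: l_def)
  next
    case False
    then have "P k < P (Suc k)" using k by (intro strict_mono_onD[OF P_mono]) auto
    moreover have "P k \<ge> 2" using P[of k] False k by (simp add: prime_ge_2_nat)
    ultimately show ?thesis using False by (simp add: exceptional_def l_def)
  qed
  show ?case
  \<comment> \<open>The new entry of m is the l-adic valuation of \<epsilon>, replaced by
    \<infinity> once it reaches J.\<close>
  proof (cases "int l ^ J dvd \<epsilon>")
    case True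
    note inf = E.extension_infinite[OF \<epsilon> True]
    have inf1: "[\<epsilon> * int q ^ 0 = \<gamma>' + int (B k) * int (phi_trunc (B k) l \<gamma>' (J - 1))] (mod int (B k * l ^ J))"
      using inf(1) by simp
    show ?thesis
    proof (rule extend[of \<infinity> 0 0])
      fix m' :: "nat \<Rightarrow> enat" and a' t' :: "nat \<Rightarrow> nat"
      assume m': "\<And>i. i \<in> {1..k} \<Longrightarrow> m' i = m i" "m' (Suc k) = \<infinity>"
        and a': "\<And>i. i \<in> {1..k} \<Longrightarrow> a' i = a i \<and> t' i = t i" "a' (Suc k) = 0" "t' (Suc k) = 0"
      have Gm: "Gam (m', a', t') k = \<gamma>'" by (intro Gam_eq m'(1) a'(1))
      have Tm: "Tau m' k = E.\<theta>" by (intro Tau_eq m'(1))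
      have G: "Gam (m', a', t') (Suc k) = \<gamma>' + int (B k) * int (phi_trunc (B k) l \<gamma>' (J - 1))"
        unfolding gamma_seq_Suc m'(2) Gm B_def[symmetric] by (simp add: l_def J_def)
      have T: "Tau m' (Suc k) = E.\<theta>" unfolding tau_seq_Suc m'(2) Tm by simp
      have "admissible m' a' t' (Suc k)" using m'(2) a'(2,3) by (simp add: admissible_def)
      then show "admissible m' a' t' (Suc k) \<and> (\<exists>c. [\<epsilon> * int q ^ c = Gam (m', a', t') (Suc k)] (mod int (B (Suc k)))) \<and>
          coset_size q (B (Suc k)) (Gam (m', a', t') (Suc k)) = Tau m' (Suc k)"
        unfolding G T BS using inf1 inf(2) by blast
    qed
  next
    case False
    then have "\<epsilon> \<noteq> 0" by auto
    moreover have "\<not> is_unit (int l)" using E.l1 by simp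
    ultimately obtain \<mu> w where w: "\<epsilon> = int l ^ \<mu> * w" "\<not> int l dvd w"
      using multiplicity_decompose'[of \<epsilon> "int l"] by blast
    have \<mu>: "\<mu> < J"
    proof (rule ccontr)
      assume "\<not> \<mu> < J"
      then have "int l ^ J dvd int l ^ \<mu>" by (intro le_imp_power_dvd) simp
      then show False using False w(1) by simp
    qed
    show ?thesis
    proof (cases "exceptional l E.Q")
      case True
      then have k0: "k = 0" "exceptional (P 1) (q ^ \<tau>)" using exc by auto
      then have exk: "k = 0 \<and> exceptional (P 1) (q ^ \<tau>)"
        and ex1: "Suc k = 1 \<and> exceptional (P 1) (q ^ \<tau>)" by auto
      have J1: "J = j 1" using k0 by (simp add: J_def)
      have "Tau m k = \<tau>" using k0 by simp
      then have \<theta>\<tau>: "E.\<theta> = \<tau>" by (simp only: \<theta>)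
      obtain t1 c' where t1: "t1 \<in> {0..2 ^ min (v1_exc q E.\<theta> - 1) (J - \<mu> - 2) - 1}"
        and fin: "[\<epsilon> * int q ^ c' = \<gamma>' + int (B k) * int (U_int q \<sigma> (B k) 2 \<gamma>' \<mu> 1 + 2 ^ (\<mu> + 2) * t1)] (mod int (B k * l ^ J))"
          "coset_size q (B k * l ^ J) (\<gamma>' + int (B k) * int (U_int q \<sigma> (B k) 2 \<gamma>' \<mu> 1 + 2 ^ (\<mu> + 2) * t1)) =
            (if \<mu> = J - 1 then E.\<theta> else 2 ^ max 1 (J - \<mu> - v1_exc q E.\<theta>) * E.\<theta>)"
        using E.extension_finite_exceptional[where \<sigma> = \<sigma>, OF rep True \<epsilon> w \<mu>] unfolding Let_def by blast
      show ?thesis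
      proof (rule extend[of "enat \<mu>" 1 t1])
        fix m' :: "nat \<Rightarrow> enat" and a' t' :: "nat \<Rightarrow> nat"
        assume m': "\<And>i. i \<in> {1..k} \<Longrightarrow> m' i = m i" "m' (Suc k) = enat \<mu>"
          and a': "\<And>i. i \<in> {1..k} \<Longrightarrow> a' i = a i \<and> t' i = t i" "a' (Suc k) = 1" "t' (Suc k) = t1"
        then have a1': "a' 1 = 1" and t1': "t' 1 = t1" using k0 by auto
        have Gm: "Gam (m', a', t') k = \<gamma>'" by (intro Gam_eq m'(1) a'(1))
      have Tm: "Tau m' k = E.\<theta>" by (intro Tau_eq m'(1))
      have G: "Gam (m', a', t') (Suc k) = \<gamma>' + int (B k) * int (U_int q \<sigma> (B k) 2 \<gamma>' \<mu> 1 + 2 ^ (\<mu> + 2) * t1)"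
          unfolding gamma_seq_Suc m'(2) Gm B_def[symmetric] \<tau>_def[symmetric] enat.case if_P[OF exk] t1'
          by (rule refl)
        have T: "Tau m' (Suc k) = (if \<mu> = J - 1 then E.\<theta> else 2 ^ max 1 (J - \<mu> - v1_exc q E.\<theta>) * E.\<theta>)"
          unfolding tau_seq_Suc m'(2) enat.case if_P[OF exk] J1 \<theta>\<tau> by (rule refl)
        have "admissible m' a' t' (Suc k)"
          unfolding admissible_def if_P[OF ex1]
          using m'(2) a1' t1' t1[unfolded J1 \<theta>\<tau>] \<mu>[unfolded J_def] by auto
        then show "admissible m' a' t' (Suc k) \<and> (\<exists>c. [\<epsilon> * int q ^ c = Gam (m', a', t') (Suc k)] (mod int (B (Suc k)))) \<and>
            coset_size q (B (Suc k)) (Gam (m', a', t') (Suc k)) = Tau m' (Suc k)"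
          unfolding G T BS using fin by blast
      qed
    next
      case False
      then have exc': "\<not> (k = 0 \<and> exceptional (P 1) (q ^ \<tau>))" using exc by simp
      obtain a1 t1 c' where a1: "a1 \<in> {1..r_of q l E.\<theta>}"
        and t1: "t1 \<in> {0..l ^ (min (v_of q l E.\<theta>) (J - \<mu>) - 1) - 1}"
        and fin: "[\<epsilon> * int q ^ c' = \<gamma>' + int (B k) * int (U_int q \<sigma> (B k) l \<gamma>' \<mu> a1 + l ^ (\<mu> + 1) * t1)] (mod int (B k * l ^ J))"
          "coset_size q (B k * l ^ J) (\<gamma>' + int (B k) * int (U_int q \<sigma> (B k) l \<gamma>' \<mu> a1 + l ^ (\<mu> + 1) * t1)) =
            l ^ (J - \<mu> - v_of q l E.\<theta>) * ((l - 1) div r_of q l E.\<theta>) * E.\<theta>"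
        using E.extension_finite[where \<sigma> = \<sigma>, OF rep False \<epsilon> w \<mu>] unfolding Let_def by blast
      show ?thesis
      proof (rule extend[of "enat \<mu>" a1 t1])
        fix m' :: "nat \<Rightarrow> enat" and a' t' :: "nat \<Rightarrow> nat"
        assume m': "\<And>i. i \<in> {1..k} \<Longrightarrow> m' i = m i" "m' (Suc k) = enat \<mu>"
          and a': "\<And>i. i \<in> {1..k} \<Longrightarrow> a' i = a i \<and> t' i = t i" "a' (Suc k) = a1" "t' (Suc k) = t1"
        have Gm: "Gam (m', a', t') k = \<gamma>'" by (intro Gam_eq m'(1) a'(1))
      have Tm: "Tau m' k = E.\<theta>" by (intro Tau_eq m'(1))
      have G: "Gam (m', a', t') (Suc k) = \<gamma>' + int (B k) * int (U_int q \<sigma> (B k) l \<gamma>' \<mu> a1 + l ^ (\<mu> + 1) * t1)"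
          unfolding gamma_seq_Suc m'(2) Gm B_def[symmetric] \<tau>_def[symmetric] enat.case
            if_not_P[OF exc'] a'(2,3) by (simp add: l_def)
        have T: "Tau m' (Suc k) = l ^ (J - \<mu> - v_of q l E.\<theta>) * ((l - 1) div r_of q l E.\<theta>) * E.\<theta>"
          unfolding tau_seq_Suc m'(2) Tm enat.case if_not_P[OF exc'] by (simp add: l_def J_def)
        have ex1: "\<not> (Suc k = 1 \<and> exceptional (P 1) (q ^ \<tau>))" using exc' by simp
        have "admissible m' a' t' (Suc k)"
          unfolding admissible_def if_not_P[OF ex1] a'(2,3) diff_Suc_1 Tm
          using m'(2) \<mu> t1 a1 by (auto simp: J_def l_def)
        then show "admissible m' a' t' (Suc k) \<and> (\<exists>c. [\<epsilon> * int q ^ c = Gam (m', a', t') (Suc k)] (mod int (B (Suc k)))) \<and>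
            coset_size q (B (Suc k)) (Gam (m', a', t') (Suc k)) = Tau m' (Suc k)"
          unfolding G T BS using fin by blast
      qed
    qed
  qed
qed

theorem index_set_covering:
  assumes "[\<delta> = \<gamma>] (mod int N\<^sub>0)"
  shows "\<exists>I\<in>index_set q s P j N\<^sub>0 \<gamma>. \<exists>c. [\<delta> * int q ^ c = Gam I s] (mod int (B s))"
proof -
  obtain m a t c where adm: "\<And>i. i \<in> {1..s} \<Longrightarrow> admissible m a t i"
    and c: "[\<delta> * int q ^ c = Gam (m, a, t) s] (mod int (B s))"
    using covering_step[OF assms order_refl] by blast
  let ?m = "restrict m {1..s}" and ?a = "restrict a {1..s}" and ?t = "restrict t {1..s}"
  have "admissible ?m ?a ?t i" if "i \<in> {1..s}" for i
    using adm[OF that] that admissible_cong[of i ?m m ?a a ?t t] by auto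
  then have "(?m, ?a, ?t) \<in> index_set q s P j N\<^sub>0 \<gamma>" by (intro index_setI) auto
  moreover have "Gam (?m, ?a, ?t) s = Gam (m, a, t) s" by (intro gamma_seq_cong) auto
  ultimately show ?thesis using c by metis
qed

end

text \<open>There are finitely many m, and each m bounds the entries of a and t. Finiteness matters
  because a product over an infinite set is 1 by convention.\<close>

lemma finite_index_set: "finite (index_set q s P j N\<^sub>0 \<gamma>)"
proof -
  define \<tau> where "\<tau> = coset_size q N\<^sub>0 \<gamma>"
  define Ms where "Ms = (\<Pi>\<^sub>E k\<in>{1..s}. enat ` {0..j k - 1} \<union> {\<infinity>})"
  \<comment> \<open>A common bound for a and t at position k, over all finite entries that m may
    have there; the element 1 serves the forced value a = 1 of the exceptional case.\<close>
  define bnd where "bnd m k = Max (insert 1 (insert (r_of q (P k) (tau_seq q P j \<tau> m (k - 1)))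
    ((\<lambda>i. 2 ^ min (v1_exc q \<tau> - 1) (j 1 - i - 2)) ` {0..j k - 1} \<union>
     (\<lambda>i. P k ^ (min (v_of q (P k) (tau_seq q P j \<tau> m (k - 1))) (j k - i) - 1)) ` {0..j k - 1})))" for m k
  have fin: "finite Ms" unfolding Ms_def by (intro finite_PiE) auto
  have bnd1: "x \<le> bnd m k" if "x \<in> insert 1 (insert (r_of q (P k) (tau_seq q P j \<tau> m (k - 1)))
    ((\<lambda>i. 2 ^ min (v1_exc q \<tau> - 1) (j 1 - i - 2)) ` {0..j k - 1} \<union>
     (\<lambda>i. P k ^ (min (v_of q (P k) (tau_seq q P j \<tau> m (k - 1))) (j k - i) - 1)) ` {0..j k - 1}))" for x m k
    unfolding bnd_def using that by (intro Max_ge) auto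
  have "index_set q s P j N\<^sub>0 \<gamma> \<subseteq> (\<Union>m\<in>Ms. {m} \<times> (\<Pi>\<^sub>E k\<in>{1..s}. {0..bnd m k}) \<times> (\<Pi>\<^sub>E k\<in>{1..s}. {0..bnd m k}))"
  proof
    fix I assume "I \<in> index_set q s P j N\<^sub>0 \<gamma>"
    then obtain m a t where I: "I = (m, a, t)" and mem: "(m, a, t) \<in> index_set q s P j N\<^sub>0 \<gamma>"
      by (cases I) auto
    from mem have m: "m \<in> Ms"
      and at: "a \<in> (\<Pi>\<^sub>E k\<in>{1..s}. UNIV)" "t \<in> (\<Pi>\<^sub>E k\<in>{1..s}. UNIV)"
      and inf: "\<forall>k\<in>{1..s}. m k = \<infinity> \<longrightarrow> a k = 0 \<and> t k = 0"
      and one: "\<forall>i. s \<ge> 1 \<and> m 1 = enat i \<longrightarrow>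
            (if exceptional (P 1) (q ^ \<tau>)
             then a 1 = 1 \<and> t 1 \<in> {0..2 ^ min (v1_exc q \<tau> - 1) (j 1 - i - 2) - 1}
             else a 1 \<in> {1..r_of q (P 1) \<tau>} \<and>
                  t 1 \<in> {0..P 1 ^ (min (v_of q (P 1) \<tau>) (j 1 - i) - 1) - 1})"
      and two: "\<forall>k\<in>{2..s}. \<forall>i. m k = enat i \<longrightarrow>
             a k \<in> {1..r_of q (P k) (tau_seq q P j \<tau> m (k - 1))} \<and>
             t k \<in> {0..P k ^ (min (v_of q (P k) (tau_seq q P j \<tau> m (k - 1))) (j k - i) - 1) - 1}"
      unfolding index_set_def Let_def \<tau>_def[symmetric] Ms_def[symmetric] mem_Collect_eq prod.case
      by blast+
    have "a k \<le> bnd m k \<and> t k \<le> bnd m k" if k: "k \<in> {1..s}" for k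
    proof (cases "m k")
      case (enat i)
      have "m k \<in> enat ` {0..j k - 1} \<union> {\<infinity>}" using m k unfolding Ms_def by (rule PiE_mem)
      then have i: "i \<in> {0..j k - 1}" using enat by auto
      have b: "1 \<le> bnd m k" "r_of q (P k) (tau_seq q P j \<tau> m (k - 1)) \<le> bnd m k"
        "2 ^ min (v1_exc q \<tau> - 1) (j 1 - i - 2) \<le> bnd m k"
        "P k ^ (min (v_of q (P k) (tau_seq q P j \<tau> m (k - 1))) (j k - i) - 1) \<le> bnd m k"
        using i by (auto intro!: bnd1)
      show ?thesis
      proof (cases "k = 1")
        case True
        have *: "s \<ge> 1 \<and> m 1 = enat i" using enat k True by auto
        have T0: "tau_seq q P j \<tau> m (k - 1) = \<tau>" using True by simp
        have "a 1 \<le> bnd m 1 \<and> t 1 \<le> bnd m 1"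
        proof (cases "exceptional (P 1) (q ^ \<tau>)")
          case exc: True
          then have "a 1 = 1" "t 1 \<le> 2 ^ min (v1_exc q \<tau> - 1) (j 1 - i - 2) - 1"
            using one * by auto
          then show ?thesis using b(1,3) unfolding True by linarith
        next
          case exc: False
          then have "a 1 \<le> r_of q (P 1) \<tau>" "t 1 \<le> P 1 ^ (min (v_of q (P 1) \<tau>) (j 1 - i) - 1) - 1"
            using one * by auto
          then show ?thesis using b(2,4)[unfolded T0] unfolding True by linarith
        qed
        then show ?thesis by (simp only: True)
      next
        case False
        then have "k \<in> {2..s}" using k by auto
        then have "a k \<le> r_of q (P k) (tau_seq q P j \<tau> m (k - 1))"
          "t k \<le> P k ^ (min (v_of q (P k) (tau_seq q P j \<tau> m (k - 1))) (j k - i) - 1) - 1"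
          using two enat by auto
        then show ?thesis using b(2,4) by linarith
      qed
    qed (use inf k in simp)
    then show "I \<in> (\<Union>m\<in>Ms. {m} \<times> (\<Pi>\<^sub>E k\<in>{1..s}. {0..bnd m k}) \<times> (\<Pi>\<^sub>E k\<in>{1..s}. {0..bnd m k}))"
      using I m at by (auto simp: PiE_def)
  qed
  moreover have "finite (\<Union>m\<in>Ms. {m} \<times> (\<Pi>\<^sub>E k\<in>{1..s}. {0..bnd m k}) \<times> (\<Pi>\<^sub>E k\<in>{1..s}. {0..bnd m k}))"
    using fin by (intro finite_UN_I finite_cartesian_product finite_PiE) auto
  ultimately show ?thesis by (rule finite_subset)
qed

section \<open>Cosets at the primes dividing the order\<close>

text \<open>
  The premise on the case \<open>k = 1\<close>, where the sum over \<open>i < k\<close> is empty, caters for the exceptional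
  case: there \<open>A 1 = 2\<close>, so the first congruence is solvable for even right-hand sides only.
\<close>

lemma triangular_congruences:
  fixes A K Y :: "nat \<Rightarrow> nat" and z :: "nat \<Rightarrow> int"
  assumes dvd: "\<And>k i. k \<in> {1..u} \<Longrightarrow> i \<in> {k<..u} \<Longrightarrow> Y k dvd A i"
    and solve: "\<And>k w. k \<in> {1..u} \<Longrightarrow> k = 1 \<longrightarrow> w = z 1 \<Longrightarrow>
      \<exists>x\<in>{0..K k - 1}. [int (A k * x) = w] (mod int (Y k))"
  shows "\<exists>x\<in>\<Pi>\<^sub>E k\<in>{1..u}. {0..K k - 1}. \<forall>k\<in>{1..u}. [int (\<Sum>i=1..u. A i * x i) = z k] (mod int (Y k))"
proof -
  have "\<exists>x. \<forall>k\<in>{1..u'}. x k \<in> {0..K k - 1} \<and> [int (\<Sum>i=1..u'. A i * x i) = z k] (mod int (Y k))"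
    if "u' \<le> u" for u'
    using that
  proof (induction u')
    case 0
    then show ?case by simp
  next
    case (Suc u')
    from Suc.prems have "u' \<le> u" by simp
    then obtain x where "\<forall>k\<in>{1..u'}. x k \<in> {0..K k - 1} \<and> [int (\<Sum>i=1..u'. A i * x i) = z k] (mod int (Y k))"
      using Suc.IH by blast
    then have x: "\<And>k. k \<in> {1..u'} \<Longrightarrow> x k \<in> {0..K k - 1}"
      "\<And>k. k \<in> {1..u'} \<Longrightarrow> [int (\<Sum>i=1..u'. A i * x i) = z k] (mod int (Y k))" by blast+
    define T where "T = (\<Sum>i=1..u'. A i * x i)"
    have "\<exists>y\<in>{0..K (Suc u') - 1}. [int (A (Suc u') * y) = z (Suc u') - int T] (mod int (Y (Suc u')))"
      using Suc.prems by (intro solve) (auto simp: T_def)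
    then obtain y where y: "y \<in> {0..K (Suc u') - 1}"
      "[int (A (Suc u') * y) = z (Suc u') - int T] (mod int (Y (Suc u')))" by blast
    define x' where "x' = x(Suc u' := y)"
    have "(\<Sum>i=1..u'. A i * x' i) = T" unfolding T_def by (intro sum.cong) (auto simp: x'_def)
    then have S: "int (\<Sum>i=1..Suc u'. A i * x' i) = int T + int (A (Suc u') * y)" by (simp add: x'_def)
    have "x' k \<in> {0..K k - 1} \<and> [int (\<Sum>i=1..Suc u'. A i * x' i) = z k] (mod int (Y k))"
      if k: "k \<in> {1..Suc u'}" for k
    proof (cases "k = Suc u'")
      case True
      then show ?thesis using y unfolding S by (auto simp: x'_def cong_iff_dvd_diff algebra_simps)
    next
      case False
      then have k': "k \<in> {1..u'}" using k by auto
      \<comment> \<open>The new summand vanishes modulo all earlier moduli, so the congruences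
        already solved survive.\<close>
      then have "Y k dvd A (Suc u')" using Suc.prems by (intro dvd) auto
      then have "[int (A (Suc u') * y) = 0] (mod int (Y k))"
        by (simp add: cong_0_iff)
      then have "[int T + int (A (Suc u') * y) = z k + 0] (mod int (Y k))"
        using x(2)[OF k'] unfolding T_def by (intro cong_add)
      then show ?thesis using x(1)[OF k'] False unfolding S by (simp add: x'_def)
    qed
    then show ?case by blast
  qed
  then obtain x where x: "\<And>k. k \<in> {1..u} \<Longrightarrow> x k \<in> {0..K k - 1}"
    "\<And>k. k \<in> {1..u} \<Longrightarrow> [int (\<Sum>i=1..u. A i * x i) = z k] (mod int (Y k))" by blast
  let ?x = "restrict x {1..u}"
  have "(\<Sum>i=1..u. A i * ?x i) = (\<Sum>i=1..u. A i * x i)" by (intro sum.cong) auto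
  moreover have "?x \<in> (\<Pi>\<^sub>E k\<in>{1..u}. {0..K k - 1})" using x(1) by auto
  ultimately show ?thesis using x(2) by (intro bexI[of _ ?x]) auto
qed

section \<open>Exponents modulo prime powers\<close>

lemma cong_1_power_prime_power:
  fixes a :: int
  assumes "[a = 1] (mod int l)"
  shows "[a ^ (l ^ n) = 1] (mod int l ^ Suc n)"
proof (induction n)
  case 0
  show ?case using assms by simp
next
  case (Suc n)
  define b where "b = a ^ (l ^ n)"
  have b: "int l ^ Suc n dvd b - 1" using Suc by (simp add: b_def cong_iff_dvd_diff)
  have "int l dvd int l ^ Suc n" by simp
  then have "int l dvd b - 1" using b by (rule dvd_trans)
  then have "[b = 1] (mod int l)" by (simp only: cong_iff_dvd_diff)
  \<comment> \<open>The cofactor of b - 1 in b^l - 1 has l terms, all 1 modulo l, so it contributes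
    a further factor l.\<close>
  then have "[(\<Sum>i<l. b ^ i) = (\<Sum>i<l. 1)] (mod int l)"
    by (intro cong_sum) (metis cong_pow power_one)
  then have "int l dvd (\<Sum>i<l. b ^ i)" by (simp add: cong_dvd_iff)
  with b have "int l ^ Suc n * int l dvd (b - 1) * (\<Sum>i<l. b ^ i)" by (rule mult_dvd_mono)
  then have "int l ^ Suc (Suc n) dvd b ^ l - 1"
    by (simp add: geometric_factor_int[of b l] mult.commute)
  then show ?case by (simp add: b_def cong_iff_dvd_diff power_mult[symmetric] mult.commute)
qed

text \<open>The exponent matters only modulo l^n because a^(l^n) is 1 modulo l^n. This allows
  exponents chosen for different primes to be replaced by a common one.\<close>

lemma cong_power_exponent:
  fixes a :: int
  assumes "[a = 1] (mod int l)" "[c = c'] (mod l ^ n)"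
  shows "[a ^ c = a ^ c'] (mod int l ^ n)"
proof -
  have *: "[a ^ c = a ^ (c mod l ^ n)] (mod int l ^ n)" for c
  proof -
    have "[a ^ (l ^ n) = 1] (mod int l ^ n)"
      using cong_1_power_prime_power[OF assms(1), of n] by (rule cong_dvd_modulus) simp
    then have "[(a ^ (l ^ n)) ^ (c div l ^ n) = 1] (mod int l ^ n)" by (metis cong_pow power_one)
    then have "[(a ^ (l ^ n)) ^ (c div l ^ n) * a ^ (c mod l ^ n) = 1 * a ^ (c mod l ^ n)] (mod int l ^ n)"
      by (rule cong_scalar_right)
    then show ?thesis by (simp add: power_mult[symmetric] power_add[symmetric])
  qed
  have "c mod l ^ n = c' mod l ^ n" using assms(2) by (simp add: cong_def)
  then show ?thesis using *[of c] *[of c'] by (metis cong_sym cong_trans)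
qed

text \<open>The primes dividing g, with modulus n_1 g. Since g divides q - 1, q is 1 modulo each G
  k, and an element of 1 + gZ is a unit with residue 1 there; no leading residue has to be
  chosen.\<close>

locale base_cosets =
  fixes q g n\<^sub>1 u :: nat and G E F :: "nat \<Rightarrow> nat"
  assumes q: "q > 1" and gq: "g dvd q - 1"
    and g: "g = (\<Prod>k=1..u. G k ^ E k)" and n1: "n\<^sub>1 = (\<Prod>k=1..u. G k ^ F k)"
    and G: "\<And>k. k \<in> {1..u} \<Longrightarrow> prime (G k) \<and> E k > 0" and G_mono: "strict_mono_on {1..u} G"
begin

definition exc where "exc \<longleftrightarrow> exceptional (G 1) q"

definition v where "v = multiplicity 2 (q + 1)"

definition A where "A k = (if k = 1 \<and> exc then G 1 else \<Prod>i=1..<k. G i ^ F i)"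

text \<open>
  \<open>G k ^ E k * Y k\<close> is the modulus up to which an element has to agree with its representative
  before multiplication by powers of \<open>q\<close> (of \<open>q\<^sup>2\<close> in the exceptional case) can do the rest.
\<close>

definition Y where "Y k = (if k = 1 \<and> exc then 2 ^ min (F 1) v else G k ^ y_exp q G E F k)"

lemma G_inj: "k \<in> {1..u} \<Longrightarrow> i \<in> {1..u} \<Longrightarrow> k \<noteq> i \<Longrightarrow> G k \<noteq> G i"
  using strict_mono_on_imp_inj_on[OF G_mono] unfolding inj_on_def by blast

lemma G_coprime: "k \<in> {1..u} \<Longrightarrow> i \<in> {1..u} \<Longrightarrow> k \<noteq> i \<Longrightarrow> coprime (G k) (G i)"
  using G G_inj primes_coprime by blast

lemma pow_E_dvd_g: "k \<in> {1..u} \<Longrightarrow> G k ^ E k dvd g"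
  unfolding g by (intro dvd_prodI) auto

lemma G_dvd_g: "k \<in> {1..u} \<Longrightarrow> G k dvd g"
  by (rule dvd_trans[OF dvd_power pow_E_dvd_g]) (use G in auto)

lemma q_cong_1: "k \<in> {1..u} \<Longrightarrow> [int q = 1] (mod int (G k))"
proof -
  assume "k \<in> {1..u}"
  then have "int (G k) dvd int (q - 1)" unfolding int_dvd_int_iff by (rule dvd_trans[OF G_dvd_g gq])
  then show ?thesis using q by (simp add: cong_iff_dvd_diff of_nat_diff)
qed

lemma G_eq_2: "k \<in> {1..u} \<Longrightarrow> G k = 2 \<Longrightarrow> k = 1"
proof (rule ccontr)
  assume k: "k \<in> {1..u}" "G k = 2" "k \<noteq> 1"
  then have "G 1 < G k" by (intro strict_mono_onD[OF G_mono]) auto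
  moreover have "prime (G 1)" using G[of 1] k by auto
  ultimately show False using k(2) prime_ge_2_nat[of "G 1"] by simp
qed

lemma exact_q: "k \<in> {1..u} \<Longrightarrow> exact_at (G k) (multiplicity (G k) (q - 1)) (int q)"
  using exact_at_multiplicity[of "G k" q] G q by auto

lemma E_le: "k \<in> {1..u} \<Longrightarrow> E k \<le> multiplicity (G k) (q - 1)"
proof -
  assume k: "k \<in> {1..u}"
  have "int (G k ^ E k) dvd int (q - 1)"
    using dvd_trans[OF pow_E_dvd_g[OF k] gq] by (simp only: int_dvd_int_iff)
  then have "int (G k) ^ E k dvd int q - 1" using q by (simp add: of_nat_diff)
  then show ?thesis using exact_at_mono_dvd[OF exact_q[OF k]] by blast
qed

lemma y_exp_eq:
  assumes "k \<in> {1..u}" "\<not> (k = 1 \<and> exc)"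
  shows "y_exp q G E F k = min (F k) (multiplicity (G k) (q - 1) - E k)"
  using assms E_le[OF assms(1)] unfolding y_exp_def exc_def by (auto simp: min_def)

text \<open>As q - 1 is twice an odd number and g divides it, the prime 2 divides g exactly once. Of
  the valuation v + 1 of q^2 - 1 one unit is thus accounted for by g.\<close>

lemma exc_props:
  assumes "exc" "u \<ge> 1"
  shows "G 1 = 2" "q mod 4 = 3" "E 1 = 1" "\<not> 4 dvd g" "v \<ge> 2" "exact_at 2 (v + 1) (int q ^ 2)"
    "y_exp q G E F 1 = min (F 1 - 1) (v - 1)"
proof -
  show G1: "G 1 = 2" and q3: "q mod 4 = 3" using assms by (auto simp: exc_def exceptional_def)
  show g4: "\<not> 4 dvd g"
  proof
    assume "4 dvd g"
    then have "4 dvd q - 1" using gq by (rule dvd_trans)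
    then show False using q3 by presburger
  qed
  show E1: "E 1 = 1"
  proof (rule ccontr)
    assume "E 1 \<noteq> 1"
    then have "2 \<le> E 1" using G[of 1] assms by auto
    then have "2 ^ 2 dvd G 1 ^ E 1" unfolding G1 by (rule le_imp_power_dvd)
    then have "2 ^ 2 dvd g" using pow_E_dvd_g[of 1] assms by (auto intro: dvd_trans)
    then show False using g4 by simp
  qed
  show v2: "v \<ge> 2" and "exact_at 2 (v + 1) (int q ^ 2)"
    unfolding v_def using exact_at_square[OF q3] by blast+
  have mult: "multiplicity (G 1) (q + 1) = v" by (simp only: v_def G1)
  have "y_exp q G E F 1 = nat (max 0 (min (int (F 1) - 1) (int v - int 1)))"
    using assms(1) unfolding y_exp_def exc_def mult E1 by simp
  then show "y_exp q G E F 1 = min (F 1 - 1) (v - 1)"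
    using v2 by linarith
qed

lemma Y_dvd:
  assumes k: "k \<in> {1..u}" and i: "i \<in> {k<..u}"
  shows "Y k dvd A i"
proof -
  have "y_exp q G E F k \<le> F k" if "\<not> (k = 1 \<and> exc)" using y_exp_eq[OF k that] by simp
  then have "Y k dvd G k ^ F k"
    using exc_props(1) k unfolding Y_def by (auto intro: le_imp_power_dvd)
  also have "G k ^ F k dvd (\<Prod>i=1..<i. G i ^ F i)" using k i by (intro dvd_prodI) auto
  finally show ?thesis using k i by (auto simp: A_def)
qed

text \<open>Ordinarily A k is a product of powers of earlier primes, hence invertible modulo G k. In
  the exceptional first position A 1 = 2: the even right-hand side is halved, and x modulo 2^K
  settles 2x modulo 2^(K+1), where K + 1 is at least min(F 1, v).\<close>

lemma solvable:
  assumes k: "k \<in> {1..u}" and w: "k = 1 \<longrightarrow> w = z" and z: "exc \<longrightarrow> even z"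
  shows "\<exists>x\<in>{0..G k ^ y_exp q G E F k - 1}. [int (A k * x) = w] (mod int (Y k))"
proof (cases "k = 1 \<and> exc")
  case True
  then have u: "u \<ge> 1" and exc using k by auto
  note ep = exc_props[OF this(2,1)]
  obtain z' where z': "w = 2 * z'" using w z True by auto
  define K where "K = y_exp q G E F 1"
  have "[0 = z'] (mod int 2 ^ 0)" by simp
  from solve_prime_power[OF two_is_prime_nat _ this, of 1 K]
  obtain x where x: "x \<in> {0..2 ^ K - 1}" "[0 + int 1 * (int 2 ^ 0 * int x) = z'] (mod int 2 ^ (0 + K))" by auto
  then have "2 ^ K dvd int x - z'" by (simp add: cong_iff_dvd_diff)
  then have "2 * 2 ^ K dvd 2 * (int x - z')" by (rule mult_dvd_mono[OF dvd_refl])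
  also have "2 * (int x - z') = 2 * int x - w" by (simp add: z')
  finally have "2 ^ (K + 1) dvd 2 * int x - w" by simp
  moreover have "Y k dvd 2 ^ (K + 1)"
  proof -
    have "min (F 1) v \<le> K + 1" using ep(5,7) by (simp add: K_def)
    then have "2 ^ min (F 1) v dvd (2::nat) ^ (K + 1)" by (rule le_imp_power_dvd)
    then show ?thesis unfolding Y_def if_P[OF True] .
  qed
  then have "int (Y k) dvd 2 ^ (K + 1)" by (metis int_dvd_int_iff of_nat_numeral of_nat_power)
  ultimately have "int (Y k) dvd 2 * int x - w" using dvd_trans by blast
  then have "[int (A k * x) = w] (mod int (Y k))"
    using True ep(1) by (simp add: A_def cong_iff_dvd_diff)
  then show ?thesis using x(1) True ep(1) by (auto simp: K_def)
next
  case False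
  have cop: "\<not> G k dvd A k"
  proof
    assume "G k dvd A k"
    then have "G k dvd (\<Prod>i=1..<k. G i ^ F i)" using False by (auto simp: A_def)
    then obtain i where i: "i \<in> {1..<k}" "G k dvd G i ^ F i"
      using G k by (auto simp: prime_dvd_prod_iff)
    then have "G k dvd G i" using G k prime_dvd_power by blast
    then have "G k = G i" using G i(1) k by (auto simp: primes_dvd_imp_eq)
    then show False using G_inj[of k i] i(1) k by auto
  qed
  have "[0 = w] (mod int (G k) ^ 0)" by simp
  from solve_prime_power[OF _ cop this, of "y_exp q G E F k"] G k
  show ?thesis using False by (auto simp: Y_def)
qed

text \<open>With \<delta> = 1 + gz, up to a power of q, the entries of x approximate z closely
  enough at every prime dividing g. The remaining discrepancy is removed at each prime by a power of
  q, and these powers are merged into one.\<close>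

lemma coset_representative:
  assumes \<delta>: "[\<delta> = 1] (mod int g)"
  shows "\<exists>x\<in>x_tuples q u G E F. \<exists>c. [\<delta> * int q ^ c = gamma_x q g u G F x] (mod int (n\<^sub>1 * g))"
proof -
  have qg: "[int q = 1] (mod int g)"
  proof -
    have "int g dvd int (q - 1)" using gq by (simp only: int_dvd_int_iff)
    then show ?thesis using q by (simp add: cong_iff_dvd_diff of_nat_diff)
  qed
  \<comment> \<open>If q and \<delta> are both 3 modulo 4, one factor q makes \<delta> congruent to
    1 modulo 4. Then z is even, as the weight 2 in front of x_1 demands.\<close>
  have "\<exists>c. exc \<and> u \<ge> 1 \<longrightarrow> [\<delta> * int q ^ c = 1] (mod 4)"
  proof (cases "exc \<and> u \<ge> 1 \<and> \<not> [\<delta> = 1] (mod 4)")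
    case True
    have "2 dvd g" using G_dvd_g[of 1] exc_props(1) True by auto
    then have "2 dvd int g" by simp
    with \<delta> have "[\<delta> = 1] (mod 2)" by (rule cong_dvd_modulus)
    then have "odd \<delta>" by (simp add: cong_iff_dvd_diff)
    moreover have "\<delta> mod 4 \<noteq> 1" using True by (auto simp: cong_def)
    ultimately have "\<delta> mod 4 = 3" by presburger
    moreover have "q mod 4 = 3" using exc_props(2) True by blast
    then have "int q mod 4 = 3" by presburger
    ultimately have "[\<delta> * int q ^ 1 = 1] (mod 4)"
      unfolding cong_def power_one_right mod_mult_eq[of \<delta> 4 "int q", symmetric] by simp
    then show ?thesis by blast
  qed (auto intro: exI[of _ 0])
  then obtain c\<^sub>0 where c0: "exc \<and> u \<ge> 1 \<Longrightarrow> [\<delta> * int q ^ c\<^sub>0 = 1] (mod 4)" by blast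
  define \<delta>' where "\<delta>' = \<delta> * int q ^ c\<^sub>0"
  have "[\<delta>' = 1 * 1 ^ c\<^sub>0] (mod int g)" unfolding \<delta>'_def by (intro cong_mult \<delta> cong_pow qg)
  then have "int g dvd \<delta>' - 1" by (simp add: cong_iff_dvd_diff)
  then obtain z where z: "\<delta>' - 1 = int g * z" ..
  have z_even: "even z" if "exc" "u \<ge> 1"
  proof (rule ccontr)
    assume "odd z"
    have "4 dvd int g * z" using c0 that z by (simp add: cong_iff_dvd_diff \<delta>'_def)
    moreover have "coprime (4::int) z" using \<open>odd z\<close> coprime_power_left_iff[of 2 2 z] by (simp add: coprime_left_2_iff_odd)
    ultimately have "4 dvd int g" by (simp add: coprime_dvd_mult_left_iff)
    then show False using exc_props(4)[OF that] by presburger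
  qed
  have "\<exists>x\<in>\<Pi>\<^sub>E k\<in>{1..u}. {0..G k ^ y_exp q G E F k - 1}. \<forall>k\<in>{1..u}. [int (\<Sum>i=1..u. A i * x i) = z] (mod int (Y k))"
  proof (rule triangular_congruences[where z = "\<lambda>_. z"])
    show "Y k dvd A i" if "k \<in> {1..u}" "i \<in> {k<..u}" for k i using Y_dvd[OF that] .
    show "\<exists>x\<in>{0..G k ^ y_exp q G E F k - 1}. [int (A k * x) = w] (mod int (Y k))"
      if "k \<in> {1..u}" "k = 1 \<longrightarrow> w = z" for k w
      using solvable[OF that] z_even that(1) by auto
  qed
  then obtain x where x: "x \<in> x_tuples q u G E F"
    and xz: "\<And>k. k \<in> {1..u} \<Longrightarrow> [int (\<Sum>i=1..u. A i * x i) = z] (mod int (Y k))"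
    unfolding x_tuples_def by blast
  define \<gamma> where "\<gamma> = gamma_x q g u G F x"
  have \<gamma>: "\<gamma> = 1 + int g * int (\<Sum>i=1..u. A i * x i)"
    unfolding \<gamma>_def gamma_x_def A_def exc_def by (rule refl)
  have \<gamma>\<delta>: "[\<delta>' = \<gamma>] (mod int (G k ^ E k * Y k))" if k: "k \<in> {1..u}" for k
  proof -
    have "int (Y k) dvd z - int (\<Sum>i=1..u. A i * x i)" using xz[OF k] by (simp add: cong_iff_dvd_diff dvd_diff_commute)
    then have "int (G k ^ E k) * int (Y k) dvd int g * (z - int (\<Sum>i=1..u. A i * x i))"
      using pow_E_dvd_g[OF k] by (intro mult_dvd_mono) (simp_all only: int_dvd_int_iff)
    also have "int g * (z - int (\<Sum>i=1..u. A i * x i)) = \<delta>' - \<gamma>"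
      using z unfolding \<gamma> by (simp only: algebra_simps)
    finally show ?thesis by (simp add: cong_iff_dvd_diff)
  qed
  have "\<exists>c. [\<delta>' * int q ^ c = \<gamma>] (mod int (G k) ^ (E k + F k))" if k: "k \<in> {1..u}" for k
  proof -
    have l: "prime (G k)" using G k by blast
    have "int (G k) dvd \<delta>' - 1"
      using G_dvd_g[OF k] \<open>int g dvd \<delta>' - 1\<close> by (meson dvd_trans int_dvd_int_iff)
    then have \<delta>'_unit: "\<not> int (G k) dvd \<delta>'"
    proof -
      have "\<not> int (G k) dvd \<delta>' - (\<delta>' - 1)" using prime_gt_1_nat[OF l] by simp
      then show ?thesis using \<open>int (G k) dvd \<delta>' - 1\<close> dvd_diff by blast
    qed
    \<comment> \<open>Agreement to precision \<nu>, the valuation of q^\<open>o'\<close> - 1,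
      suffices. In the exceptional case \<open>o'\<close> is 2 and \<nu> is v + 1; otherwise
      \<open>o'\<close> is 1.\<close>
    have orbit: "\<exists>c. [\<delta>' * int q ^ c = \<gamma>] (mod int (G k) ^ (E k + F k))"
      if ex: "exact_at (G k) \<nu> (int q ^ o')" and \<nu>: "\<nu> \<ge> 1" "G k = 2 \<longrightarrow> \<nu> \<ge> 2"
        and cong: "[\<delta>' = \<gamma>] (mod int (G k) ^ min (E k + F k) \<nu>)" for \<nu> o'
    proof (cases "E k + F k \<le> \<nu>")
      case True
      then have "[\<delta>' * int q ^ 0 = \<gamma>] (mod int (G k) ^ (E k + F k))" using cong by simp
      then show ?thesis by blast
    next
      case False
      then have "[\<delta>' = \<gamma>] (mod int (G k) ^ \<nu>)" using cong by simp
      then obtain i where "[(int q ^ o') ^ i * \<delta>' = \<gamma>] (mod int (G k) ^ (E k + F k))"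
        using orbit_prime_power[OF l \<nu> ex \<delta>'_unit] by blast
      then have "[\<delta>' * int q ^ (o' * i) = \<gamma>] (mod int (G k) ^ (E k + F k))"
        by (simp only: power_mult mult.commute[of \<delta>'])
      then show ?thesis by blast
    qed
    show ?thesis
    proof (cases "k = 1 \<and> exc")
      case True
      then have u: "u \<ge> 1" and exc using k by auto
      note ep = exc_props[OF this(2,1)]
      have Gk: "G k = 2" "E k = 1" using True ep by auto
      have "G k ^ E k * Y k = 2 ^ (1 + min (F k) v)" using True ep(3) Gk by (simp add: Y_def)
      also have "1 + min (F k) v = min (E k + F k) (v + 1)" using Gk by simp
      finally have "[\<delta>' = \<gamma>] (mod int (G k) ^ min (E k + F k) (v + 1))"
        using \<gamma>\<delta>[OF k] Gk by simp
      then show ?thesis using ep(5,6) Gk by (intro orbit[of "v + 1" 2]) auto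
    next
      case False
      define \<nu> where "\<nu> = multiplicity (G k) (q - 1)"
      have "Y k = G k ^ min (F k) (\<nu> - E k)"
        unfolding Y_def if_not_P[OF False] y_exp_eq[OF k False] \<nu>_def by (rule refl)
      then have "G k ^ E k * Y k = G k ^ (E k + min (F k) (\<nu> - E k))"
        by (simp only: power_add)
      also have "E k + min (F k) (\<nu> - E k) = min (E k + F k) \<nu>"
        using E_le[OF k] unfolding \<nu>_def by linarith
      finally have "G k ^ E k * Y k = G k ^ min (E k + F k) \<nu>" .
      then have cong: "[\<delta>' = \<gamma>] (mod int (G k) ^ min (E k + F k) \<nu>)" using \<gamma>\<delta>[OF k] by simp
      have ex: "exact_at (G k) \<nu> (int q ^ 1)" using exact_q[OF k] by (simp add: \<nu>_def)
      have "\<nu> \<ge> 1" using E_le[OF k] G[OF k] unfolding \<nu>_def by linarith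
      moreover have "\<nu> \<ge> 2" if G2: "G k = 2"
      proof -
        have "\<not> exceptional 2 q" using False G_eq_2[OF k G2] G2 by (auto simp: exc_def)
        then have "q mod 4 \<noteq> 3" by (simp add: exceptional_def)
        moreover have "odd q" using q_cong_1[OF k] G2 by (simp add: cong_iff_dvd_diff)
        ultimately have "q mod 4 = 1" by presburger
        then have "int q mod 4 = 1" by presburger
        then have "(4::int) dvd int q - 1" by presburger
        then show ?thesis using exact_at_mono_dvd[OF ex, of 2] G2 by simp
      qed
      ultimately show ?thesis using orbit[OF ex] cong by blast
    qed
  qed
  then obtain c where c: "\<And>k. k \<in> {1..u} \<Longrightarrow> [\<delta>' * int q ^ c k = \<gamma>] (mod int (G k) ^ (E k + F k))"
    by metis
  \<comment> \<open>The moduli are powers of distinct primes, so one exponent C meets all local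
    requirements.\<close>
  have "\<exists>C. \<forall>k\<in>{1..u}. [C = c k] (mod G k ^ (E k + F k))"
    using G_coprime by (intro chinese_remainder_nat) auto
  then obtain C where C: "\<And>k. k \<in> {1..u} \<Longrightarrow> [C = c k] (mod G k ^ (E k + F k))" by blast
  have "[\<delta>' * int q ^ C = \<gamma>] (mod int (G k ^ (E k + F k)))" if k: "k \<in> {1..u}" for k
  proof -
    have "[\<delta>' * int q ^ C = \<delta>' * int q ^ c k] (mod int (G k) ^ (E k + F k))"
      by (intro cong_scalar_left cong_power_exponent q_cong_1 C k)
    then show ?thesis using c[OF k] by (simp add: cong_trans[of "\<delta>' * int q ^ C"])
  qed
  then have "[\<delta>' * int q ^ C = \<gamma>] (mod (\<Prod>k=1..u. int (G k ^ (E k + F k))))"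
    using G_coprime by (intro cong_cong_prod_coprime) auto
  moreover have "(\<Prod>k=1..u. int (G k ^ (E k + F k))) = int (n\<^sub>1 * g)"
    by (simp add: n1 g power_add prod.distrib)
  ultimately have "[\<delta> * int q ^ (c\<^sub>0 + C) = \<gamma>] (mod int (n\<^sub>1 * g))"
    by (simp add: \<delta>'_def power_add mult.assoc)
  then show ?thesis using x unfolding \<gamma>_def by blast
qed

end

section \<open>Constacyclic codes as ideals\<close>

definition vec_poly :: "nat \<Rightarrow> 'a::field Matrix.vec \<Rightarrow> 'a poly" where
  "vec_poly N c = (\<Sum>i<N. Polynomial.monom (c $ i) i)"

definition binomial_modulus :: "nat \<Rightarrow> 'a::field \<Rightarrow> 'a poly" where
  "binomial_modulus N lam = Polynomial.monom 1 N - [:lam:]"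

lemma vec_class_eq: "vec_class N lam c = residue_class N lam (vec_poly N c)"
  by (simp add: vec_class_def vec_poly_def)

lemma modulus_ideal_iff: "f \<in> modulus_ideal N lam \<longleftrightarrow> binomial_modulus N lam dvd f"
  unfolding modulus_ideal_def cgenideal_def by (auto simp: dvd_def mult.commute binomial_modulus_def)

lemma residue_class_iff: "h \<in> residue_class N lam f \<longleftrightarrow> binomial_modulus N lam dvd h - f"
proof -
  have "h \<in> residue_class N lam f \<longleftrightarrow> h - f \<in> modulus_ideal N lam"
    unfolding residue_class_def a_r_coset_def' by (auto simp: algebra_simps intro: bexI[of _ "h - f"])
  then show ?thesis by (simp only: modulus_ideal_iff)
qed

lemma residue_class_eq_iff:
  "residue_class N lam f = residue_class N lam h \<longleftrightarrow> binomial_modulus N lam dvd f - h"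
proof
  assume "residue_class N lam f = residue_class N lam h"
  moreover have "f \<in> residue_class N lam f" by (simp add: residue_class_iff)
  ultimately show "binomial_modulus N lam dvd f - h" by (simp add: residue_class_iff)
next
  assume fh: "binomial_modulus N lam dvd f - h"
  have "binomial_modulus N lam dvd k - f \<longleftrightarrow> binomial_modulus N lam dvd k - h" for k
    using fh dvd_add_left_iff[OF fh, of "k - f"] by (simp add: algebra_simps)
  then show "residue_class N lam f = residue_class N lam h"
    by (auto simp: residue_class_iff)
qed

lemma PIdl_residue_class:
  "PIdl\<^bsub>constacyclic_ring N lam\<^esub> (residue_class N lam f) = {residue_class N lam (x * f) | x. True}"
proof -
  have I: "ideal (modulus_ideal N lam) (class_ring :: 'a::field poly ring)" for N and lam :: 'a
    unfolding modulus_ideal_def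
    by (rule cring.cgenideal_ideal[OF class_cring.is_cring]) simp
  have mult: "residue_class N lam x \<otimes>\<^bsub>constacyclic_ring N lam\<^esub> residue_class N lam f = residue_class N lam (x * f)" for x
    using ideal.rcoset_mult_add[OF I, of x f] by (simp add: constacyclic_ring_def FactRing_def residue_class_def)
  have carr: "carrier (constacyclic_ring N lam) = {residue_class N lam x | x. True}"
    by (auto simp: constacyclic_ring_def FactRing_def A_RCOSETS_def' residue_class_def)
  show ?thesis unfolding cgenideal_def carr by (auto simp: mult) (metis mult)
qed

context
  fixes N :: nat and lam :: "'a::field"
  assumes N: "N > 0"
begin

lemma degree_binomial: "degree (binomial_modulus N lam) = N"
proof -
  have "degree (- [:lam:]) < degree (Polynomial.monom (1::'a) N)"
    using N by (simp add: degree_monom_eq)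
  then have "degree (Polynomial.monom 1 N + - [:lam:]) = degree (Polynomial.monom (1::'a) N)"
    by (rule degree_add_eq_left)
  then show ?thesis
    by (simp only: binomial_modulus_def diff_conv_add_uminus degree_monom_eq one_neq_zero not_False_eq_True)
qed

lemma binomial_nonzero: "binomial_modulus N lam \<noteq> 0"
  using degree_binomial N by auto

lemma vec_poly_surj:
  obtains c where "c \<in> carrier_vec N" "binomial_modulus N lam dvd f - vec_poly N c"
proof
  define r where "r = f mod binomial_modulus N lam"
  define c where "c = Matrix.vec N (Polynomial.coeff r)"
  show "c \<in> carrier_vec N" by (simp add: c_def)
  have "degree r < N"
    using degree_mod_less[OF binomial_nonzero, of f] degree_binomial N by (auto simp: r_def)
  then have "r = vec_poly N c"
    by (intro poly_eqI) (auto simp: vec_poly_def coeff_sum coeff_eq_0 c_def)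
  then show "binomial_modulus N lam dvd f - vec_poly N c"
    unfolding r_def by (metis dvd_minus_mod)
qed

lemma constacyclic_shift_carrier:
  assumes "c \<in> carrier_vec N"
  shows "constacyclic_shift lam c \<in> carrier_vec N"
  using carrier_vecD[OF assms] unfolding constacyclic_shift_def by (intro carrier_vecI) simp

text \<open>The shift is multiplication by X except for the overflow c_(N-1) X^N, which the modulus
  turns into \<lambda> c_(N-1).\<close>

lemma vec_poly_shift:
  assumes "c \<in> carrier_vec N"
  shows "vec_poly N (constacyclic_shift lam c)
    = [:0, 1:] * vec_poly N c - [:c $ (N - 1):] * binomial_modulus N lam"
proof (rule poly_eqI)
  fix k
  have coeff: "Polynomial.coeff (vec_poly N c) i = (if i < N then c $ i else 0)" for i and c :: "'a Matrix.vec"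
    by (simp add: vec_poly_def coeff_sum)
  show "Polynomial.coeff (vec_poly N (constacyclic_shift lam c)) k =
      Polynomial.coeff ([:0, 1:] * vec_poly N c - [:c $ (N - 1):] * binomial_modulus N lam) k"
    using assms N
  proof (cases k)
    case 0
    then show ?thesis
      using assms N by (simp add: coeff coeff_pCons binomial_modulus_def constacyclic_shift_def)
  next
    case (Suc i)
    have "i = N - 1" if "i < N" "\<not> Suc i < N" using that by linarith
    then show ?thesis
      using assms N Suc
      by (auto simp: coeff coeff_pCons binomial_modulus_def constacyclic_shift_def)
  qed
qed

lemma vec_poly_add:
  "c \<in> carrier_vec N \<Longrightarrow> d \<in> carrier_vec N \<Longrightarrow> vec_poly N (c + d) = vec_poly N c + vec_poly N d"
  by (simp add: vec_poly_def sum.distrib[symmetric] add_monom)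

lemma vec_poly_smult: "c \<in> carrier_vec N \<Longrightarrow> vec_poly N (a \<cdot>\<^sub>v c) = [:a:] * vec_poly N c"
  by (simp add: vec_poly_def sum_distrib_left smult_monom)

lemma vec_poly_zero: "vec_poly N (0\<^sub>v N) = (0 :: 'a poly)"
  by (simp add: vec_poly_def)

lemma constacyclic_codeD:
  assumes "constacyclic_code N lam C"
  shows "C \<subseteq> carrier_vec N" "0\<^sub>v N \<in> C" "c \<in> C \<Longrightarrow> d \<in> C \<Longrightarrow> c + d \<in> C" "c \<in> C \<Longrightarrow> a \<cdot>\<^sub>v c \<in> C"
    "c \<in> C \<Longrightarrow> constacyclic_shift lam c \<in> C"
  using assms unfolding constacyclic_code_def VectorSpace.subspace_def submodule_def
  by (auto simp: module_vec_simps)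

text \<open>C consists of the coefficient vectors of the elements of the ideal generated by f and
  the modulus. The shift corresponds to multiplication by X, and division with remainder puts a
  vector into every residue class.\<close>

lemma constacyclic_code_of_poly:
  fixes f :: "'a poly"
  shows "\<exists>C. constacyclic_code N lam C \<and>
    vec_class N lam ` C = {residue_class N lam (x * f) | x. True}"
proof -
  let ?W = "binomial_modulus N lam"
  define C where "C = {c \<in> carrier_vec N. \<exists>x. ?W dvd vec_poly N c - x * f}"
  have "constacyclic_code N lam C"
    unfolding constacyclic_code_def VectorSpace.subspace_def submodule_def
  proof (intro conjI allI impI)
    show "vectorspace class_ring (module_vec TYPE('a) N)" by (rule vec_vs)
    show "Module.module class_ring (module_vec TYPE('a) N)" by (rule vec_module)
    show "C \<subseteq> carrier (module_vec TYPE('a) N)" by (auto simp: C_def module_vec_simps)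
    show "\<zero>\<^bsub>module_vec TYPE('a) N\<^esub> \<in> C"
      by (auto simp: C_def module_vec_simps vec_poly_zero intro!: exI[of _ 0])
  next
    fix c d assume "c \<in> C" "d \<in> C"
    then obtain x y where cd: "c \<in> carrier_vec N" "d \<in> carrier_vec N"
      "?W dvd vec_poly N c - x * f" "?W dvd vec_poly N d - y * f" by (auto simp: C_def)
    have "?W dvd (vec_poly N c - x * f) + (vec_poly N d - y * f)" using cd(3,4) by (rule dvd_add)
    also have "(vec_poly N c - x * f) + (vec_poly N d - y * f) = vec_poly N (c + d) - (x + y) * f"
      unfolding vec_poly_add[OF cd(1,2)] by (simp add: algebra_simps)
    finally show "c \<oplus>\<^bsub>module_vec TYPE('a) N\<^esub> d \<in> C"
      using cd(1,2) unfolding C_def module_vec_simps by (blast intro: add_carrier_vec)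
  next
    fix a c assume "c \<in> C"
    then obtain x where c: "c \<in> carrier_vec N" "?W dvd vec_poly N c - x * f" by (auto simp: C_def)
    have "?W dvd [:a:] * (vec_poly N c - x * f)" using c(2) by (rule dvd_mult)
    also have "[:a:] * (vec_poly N c - x * f) = vec_poly N (a \<cdot>\<^sub>v c) - ([:a:] * x) * f"
      unfolding vec_poly_smult[OF c(1)] by (simp only: right_diff_distrib mult.assoc)
    finally show "a \<odot>\<^bsub>module_vec TYPE('a) N\<^esub> c \<in> C"
      using c(1) unfolding C_def module_vec_simps by (blast intro: smult_carrier_vec[THEN iffD2])
  next
    show "constacyclic_shift lam ` C \<subseteq> C"
    proof
      fix d assume "d \<in> constacyclic_shift lam ` C"
      then obtain c x where c: "c \<in> carrier_vec N" "?W dvd vec_poly N c - x * f"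
        and d: "d = constacyclic_shift lam c" by (auto simp: C_def)
      have "?W dvd [:0, 1:] * (vec_poly N c - x * f) - [:c $ (N - 1):] * ?W"
        by (rule dvd_diff[OF dvd_mult[OF c(2)] dvd_triv_right])
      also have "[:0, 1:] * (vec_poly N c - x * f) - [:c $ (N - 1):] * ?W = vec_poly N d - ([:0, 1:] * x) * f"
        unfolding d vec_poly_shift[OF c(1)] by (simp only: right_diff_distrib mult.assoc) (simp only: algebra_simps)
      finally have "?W dvd vec_poly N d - ([:0, 1:] * x) * f" .
      moreover have "d \<in> carrier_vec N" unfolding d using c(1) by (rule constacyclic_shift_carrier)
      ultimately show "d \<in> C" unfolding C_def by (intro CollectI conjI exI)
    qed
  qed
  moreover have "vec_class N lam ` C = {residue_class N lam (x * f) | x. True}"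
  proof (intro Set.set_eqI iffI)
    fix K assume "K \<in> vec_class N lam ` C"
    then show "K \<in> {residue_class N lam (x * f) | x. True}"
      by (auto simp: vec_class_eq residue_class_eq_iff C_def)
  next
    fix K assume "K \<in> {residue_class N lam (x * f) | x. True}"
    then obtain x where K: "K = residue_class N lam (x * f)" by blast
    obtain c where c: "c \<in> carrier_vec N" "?W dvd x * f - vec_poly N c" by (rule vec_poly_surj)
    have "?W dvd vec_poly N c - x * f" using c(2) by (simp add: dvd_diff_commute)
    then have "c \<in> C" using c(1) by (auto simp: C_def)
    moreover have "K = vec_class N lam c" unfolding K vec_class_eq residue_class_eq_iff by (rule c(2))
    ultimately show "K \<in> vec_class N lam ` C" by blast
  qed
  ultimately show ?thesis by blast
qed

text \<open>Pulled back to F_q[X], the code becomes an ideal K: closure under constants and under X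
  gives closure under all polynomials. A nonzero element of least degree generates K, and it divides
  the modulus, which lies in K as a preimage of 0.\<close>

lemma constacyclic_code_generator:
  assumes C: "constacyclic_code N lam C"
  shows "\<exists>d. d dvd binomial_modulus N lam \<and>
    vec_class N lam ` C = {residue_class N lam (x * d) | x. True}"
proof -
  let ?W = "binomial_modulus N lam"
  note code = constacyclic_codeD[OF C]
  define K where "K = {f. \<exists>c\<in>C. ?W dvd f - vec_poly N c}"
  have W_K: "?W \<in> K" using code(2) by (auto simp: K_def vec_poly_zero intro!: bexI[of _ "0\<^sub>v N"])
  have K_add: "f + f' \<in> K" if ff: "f \<in> K" "f' \<in> K" for f f'
  proof -
    obtain c c' where c: "c \<in> C" "c' \<in> C" "?W dvd f - vec_poly N c" "?W dvd f' - vec_poly N c'"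
      using ff by (auto simp: K_def)
    have "?W dvd (f - vec_poly N c) + (f' - vec_poly N c')" using c(3,4) by (rule dvd_add)
    also have "(f - vec_poly N c) + (f' - vec_poly N c') = (f + f') - vec_poly N (c + c')"
      using c(1,2) code(1) by (subst vec_poly_add) (auto simp: algebra_simps)
    finally show ?thesis using code(3)[OF c(1,2)] unfolding K_def by blast
  qed
  have K_const: "[:a:] * f \<in> K" if f: "f \<in> K" for a f
  proof -
    obtain c where c: "c \<in> C" "?W dvd f - vec_poly N c" using f by (auto simp: K_def)
    have "?W dvd [:a:] * (f - vec_poly N c)" using c(2) by (rule dvd_mult)
    also have "[:a:] * (f - vec_poly N c) = [:a:] * f - vec_poly N (a \<cdot>\<^sub>v c)"
      using c(1) code(1) by (subst vec_poly_smult) (auto simp only: right_diff_distrib)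
    finally show ?thesis using code(4)[OF c(1)] unfolding K_def by blast
  qed
  have K_shift: "[:0, 1:] * f \<in> K" if f: "f \<in> K" for f
  proof -
    obtain c where c: "c \<in> C" "?W dvd f - vec_poly N c" using f by (auto simp: K_def)
    then have cN: "c \<in> carrier_vec N" using code(1) by blast
    have "?W dvd [:0, 1:] * (f - vec_poly N c) + [:c $ (N - 1):] * ?W"
      by (rule dvd_add[OF dvd_mult[OF c(2)] dvd_triv_right])
    also have "[:0, 1:] * (f - vec_poly N c) + [:c $ (N - 1):] * ?W
        = [:0, 1:] * f - vec_poly N (constacyclic_shift lam c)"
      unfolding vec_poly_shift[OF cN] by (simp only: right_diff_distrib) (simp only: algebra_simps)
    finally show ?thesis using code(5)[OF c(1)] unfolding K_def by blast
  qed
  have K_mult: "x * f \<in> K" if f: "f \<in> K" for x f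
  proof (induction x)
    case 0
    show ?case using K_const[OF f, of 0] by simp
  next
    case (pCons a x)
    have "pCons a x * f = [:a:] * f + [:0, 1:] * (x * f)" by simp
    then show ?case using K_add[OF K_const[OF f] K_shift[OF pCons.IH]] by simp
  qed
  define P where "P d \<longleftrightarrow> d \<in> K \<and> d \<noteq> 0" for d
  have "P ?W" using W_K binomial_nonzero by (simp add: P_def)
  then obtain d where d: "P d" "\<And>d'. P d' \<Longrightarrow> degree d \<le> degree d'"
    using ex_has_least_nat[of P ?W degree] by blast
  have d_dvd: "d dvd f" if f: "f \<in> K" for f
  proof (rule ccontr)
    assume "\<not> d dvd f"
    then have "f mod d \<noteq> 0" by (simp add: dvd_eq_mod_eq_0)
    moreover have mod: "f + (- (f div d)) * d = f mod d"
      unfolding mult_minus_left add_uminus_conv_diff by (rule minus_div_mult_eq_mod)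
    have "d \<in> K" using d(1) by (simp add: P_def)
    then have "f mod d \<in> K" using K_add[OF f K_mult] unfolding mod[symmetric] by blast
    ultimately have "degree d \<le> degree (f mod d)" by (intro d(2)) (simp add: P_def)
    moreover have "degree (f mod d) < degree d"
      using degree_mod_less[of d f] d(1) \<open>f mod d \<noteq> 0\<close> by (auto simp: P_def)
    ultimately show False by simp
  qed
  have "vec_class N lam ` C = {residue_class N lam (x * d) | x. True}"
  proof (intro Set.set_eqI iffI)
    fix L assume "L \<in> vec_class N lam ` C"
    then obtain c where c: "c \<in> C" "L = residue_class N lam (vec_poly N c)" by (auto simp: vec_class_eq)
    then have "vec_poly N c \<in> K" by (auto simp: K_def intro: bexI[of _ c])
    then obtain x where "vec_poly N c = x * d" using d_dvd by (metis dvdE mult.commute)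
    then show "L \<in> {residue_class N lam (x * d) | x. True}" using c(2) by auto
  next
    fix L assume "L \<in> {residue_class N lam (x * d) | x. True}"
    then obtain x where L: "L = residue_class N lam (x * d)" by blast
    have "x * d \<in> K" using K_mult d(1) by (simp add: P_def)
    then obtain c where c: "c \<in> C" "?W dvd x * d - vec_poly N c" by (auto simp: K_def)
    then have "L = vec_class N lam c" by (simp add: L vec_class_eq residue_class_eq_iff)
    then show "L \<in> vec_class N lam ` C" using c(1) by blast
  qed
  then show ?thesis using d_dvd[OF W_K] by blast
qed

end

section \<open>Coset polynomials\<close>

lemma dvd_prime_elem_multD:
  fixes \<pi> :: "'a::idom"
  assumes "prime_elem \<pi>" "d dvd \<pi> * r"
  shows "d dvd r \<or> (\<exists>d'. d = \<pi> * d' \<and> d' dvd r)"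
proof -
  obtain e where e: "\<pi> * r = d * e" using assms(2) by blast
  have nz: "\<pi> \<noteq> 0" using assms(1) by auto
  have "\<pi> dvd d * e" using e by (metis dvd_triv_left)
  then consider "\<pi> dvd d" | "\<pi> dvd e" using assms(1) by (auto simp: prime_elem_dvd_mult_iff)
  then show ?thesis
  proof cases
    case 1
    then obtain d' where d': "d = \<pi> * d'" ..
    then have "r = d' * e" using e nz by simp
    then show ?thesis using d' by auto
  next
    case 2
    then obtain e' where "e = \<pi> * e'" ..
    then have "\<pi> * r = \<pi> * (d * e')" using e by (simp add: mult_ac)
    then have "r = d * e'" using nz by simp
    then show ?thesis by simp
  qed
qed

lemma dvd_prime_elem_power_multD:
  fixes \<pi> :: "'a::idom"
  assumes "prime_elem \<pi>" "d dvd \<pi> ^ k * r"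
  shows "\<exists>m\<le>k. \<exists>d'. d = \<pi> ^ m * d' \<and> d' dvd r"
  using assms(2)
proof (induction k arbitrary: d)
  case 0
  then show ?case by simp
next
  case (Suc k)
  then have "d dvd \<pi> * (\<pi> ^ k * r)" by (simp add: mult.assoc)
  from dvd_prime_elem_multD[OF assms(1) this] show ?case
  proof
    assume "d dvd \<pi> ^ k * r"
    from Suc.IH[OF this] show ?case using le_SucI by blast
  next
    assume "\<exists>d'. d = \<pi> * d' \<and> d' dvd \<pi> ^ k * r"
    then obtain d' where d': "d = \<pi> * d'" "d' dvd \<pi> ^ k * r" by blast
    from Suc.IH[OF d'(2)] obtain m d'' where "m \<le> k" "d' = \<pi> ^ m * d''" "d'' dvd r" by blast
    then show ?case using d'(1) by (intro exI[of _ "Suc m"]) (auto simp: mult.assoc)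
  qed
qed

text \<open>Each prime factor either divides d and is split off, or divides the cofactor and is
  cancelled, until only a unit is left. The \<pi> x may be associated with one another, in which
  case the exponents are not unique.\<close>

lemma dvd_prod_prime_elem_powerD:
  fixes \<pi> :: "'b \<Rightarrow> 'a::idom"
  assumes "finite A" "\<And>x. x \<in> A \<Longrightarrow> prime_elem (\<pi> x)" "d dvd (\<Prod>x\<in>A. \<pi> x ^ k)"
  shows "\<exists>\<Omega> u. (\<forall>x\<in>A. \<Omega> x \<le> k) \<and> u dvd 1 \<and> d = u * (\<Prod>x\<in>A. \<pi> x ^ \<Omega> x)"
  using assms
proof (induction A arbitrary: d rule: finite_induct)
  case empty
  then show ?case by auto
next
  case (insert x A)
  then have "d dvd \<pi> x ^ k * (\<Prod>x\<in>A. \<pi> x ^ k)" by simp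
  then obtain m d' where m: "m \<le> k" "d = \<pi> x ^ m * d'" "d' dvd (\<Prod>x\<in>A. \<pi> x ^ k)"
    using dvd_prime_elem_power_multD[of "\<pi> x"] insert.prems(1) by blast
  from insert.IH[OF insert.prems(1) m(3)] obtain \<Omega> u
    where \<Omega>: "\<And>x. x \<in> A \<Longrightarrow>  \<Omega> x \<le> k" "u dvd 1" "d' = u * (\<Prod>x\<in>A. \<pi> x ^ \<Omega> x)" by blast
  have "(\<Prod>y\<in>A. \<pi> y ^ (\<Omega>(x := m)) y) = (\<Prod>y\<in>A. \<pi> y ^ \<Omega> y)"
    using insert.hyps(2) by (intro prod.cong) auto
  then have "d = u * (\<Prod>y\<in>insert x A. \<pi> y ^ (\<Omega>(x := m)) y)"
    using insert.hyps m(2) \<Omega>(3) by (simp add: mult_ac)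
  moreover have "\<forall>y\<in>insert x A. (\<Omega>(x := m)) y \<le> k" using m(1) \<Omega>(1) by auto
  ultimately show ?case using \<Omega>(2) by blast
qed

lemma prod_linear_factors_dvd:
  fixes f :: "'a::idom poly"
  assumes "finite S" "\<And>x. x \<in> S \<Longrightarrow> poly f x = 0"
  shows "(\<Prod>x\<in>S. [:- x, 1:]) dvd f"
  using assms
proof (induction S arbitrary: f rule: finite_induct)
  case (insert x S)
  then have "[:- x, 1:] dvd f" by (simp add: poly_eq_0_iff_dvd)
  then obtain f' where f': "f = [:- x, 1:] * f'" ..
  have "poly f' y = 0" if "y \<in> S" for y
    using insert.prems[of y] insert.hyps(2) that f' by auto
  then have "(\<Prod>x\<in>S. [:- x, 1:]) dvd f'" by (rule insert.IH)
  then show ?case using insert.hyps by (simp add: f' del: mult_pCons_left)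
qed simp

section \<open>Descent from the algebraic closure to F_q\<close>

lemma to_ac_field_hom: "field_hom (to_ac :: 'a::field \<Rightarrow> 'a alg_closure)"
  by unfold_locales auto

interpretation ac: field_hom "to_ac :: 'a::field \<Rightarrow> 'a alg_closure"
  by (rule to_ac_field_hom)

interpretation ac_poly: map_poly_inj_idom_hom "to_ac :: 'a::field \<Rightarrow> 'a alg_closure" ..

text \<open>The polynomial X^c - X has at most c roots, and the c elements of the ground field are
  already roots of it.\<close>

lemma range_to_ac:
  fixes y :: "'a::finite_field alg_closure"
  assumes "y ^ card (UNIV :: 'a set) = y"
  shows "y \<in> range to_ac"
proof -
  define c where "c = card (UNIV :: 'a set)"
  have "c > 1" unfolding c_def using card_mono[of "UNIV :: 'a set" "{0, 1}"] by simp
  define f where "f = Polynomial.monom (1 :: 'a alg_closure) c - [:0, 1:]"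
  have "Polynomial.coeff f c = 1" using \<open>c > 1\<close> by (simp add: f_def coeff_pCons split: nat.split)
  then have "f \<noteq> 0" by auto
  have "degree f \<le> c" unfolding f_def using \<open>c > 1\<close> by (intro degree_diff_le) (auto simp: degree_monom_le)
  have roots: "{x. poly f x = 0} = {x. x ^ c = x}" by (auto simp: f_def poly_monom)
  have fin: "finite {x :: 'a alg_closure. x ^ c = x}" using poly_roots_finite[OF \<open>f \<noteq> 0\<close>] roots by simp
  have sub: "range to_ac \<subseteq> {x :: 'a alg_closure. x ^ c = x}"
  proof
    fix x :: "'a alg_closure" assume "x \<in> range to_ac"
    then obtain a where "x = to_ac a" by blast
    then show "x \<in> {x. x ^ c = x}"
      using finite_field_power_card_eq_same[of a] by (simp add: c_def flip: to_ac_power)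
  qed
  have "card {x :: 'a alg_closure. x ^ c = x} \<le> c"
    using card_poly_roots_bound[OF \<open>f \<noteq> 0\<close>] roots \<open>degree f \<le> c\<close> by simp
  also have "c = card (range (to_ac :: 'a \<Rightarrow> _))"
    by (simp add: c_def card_image inj_to_ac)
  finally have "range to_ac = {x :: 'a alg_closure. x ^ c = x}"
    using card_seteq[OF fin sub] by simp
  then show ?thesis using assms by (simp add: c_def)
qed

lemma CHAR_eq:
  assumes "prime p" "card (UNIV :: 'a::finite_field set) = p ^ e"
  shows "CHAR('a) = p"
proof -
  have "CHAR('a) dvd p ^ e" using CHAR_dvd_CARD[where ?'a = 'a] assms by simp
  moreover have "prime CHAR('a)" by (rule CHAR_prime)
  ultimately show ?thesis using assms(1) prime_dvd_power primes_dvd_imp_eq by blast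
qed

lemma frobenius_hom:
  assumes "prime p" "card (UNIV :: 'a::finite_field set) = p ^ e"
  shows "comm_ring_hom (\<lambda>x :: 'a alg_closure. x ^ (p ^ e))"
proof -
  have "CHAR('a alg_closure) = p" using CHAR_eq[OF assms] by simp
  then have "(x + y) ^ (p ^ e) = x ^ (p ^ e) + y ^ (p ^ e)" for x y :: "'a alg_closure"
    using freshmans_dream'[where ?'a = "'a alg_closure"] assms(1) by simp
  then show ?thesis
    using assms(1) by unfold_locales (auto simp: power_mult_distrib prime_gt_0_nat)
qed

section \<open>Cosets as orbits, and the sets of roots attached to them\<close>

lemma mem_cyclotomic_coset:
  assumes "coprime M q" "[i = \<gamma> * int q ^ c] (mod int M)"
  shows "i mod int M \<in> cyclotomic_coset q M \<gamma>"
proof -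
  define \<theta> where "\<theta> = coset_size q M \<gamma>"
  have pos: "\<theta> > 0" unfolding \<theta>_def using coset_size_pos[OF assms(1)] .
  have "[\<gamma> * int q ^ (\<theta> * (c div \<theta>)) = \<gamma>] (mod int M)"
    using cong_power_iff_coset_size_dvd[OF assms(1)] by (simp add: \<theta>_def)
  then have "[\<gamma> * int q ^ (\<theta> * (c div \<theta>)) * int q ^ (c mod \<theta>) = \<gamma> * int q ^ (c mod \<theta>)] (mod int M)"
    by (rule cong_scalar_right)
  then have "[\<gamma> * int q ^ c = \<gamma> * int q ^ (c mod \<theta>)] (mod int M)"
    by (simp add: mult.assoc power_add[symmetric])
  then have "i mod int M = (\<gamma> * int q ^ (c mod \<theta>)) mod int M"
    using assms(2) by (simp add: cong_def)
  then show ?thesis unfolding cyclotomic_coset_def \<theta>_def[symmetric] using pos by (intro image_eqI[of _ _ "c mod \<theta>"]) auto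
qed

lemma mem_cyclotomic_cosetE:
  assumes "i \<in> cyclotomic_coset q M \<gamma>"
  obtains c where "i = (\<gamma> * int q ^ c) mod int M"
  using assms unfolding cyclotomic_coset_def by blast

text \<open>Multiplication by q is invertible modulo M, so the orbit can be followed backwards: the
  exponent c' completes c to a multiple of the order of q.\<close>

lemma mem_cyclotomic_coset_inverse:
  assumes "coprime M q" "[i * int q ^ c = \<gamma>] (mod int M)"
  shows "i mod int M \<in> cyclotomic_coset q M \<gamma>"
proof -
  define o' where "o' = ord M q"
  have pos: "o' > 0" using assms(1) by (simp add: o'_def)
  have one: "[int q ^ o' = 1] (mod int M)"
    using ord[of q M] unfolding o'_def by (simp add: cong_int_iff[symmetric])
  define c' where "c' = o' * c - c"
  have "c + c' = o' * c" using pos by (simp add: c'_def)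
  have "[\<gamma> * int q ^ c' = i * int q ^ c * int q ^ c'] (mod int M)"
    using assms(2) by (intro cong_scalar_right) (rule cong_sym)
  also have "i * int q ^ c * int q ^ c' = i * (int q ^ o') ^ c"
    using \<open>c + c' = o' * c\<close> by (simp add: mult.assoc power_add[symmetric] power_mult[symmetric])
  also have "[i * (int q ^ o') ^ c = i * 1 ^ c] (mod int M)"
    using one by (intro cong_scalar_left cong_pow)
  finally have "[i = \<gamma> * int q ^ c'] (mod int M)" by (simp add: cong_sym)
  then show ?thesis by (rule mem_cyclotomic_coset[OF assms(1)])
qed

lemma finite_cyclotomic_coset: "finite (cyclotomic_coset q M \<gamma>)"
  by (simp add: cyclotomic_coset_def)

locale coset_polys =
  fixes p e q M :: nat and zeta :: "nat \<Rightarrow> 'a::finite_field alg_closure"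
  assumes p: "prime p" and card_q: "card (UNIV :: 'a set) = q" and qpe: "q = p ^ e"
    and M: "coprime M q" and zeta: "primitive_root_of_unity M (zeta M)"
begin

definition \<zeta> where "\<zeta> = zeta M"

text \<open>Integer exponents are reduced modulo M first, so that \<open>rt\<close> depends on the
  residue class alone; it agrees with \<open>powi\<close>.\<close>

definition rt :: "int \<Rightarrow> 'a alg_closure" where "rt i = \<zeta> ^ nat (i mod int M)"

lemma M_pos: "M > 0" and zeta_pow: "\<zeta> ^ M = 1"
  and zeta_prim: "0 < k \<Longrightarrow> k < M \<Longrightarrow> \<zeta> ^ k \<noteq> 1"
  using zeta by (auto simp: primitive_root_of_unity_def \<zeta>_def)

lemma zeta_nonzero: "\<zeta> \<noteq> 0"
  using zeta_pow M_pos by (metis power_0_left zero_neq_one not_gr0)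

lemma zeta_pow_mod: "\<zeta> ^ (k mod M) = \<zeta> ^ k"
proof -
  have "\<zeta> ^ k = \<zeta> ^ (M * (k div M) + k mod M)" by simp
  also have "\<dots> = \<zeta> ^ (k mod M)" unfolding power_add power_mult zeta_pow by simp
  finally show ?thesis ..
qed

lemma zeta_pow_eq_1_iff: "\<zeta> ^ k = 1 \<longleftrightarrow> M dvd k"
proof
  assume "\<zeta> ^ k = 1"
  then have "\<not> 0 < k mod M" using zeta_prim[of "k mod M"] M_pos zeta_pow_mod[of k] by auto
  then show "M dvd k" by auto
next
  assume "M dvd k"
  then show "\<zeta> ^ k = 1" by (auto simp: power_mult zeta_pow)
qed

lemma rt_cong: "[i = j] (mod int M) \<Longrightarrow> rt i = rt j"
  by (simp add: rt_def cong_def)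

lemma rt_power: "rt i ^ k = rt (i * int k)"
proof -
  have "nat (i * int k mod int M) = (nat (i mod int M) * k) mod M"
  proof -
    have "int ((nat (i mod int M) * k) mod M) = (i mod int M) * int k mod int M"
      using M_pos by (simp add: zmod_int)
    also have "\<dots> = i * int k mod int M" by (simp add: mod_simps)
    finally show ?thesis by (metis nat_int)
  qed
  then show ?thesis by (simp add: rt_def power_mult[symmetric] zeta_pow_mod)
qed

lemma rt_powi: "rt i = \<zeta> powi i"
proof -
  have "\<zeta> powi i = \<zeta> powi (int M * (i div int M) + i mod int M)" by simp
  also have "\<dots> = \<zeta> powi (int M * (i div int M)) * \<zeta> powi (i mod int M)"
    using zeta_nonzero by (simp only: power_int_add simp_thms)
  also have "\<zeta> powi (int M * (i div int M)) = (\<zeta> powi int M) powi (i div int M)" by (rule power_int_mult)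
  also have "\<zeta> powi int M = 1" by (simp add: zeta_pow)
  also have "\<zeta> powi (i mod int M) = rt i" using M_pos by (simp add: power_int_def rt_def)
  finally show ?thesis by simp
qed

lemma rt_eq_iff: "rt i = rt j \<longleftrightarrow> [i = j] (mod int M)"
proof
  assume "rt i = rt j"
  then have "\<zeta> powi (i - j) = 1" using zeta_nonzero by (simp add: rt_powi power_int_diff)
  then have "rt (i - j) = 1" by (simp add: rt_powi)
  then have "M dvd nat ((i - j) mod int M)" by (simp add: rt_def zeta_pow_eq_1_iff)
  moreover have "nat ((i - j) mod int M) < M" using M_pos by (simp add: nat_less_iff)
  ultimately have "nat ((i - j) mod int M) = 0" by (meson dvd_imp_le not_le neq0_conv)
  then have "(i - j) mod int M = 0" using M_pos pos_mod_sign[of "int M" "i - j"] by linarith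
  then show "[i = j] (mod int M)" by (simp add: cong_iff_dvd_diff dvd_eq_mod_eq_0)
qed (rule rt_cong)

definition root_set where "root_set \<delta> = rt ` cyclotomic_coset q M \<delta>"

lemma mem_root_set:
  assumes "[i * int q ^ c = \<delta>] (mod int M)"
  shows "rt i \<in> root_set \<delta>"
proof -
  have "rt (i mod int M) \<in> root_set \<delta>"
    unfolding root_set_def using mem_cyclotomic_coset_inverse[OF M assms] by (rule imageI)
  then show ?thesis by (simp add: rt_def)
qed

lemma root_set_eq: "root_set \<delta> = {rt (\<delta> * int q ^ c) | c. True}"
proof (intro Set.set_eqI iffI)
  fix x assume "x \<in> root_set \<delta>"
  then obtain i where i: "i \<in> cyclotomic_coset q M \<delta>" "x = rt i" by (auto simp: root_set_def)
  from i(1) obtain c where "i = (\<delta> * int q ^ c) mod int M" by (rule mem_cyclotomic_cosetE)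
  then have "x = rt (\<delta> * int q ^ c)" using i(2) by (simp add: rt_def)
  then show "x \<in> {rt (\<delta> * int q ^ c) | c. True}" by blast
next
  fix x assume "x \<in> {rt (\<delta> * int q ^ c) | c. True}"
  then obtain c where c: "x = rt (\<delta> * int q ^ c)" by blast
  have "(\<delta> * int q ^ c) mod int M \<in> cyclotomic_coset q M \<delta>"
    by (rule mem_cyclotomic_coset[OF M cong_refl])
  then have "rt ((\<delta> * int q ^ c) mod int M) \<in> root_set \<delta>" unfolding root_set_def by (rule imageI)
  then show "x \<in> root_set \<delta>" by (simp add: c rt_def)
qed

lemma finite_root_set: "finite (root_set \<delta>)"
  by (simp add: root_set_def finite_cyclotomic_coset)

lemma root_set_nonempty: "rt \<delta> \<in> root_set \<delta>"
  unfolding root_set_eq by (auto intro!: exI[of _ 0])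

lemma root_set_power:
  assumes "x \<in> root_set \<delta>"
  shows "x ^ q \<in> root_set \<delta>"
proof -
  obtain c where "x = rt (\<delta> * int q ^ c)" using assms by (auto simp: root_set_eq)
  then have "x ^ q = rt (\<delta> * int q ^ Suc c)" by (simp add: rt_power mult_ac)
  then show ?thesis unfolding root_set_eq by blast
qed

text \<open>The orbit is a single cycle: from any of its elements, repeated q-th powers reach all
  others.\<close>

lemma root_set_closed:
  assumes "x \<in> root_set \<delta>" "\<And>y. y \<in> R \<Longrightarrow> y ^ q \<in> R" "x \<in> R"
  shows "root_set \<delta> \<subseteq> R"
proof -
  obtain c where c: "x = rt (\<delta> * int q ^ c)" using assms(1) by (auto simp: root_set_eq)
  have R: "rt (\<delta> * int q ^ (c + k)) \<in> R" for k
  proof (induction k)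
    case 0
    then show ?case using assms(3) c by simp
  next
    case (Suc k)
    then have "rt (\<delta> * int q ^ (c + k)) ^ q \<in> R" by (rule assms(2))
    then show ?case by (simp add: rt_power mult_ac)
  qed
  show ?thesis
  proof
    fix y assume "y \<in> root_set \<delta>"
    then obtain b where b: "y = rt (\<delta> * int q ^ b)" by (auto simp: root_set_eq)
    define o' where "o' = ord M q"
    have pos: "o' > 0" using M by (simp add: o'_def)
    have one: "[int q ^ o' = 1] (mod int M)"
      using ord[of q M] unfolding o'_def by (simp add: cong_int_iff[symmetric])
    \<comment> \<open>Adding c full periods brings the exponent up to at least c without changing
      the root.\<close>
    have le: "c \<le> b + o' * c" using pos by (simp add: trans_le_add2)
    have "[\<delta> * int q ^ b * (int q ^ o') ^ c = \<delta> * int q ^ b * 1 ^ c] (mod int M)"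
      using one by (intro cong_scalar_left cong_pow)
    then have "rt (\<delta> * int q ^ (b + o' * c)) = y"
      unfolding b by (intro rt_cong) (simp add: power_add power_mult mult.assoc)
    moreover have "b + o' * c = c + (b + o' * c - c)" using le by simp
    ultimately show "y \<in> R" using R by metis
  qed
qed

definition ac_prod :: "int \<Rightarrow> 'a alg_closure poly" where
  "ac_prod \<delta> = (\<Prod>x\<in>root_set \<delta>. [:- x, 1:])"

lemma ac_prod_eq: "(\<Prod>i\<in>cyclotomic_coset q M \<delta>. [: - (zeta M ^ nat i), 1 :]) = ac_prod \<delta>"
proof -
  have mod: "i mod int M = i" if "i \<in> cyclotomic_coset q M \<delta>" for i
    using that by (elim mem_cyclotomic_cosetE) simp
  have inj: "inj_on rt (cyclotomic_coset q M \<delta>)"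
    using mod by (intro inj_onI) (metis rt_eq_iff cong_def)
  have "(\<Prod>x\<in>root_set \<delta>. [:- x, 1:]) = (\<Prod>i\<in>cyclotomic_coset q M \<delta>. [:- rt i, 1:])"
    unfolding root_set_def by (simp add: prod.reindex[OF inj])
  also have "\<dots> = (\<Prod>i\<in>cyclotomic_coset q M \<delta>. [: - (zeta M ^ nat i), 1 :])"
    using mod by (intro prod.cong) (simp_all add: rt_def \<zeta>_def)
  finally show ?thesis by (simp add: ac_prod_def)
qed

lemma power_q_fixed: "x ^ q = x \<Longrightarrow> x \<in> range to_ac" for x :: "'a alg_closure"
  using range_to_ac[of x] card_q by simp

text \<open>The q-th power map sends the finite orbit injectively into itself, hence permutes the
  linear factors.\<close>

lemma ac_prod_frobenius: "map_poly (\<lambda>x. x ^ q) (ac_prod \<delta>) = ac_prod \<delta>"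
proof -
  interpret fr: comm_ring_hom "\<lambda>x :: 'a alg_closure. x ^ q"
    using frobenius_hom[OF p] card_q qpe by simp
  interpret frp: map_poly_comm_ring_hom "\<lambda>x :: 'a alg_closure. x ^ q" ..
  have inj: "inj_on (\<lambda>x. x ^ q) (root_set \<delta>)"
  proof
    fix x y assume xy: "x \<in> root_set \<delta>" "y \<in> root_set \<delta>" "x ^ q = y ^ q"
    obtain a b where ab: "x = rt (\<delta> * int q ^ a)" "y = rt (\<delta> * int q ^ b)"
      using xy(1,2) by (auto simp: root_set_eq)
    have "[\<delta> * int q ^ a * int q = \<delta> * int q ^ b * int q] (mod int M)"
      using xy(3) by (simp only: ab rt_power rt_eq_iff)
    moreover have "coprime (int q) (int M)" using M by (simp add: coprime_commute)
    ultimately have "[\<delta> * int q ^ a = \<delta> * int q ^ b] (mod int M)"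
      by (simp only: cong_mult_rcancel)
    then show "x = y" unfolding ab by (rule rt_cong)
  qed
  have "(\<lambda>x. x ^ q) ` root_set \<delta> = root_set \<delta>"
    using root_set_power by (intro endo_inj_surj finite_root_set inj) auto
  then have "ac_prod \<delta> = (\<Prod>x\<in>root_set \<delta>. [:- (x ^ q), 1:])"
    unfolding ac_prod_def using prod.reindex[OF inj, of "\<lambda>x. [:- x, 1:]"] by simp
  also have "\<dots> = map_poly (\<lambda>x. x ^ q) (ac_prod \<delta>)"
    unfolding ac_prod_def frp.hom_prod by (intro prod.cong refl) (simp add: map_poly_pCons fr.hom_uminus)
  finally show ?thesis by simp
qed

text \<open>Coefficients fixed by the q-th power map lie in F_q, so a preimage exists; it is unique
  because \<open>to_ac\<close> is injective. This justifies the \<open>THE\<close> in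
  \<open>coset_poly\<close>.\<close>

lemma map_coset_poly: "map_poly to_ac (coset_poly zeta q M \<delta>) = ac_prod \<delta>"
proof -
  have "Polynomial.coeff (ac_prod \<delta>) i \<in> range to_ac" for i
  proof -
    have q0: "q > 0" using p by (simp add: qpe prime_gt_0_nat)
    have "Polynomial.coeff (map_poly (\<lambda>x. x ^ q) (ac_prod \<delta>)) i = Polynomial.coeff (ac_prod \<delta>) i ^ q"
      using q0 by (simp add: coeff_map_poly)
    then show ?thesis unfolding ac_prod_frobenius by (intro power_q_fixed) simp
  qed
  then have "map_poly to_ac (map_poly of_ac (ac_prod \<delta>)) = ac_prod \<delta>"
    by (intro poly_eqI) (simp add: coeff_map_poly to_ac_of_ac)
  moreover have "f = f'" if "map_poly to_ac f = ac_prod \<delta>" "map_poly to_ac f' = ac_prod \<delta>" for f f' :: "'a poly"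
    using that by (metis ac_poly.injectivity)
  ultimately have "\<exists>!f. map_poly to_ac f = ac_prod \<delta>" by blast
  then have "map_poly to_ac (THE f. map_poly to_ac f = ac_prod \<delta>) = ac_prod \<delta>" by (rule theI')
  then show ?thesis unfolding coset_poly_def ac_prod_eq .
qed

text \<open>Divisibility by this polynomial amounts to vanishing at the single point
  \<open>rt \<delta>\<close>: the zeros of a polynomial over F_q are closed under q-th powers, so
  one zero brings the whole orbit. Primality is then the absence of zero divisors in the
  closure.\<close>

lemma prime_elem_coset_poly: "prime_elem (coset_poly zeta q M \<delta>)"
proof -
  let ?M = "coset_poly zeta q M \<delta>"
  have root: "poly (ac_prod \<delta>) (rt \<delta>) = 0"
    unfolding ac_prod_def poly_prod using finite_root_set root_set_nonempty by (auto intro!: prod_zero)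
  have nz: "ac_prod \<delta> \<noteq> 0" unfolding ac_prod_def using finite_root_set by simp
  have dvd: "?M dvd a" if "poly (map_poly to_ac a) (rt \<delta>) = 0" for a :: "'a poly"
  proof -
    interpret fr: comm_ring_hom "\<lambda>x :: 'a alg_closure. x ^ q"
      using frobenius_hom[OF p] card_q qpe by simp
    have fixed: "map_poly (\<lambda>x. x ^ q) (map_poly to_ac a) = map_poly to_ac a"
    proof (rule poly_eqI)
      fix i
      have "q > 0" using p by (simp add: qpe prime_gt_0_nat)
      then show "Polynomial.coeff (map_poly (\<lambda>x. x ^ q) (map_poly to_ac a)) i = Polynomial.coeff (map_poly to_ac a) i"
        using finite_field_power_card_eq_same[of "Polynomial.coeff a i"] card_q
        by (simp add: coeff_map_poly flip: to_ac_power)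
    qed
    have "root_set \<delta> \<subseteq> {x. poly (map_poly to_ac a) x = 0}"
    proof (rule root_set_closed[OF root_set_nonempty])
      fix y assume "y \<in> {x. poly (map_poly to_ac a) x = 0}"
      then have "(poly (map_poly to_ac a) y) ^ q = 0" using p by (simp add: qpe prime_gt_0_nat)
      moreover have "poly (map_poly (\<lambda>x. x ^ q) (map_poly to_ac a)) (y ^ q) = (poly (map_poly to_ac a) y) ^ q"
        by (rule fr.poly_map_poly)
      ultimately show "y ^ q \<in> {x. poly (map_poly to_ac a) x = 0}" unfolding fixed by simp
    qed (use that in simp)
    then have "ac_prod \<delta> dvd map_poly to_ac a"
      unfolding ac_prod_def by (intro prod_linear_factors_dvd finite_root_set) auto
    then show ?thesis unfolding map_coset_poly[symmetric] by (rule ac.dvd_map_poly_hom_imp_dvd)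
  qed
  show ?thesis
  proof (rule prime_elemI)
    show "?M \<noteq> 0" using nz map_coset_poly by (metis map_poly_0)
    show "\<not> is_unit ?M"
    proof
      assume "is_unit ?M"
      then obtain b where "1 = ?M * b" ..
      then have "poly (map_poly to_ac ?M) (rt \<delta>) * poly (map_poly to_ac b) (rt \<delta>) = 1"
        by (metis ac_poly.hom_mult ac_poly.hom_one poly_1 poly_mult)
      then show False using root map_coset_poly by simp
    qed
    fix a b assume "?M dvd a * b"
    then obtain c where "a * b = ?M * c" ..
    then have "poly (map_poly to_ac a) (rt \<delta>) * poly (map_poly to_ac b) (rt \<delta>) = 0"
      using root map_coset_poly by (metis ac_poly.hom_mult mult_zero_left poly_mult)
    then show "?M dvd a \<or> ?M dvd b" using dvd by auto
  qed
qed

lemma poly_coset_poly_root: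
  assumes "[i * int q ^ c = \<delta>] (mod int M)"
  shows "poly (map_poly to_ac (coset_poly zeta q M \<delta>)) (rt i) = 0"
  unfolding map_coset_poly ac_prod_def poly_prod using finite_root_set mem_root_set[OF assms]
  by (auto intro!: prod_zero)

end

section \<open>The factorization of the modulus\<close>

text \<open>The freshman's dream is applied to X^n in the form (X^n - \<lambda>') + \<lambda>', so
  that no sign has to be tracked.\<close>

lemma binomial_modulus_prime_power:
  fixes lam' :: "'a::field"
  assumes "prime CHAR('a)"
  shows "binomial_modulus (CHAR('a) ^ v * n) (lam' ^ (CHAR('a) ^ v)) = binomial_modulus n lam' ^ (CHAR('a) ^ v)"
proof -
  let ?m = "CHAR('a) ^ v"
  have "(binomial_modulus n lam' + [:lam':]) ^ ?m = binomial_modulus n lam' ^ ?m + [:lam':] ^ ?m"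
    using assms by (intro freshmans_dream') (simp_all add: semiring_char_poly)
  moreover have "(binomial_modulus n lam' + [:lam':]) ^ ?m = Polynomial.monom 1 (?m * n)"
    by (simp add: binomial_modulus_def monom_power mult.commute)
  moreover have "[:lam':] ^ ?m = [:lam' ^ ?m:]" by (simp add: poly_const_pow)
  ultimately show ?thesis by (simp add: binomial_modulus_def algebra_simps)
qed

context coset_polys
begin

text \<open>The roots of X^n - \<lambda>' are listed as \<zeta>^(h + gk) with k < n: these are n
  distinct roots, hence all. Inverting h modulo M writes h + gk as h\<delta>, where \<delta> is 1
  modulo g, and the covering hypothesis applies to \<delta>.\<close>

lemma binomial_modulus_dvd_prod:
  fixes h :: int and lam' :: 'a and n g :: nat
  assumes Mng: "M = n * g" and h: "coprime h (int M)" and lam': "\<zeta> powi (h * int n) = to_ac lam'"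
    and A: "finite A" and cover: "\<And>\<delta>. [\<delta> = 1] (mod int g) \<Longrightarrow> \<exists>x\<in>A. \<exists>c. [\<delta> * int q ^ c = \<gamma> x] (mod int M)"
  shows "binomial_modulus n lam' dvd (\<Prod>x\<in>A. coset_poly zeta q M (h * \<gamma> x))"
proof -
  have n: "n > 0" and g: "g > 0" using M_pos Mng by auto
  define R where "R = (\<lambda>k. rt (h + int g * int k)) ` {..<n}"
  have inj: "inj_on (\<lambda>k. rt (h + int g * int k)) {..<n}"
  proof
    fix k k' assume k: "k \<in> {..<n}" "k' \<in> {..<n}" "rt (h + int g * int k) = rt (h + int g * int k')"
    then have "int M dvd int g * (int k - int k')"
      by (simp add: rt_eq_iff cong_iff_dvd_diff algebra_simps)
    then have "int g * int n dvd int g * (int k - int k')" by (simp add: Mng mult.commute)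
    then have "int n dvd int k - int k'" using g by simp
    then have "[k = k'] (mod n)" by (simp add: cong_int_iff[symmetric] cong_iff_dvd_diff)
    then show "k = k'" using k(1,2) by (auto simp: cong_def)
  qed
  have card_R: "card R = n" unfolding R_def by (simp add: card_image[OF inj])
  let ?W = "map_poly to_ac (binomial_modulus n lam')"
  have W: "?W = binomial_modulus n (to_ac lam')"
    by (rule poly_eqI) (simp add: binomial_modulus_def coeff_map_poly coeff_pCons split: nat.split)
  have root: "poly ?W x = 0" if "x \<in> R" for x
  proof -
    obtain k where x: "x = rt (h + int g * int k)" using \<open>x \<in> R\<close> by (auto simp: R_def)
    have "x ^ n = rt ((h + int g * int k) * int n)" by (simp add: x rt_power)
    also have "\<dots> = rt (h * int n)"
      by (rule rt_cong) (simp add: cong_iff_dvd_diff Mng algebra_simps)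
    also have "\<dots> = to_ac lam'" using lam' by (simp add: rt_powi)
    finally show ?thesis unfolding W by (simp add: binomial_modulus_def poly_monom)
  qed
  have fin: "finite R" by (simp add: R_def)
  have "(\<Prod>x\<in>R. [:- x, 1:]) dvd ?W" using root by (intro prod_linear_factors_dvd fin)
  moreover have "degree ?W = n" unfolding W by (rule degree_binomial[OF n])
  moreover have "degree (\<Prod>x\<in>R. [:- x, 1:]) = n"
    using card_R by (simp add: degree_prod_eq_sum_degree)
  moreover have "?W \<noteq> 0" unfolding W by (rule binomial_nonzero[OF n])
  \<comment> \<open>Both polynomials have degree n, so the divisibility just found can be
    reversed.\<close>
  ultimately have W_dvd: "?W dvd (\<Prod>x\<in>R. [:- x, 1:])"
  proof -
    assume dvd: "(\<Prod>x\<in>R. [:- x, 1:]) dvd ?W" and deg: "degree ?W = n" "degree (\<Prod>x\<in>R. [:- x, 1:]) = n"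
      and nz: "?W \<noteq> 0"
    obtain b where b: "?W = (\<Prod>x\<in>R. [:- x, 1:]) * b" using dvd ..
    have "b \<noteq> 0" "(\<Prod>x\<in>R. [:- x, 1:]) \<noteq> 0" using nz b by auto
    then have "degree b = 0" using deg b degree_mult_eq[of "\<Prod>x\<in>R. [:- x, 1:]" b] by simp
    then have "b dvd 1" using \<open>b \<noteq> 0\<close> by (simp add: is_unit_iff_degree)
    then obtain b' where b': "1 = b * b'" ..
    have "?W * b' = (\<Prod>x\<in>R. [:- x, 1:])" unfolding b mult.assoc b'[symmetric] by (rule mult_1_right)
    then show ?thesis by (metis dvd_triv_left)
  qed
  have "poly (map_poly to_ac (\<Prod>x\<in>A. coset_poly zeta q M (h * \<gamma> x))) y = 0" if y: "y \<in> R" for y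
  proof -
    obtain k where k: "y = rt (h + int g * int k)" using y by (auto simp: R_def)
    obtain h' where h': "[h * h' = 1] (mod int M)" using cong_solve_coprime_int[OF h] by blast
    define \<delta> where "\<delta> = h' * (h + int g * int k)"
    have "[h' * h + int g * (h' * int k) = 1 + 0] (mod int g)"
      using cong_dvd_modulus[OF h', of "int g"]
      by (intro cong_add) (simp_all add: Mng mult.commute cong_0_iff)
    then have "[\<delta> = 1] (mod int g)" by (simp add: \<delta>_def algebra_simps)
    then obtain x c where x: "x \<in> A" "[\<delta> * int q ^ c = \<gamma> x] (mod int M)" using cover by blast
    have "[h * h' * ((h + int g * int k) * int q ^ c) = 1 * ((h + int g * int k) * int q ^ c)] (mod int M)"
      using h' by (rule cong_scalar_right)
    moreover have "[h * (\<delta> * int q ^ c) = h * \<gamma> x] (mod int M)"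
      using x(2) by (rule cong_scalar_left)
    moreover have "h * (\<delta> * int q ^ c) = h * h' * ((h + int g * int k) * int q ^ c)"
      by (simp add: \<delta>_def)
    ultimately have "[(h + int g * int k) * int q ^ c = h * \<gamma> x] (mod int M)"
      by (metis cong_sym cong_trans mult_1)
    then have "poly (map_poly to_ac (coset_poly zeta q M (h * \<gamma> x))) y = 0"
      unfolding k by (rule poly_coset_poly_root)
    then show ?thesis
      unfolding ac_poly.hom_prod poly_prod using A x(1) by (intro prod_zero) auto
  qed
  then have "(\<Prod>x\<in>R. [:- x, 1:]) dvd map_poly to_ac (\<Prod>x\<in>A. coset_poly zeta q M (h * \<gamma> x))"
    by (intro prod_linear_factors_dvd fin)
  with W_dvd have "?W dvd map_poly to_ac (\<Prod>x\<in>A. coset_poly zeta q M (h * \<gamma> x))"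
    by (rule dvd_trans)
  then show ?thesis by (rule ac.dvd_map_poly_hom_imp_dvd)
qed

end

section \<open>Assembling the classification of the codes\<close>

lemma finite_x_tuples: "finite (x_tuples q u G e f)"
  unfolding x_tuples_def by (intro finite_PiE) auto

lemma primitive_root_of_unity_dvd:
  assumes "primitive_root_of_unity g z" "z ^ k = 1"
  shows "g dvd k"
proof -
  have g: "g > 0" "z ^ g = 1" using assms(1) by (auto simp: primitive_root_of_unity_def)
  have "z ^ k = z ^ (g * (k div g) + k mod g)" by simp
  also have "\<dots> = z ^ (k mod g)" unfolding power_add power_mult g(2) by simp
  finally have "z ^ (k mod g) = 1" using assms(2) by simp
  moreover have "k mod g < g" using g(1) by simp
  ultimately have "k mod g = 0" using assms(1) by (auto simp: primitive_root_of_unity_def)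
  then show ?thesis by auto
qed

theorem theorem8p1:
  fixes p e q N v n n\<^sub>1 g u s :: nat
    and lam lam' :: "'a::finite_field"
    and zeta :: "nat \<Rightarrow> 'a alg_closure"
    and \<sigma> :: "nat \<Rightarrow> nat \<Rightarrow> int \<Rightarrow> nat set"
    and h :: int
    and G E F P J :: "nat \<Rightarrow> nat"
  assumes "prime p" and "e > 0" and "q = p ^ e" and "card (UNIV :: 'a set) = q"
    and "primitive_root_of_unity g lam"
    and "N > 0" and "v = multiplicity p N" and "N = p ^ v * n" and "coprime n p"
    and "lam' ^ (p ^ v) = lam"
    and "compatible_roots_of_unity q zeta"
    and "rep_choice p q \<sigma>"
    and "coprime h (int (n * g))" and "zeta (n * g) powi (h * int n) = to_ac lam'"
    and "g = (\<Prod>k=1..u. G k ^ E k)"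
    and "n\<^sub>1 = (\<Prod>k=1..u. G k ^ F k)"
    and "n = n\<^sub>1 * (\<Prod>k=1..s. P k ^ J k)"
    and "\<forall>k\<in>{1..u}. prime (G k) \<and> G k \<noteq> p \<and> E k > 0"
    and "\<forall>k\<in>{1..s}. prime (P k) \<and> P k \<noteq> p \<and> J k > 0"
    and "strict_mono_on {1..u} G" and "strict_mono_on {1..s} P"
    and "G ` {1..u} \<inter> P ` {1..s} = {}"
  shows
    "let Xs = x_tuples q u G E F;
         Idx = (\<lambda>x. index_set q s P J (n\<^sub>1 * g) (gamma_x q g u G F x));
         \<gamma> = (\<lambda>x I. gamma_seq q \<sigma> P J (n\<^sub>1 * g) (gamma_x q g u G F x) I s);
         M = (\<lambda>\<delta>. coset_poly zeta q (n * g) \<delta> :: 'a poly)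
     in (\<lambda>C. vec_class N lam ` C) ` {C. constacyclic_code N lam C} =
        {code_ideal N lam (\<lambda>x I. M (h * \<gamma> x I)) Xs Idx \<Omega> |
           \<Omega>. \<forall>x\<in>Xs. \<forall>I\<in>Idx x. \<Omega> x I \<in> {0..p ^ v}}"
proof -
  note p = \<open>prime p\<close> and e = \<open>e > 0\<close> and qpe = \<open>q = p ^ e\<close> and card_q = \<open>card (UNIV :: 'a set) = q\<close>
    and lam = \<open>primitive_root_of_unity g lam\<close> and N = \<open>N > 0\<close> and Npn = \<open>N = p ^ v * n\<close>
    and cop = \<open>coprime n p\<close> and lam' = \<open>lam' ^ (p ^ v) = lam\<close>
    and roots = \<open>compatible_roots_of_unity q zeta\<close> and rep = \<open>rep_choice p q \<sigma>\<close>
    and h = \<open>coprime h (int (n * g))\<close> and hlam = \<open>zeta (n * g) powi (h * int n) = to_ac lam'\<close>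
    and g = \<open>g = (\<Prod>k=1..u. G k ^ E k)\<close> and n1 = \<open>n\<^sub>1 = (\<Prod>k=1..u. G k ^ F k)\<close>
    and n = \<open>n = n\<^sub>1 * (\<Prod>k=1..s. P k ^ J k)\<close>
    and G = \<open>\<forall>k\<in>{1..u}. prime (G k) \<and> G k \<noteq> p \<and> E k > 0\<close>
    and P = \<open>\<forall>k\<in>{1..s}. prime (P k) \<and> P k \<noteq> p \<and> J k > 0\<close>
    and G_mono = \<open>strict_mono_on {1..u} G\<close> and P_mono = \<open>strict_mono_on {1..s} P\<close>
    and GP = \<open>G ` {1..u} \<inter> P ` {1..s} = {}\<close>
  define Xs where "Xs = x_tuples q u G E F"
  define Idx where "Idx = (\<lambda>x. index_set q s P J (n\<^sub>1 * g) (gamma_x q g u G F x))"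
  define \<gamma> where "\<gamma> = (\<lambda>x I. gamma_seq q \<sigma> P J (n\<^sub>1 * g) (gamma_x q g u G F x) I s)"
  define M where "M = (\<lambda>x I. coset_poly zeta q (n * g) (h * \<gamma> x I) :: 'a poly)"
  have q1: "q > 1" using one_less_power[OF prime_gt_1_nat[OF p] e] qpe by simp
  have g0: "g > 0" using lam by (simp add: primitive_root_of_unity_def)
  have n0: "n > 0" using N Npn by (cases n) auto
  have lam_nz: "lam \<noteq> 0"
    using lam g0 by (metis power_0_left primitive_root_of_unity_def zero_neq_one neq0_conv)
  have gq: "g dvd q - 1"
  proof (rule primitive_root_of_unity_dvd[OF lam])
    have "lam * lam ^ (q - 1) = lam ^ q" using q1 by (simp flip: power_Suc)
    also have "\<dots> = lam" using finite_field_power_card_eq_same[of lam] card_q by simp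
    finally show "lam ^ (q - 1) = 1" using lam_nz by simp
  qed
  have cop_gq: "coprime g q"
  proof -
    have "coprime (q - 1) q" using q1 coprime_diff_one_left_nat[of q] by simp
    then show ?thesis using gq by (meson coprime_divisors dvd_refl)
  qed
  have cop_nq: "coprime n q" using cop by (simp add: qpe)
  have cop_ng: "coprime (n * g) q" using cop_gq cop_nq by simp
  have n1_dvd: "n\<^sub>1 dvd n" using n by simp
  have cop_n1g: "coprime (n\<^sub>1 * g) q"
    using cop_ng by (rule coprime_divisors[rotated 2]) (use n1_dvd in auto)
  have n1g0: "n\<^sub>1 * g > 0" using n0 n g0 by auto
  have P_q: "\<not> P k dvd q" if "k \<in> {1..s}" for k
  proof
    assume "P k dvd q"
    then have "P k dvd p" using P that prime_dvd_power unfolding qpe by blast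
    then show False using P that p primes_dvd_imp_eq by blast
  qed
  have P_n1g: "\<not> P k dvd n\<^sub>1 * g" if k: "k \<in> {1..s}" for k
  proof
    assume dvd: "P k dvd n\<^sub>1 * g"
    have prime: "prime (P k)" using P k by blast
    have "n\<^sub>1 * g = (\<Prod>k=1..u. G k ^ (F k + E k))" by (simp add: n1 g prod.distrib power_add)
    then obtain i where i: "i \<in> {1..u}" "P k dvd G i ^ (F i + E i)"
      using dvd prime by (auto simp: prime_dvd_prod_iff)
    then have "P k dvd G i" using prime prime_dvd_power by blast
    then have "P k = G i" using prime G i(1) primes_dvd_imp_eq by blast
    then show False using GP i(1) k by blast
  qed
  have zeta: "primitive_root_of_unity (n * g) (zeta (n * g))"
    using roots cop_ng unfolding compatible_roots_of_unity_def by blast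
  have G': "\<And>k. k \<in> {1..u} \<Longrightarrow> prime (G k) \<and> E k > 0" using G by blast
  interpret base: base_cosets q g n\<^sub>1 u G E F
    by (rule base_cosets.intro[OF q1 gq g n1 G' G_mono])
  interpret polys: coset_polys p e q "n * g" zeta
    by (rule coset_polys.intro) (fact p card_q qpe cop_ng zeta)+
  have finXs: "finite Xs" unfolding Xs_def by (rule finite_x_tuples)
  have finIdx: "finite (Idx x)" for x unfolding Idx_def by (rule finite_index_set)
  \<comment> \<open>A class is carried to some \<open>gamma_x\<close> modulo n_1 g; the integer so
    obtained then enters the tower over that base modulus, and the exponents of q add up.\<close>
  have cover: "\<exists>z\<in>Sigma Xs Idx. \<exists>c. [\<delta> * int q ^ c = (case z of (x, I) \<Rightarrow> \<gamma> x I)] (mod int (n * g))"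
    if \<delta>: "[\<delta> = 1] (mod int g)" for \<delta>
  proof -
    obtain x c where x: "x \<in> Xs" "[\<delta> * int q ^ c = gamma_x q g u G F x] (mod int (n\<^sub>1 * g))"
      using base.coset_representative[OF \<delta>] unfolding Xs_def by blast
    interpret tower: extension_tower q s "n\<^sub>1 * g" P J \<sigma> "gamma_x q g u G F x"
    proof unfold_locales
      show "strict_mono_on {1..s} P" by (rule P_mono)
      fix B l \<delta>
      assume *: "0 < B" "coprime B q" "prime l" "\<not> l dvd B" "\<not> l dvd q"
      then have "l \<noteq> p" using e by (auto simp: qpe)
      then show "full_rep_set l (q ^ coset_size q B \<delta>) (\<sigma> B l \<delta>)"
        using rep * unfolding rep_choice_def by blast
    qed (use q1 n1g0 cop_n1g P P_q P_n1g in auto)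
    obtain I c' where I: "I \<in> Idx x" "[\<delta> * int q ^ c * int q ^ c' = \<gamma> x I] (mod int (tower.B s))"
      using tower.index_set_covering[OF x(2)] unfolding Idx_def \<gamma>_def by blast
    have "tower.B s = n * g"
      unfolding tower.B_def atLeastLessThanSuc_atLeastAtMost n by (simp only: mult_ac)
    then have "[\<delta> * int q ^ (c + c') = \<gamma> x I] (mod int (n * g))"
      using I(2) by (simp add: power_add mult.assoc)
    then show ?thesis using x(1) I(1) by (intro bexI[of _ "(x, I)"]) auto
  qed
  have finS: "finite (Sigma Xs Idx)" using finXs finIdx by auto
  have dvd1: "binomial_modulus n lam' dvd (\<Prod>z\<in>Sigma Xs Idx. coset_poly zeta q (n * g) (h * (case z of (x, I) \<Rightarrow> \<gamma> x I)))"
    using h hlam cover by (intro polys.binomial_modulus_dvd_prod[OF refl _ _ finS]) (auto simp: polys.\<zeta>_def)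
  have CHAR: "CHAR('a) = p" using CHAR_eq[OF p] card_q qpe by simp
  have W: "binomial_modulus N lam = binomial_modulus n lam' ^ (p ^ v)"
    using binomial_modulus_prime_power[of v n lam'] p unfolding CHAR lam' Npn[symmetric] by simp
  have W_dvd: "binomial_modulus N lam dvd (\<Prod>z\<in>Sigma Xs Idx. (case z of (x, I) \<Rightarrow> M x I) ^ (p ^ v))"
  proof -
    have "binomial_modulus N lam dvd (\<Prod>z\<in>Sigma Xs Idx. coset_poly zeta q (n * g) (h * (case z of (x, I) \<Rightarrow> \<gamma> x I))) ^ (p ^ v)"
      unfolding W by (intro dvd_power_same dvd1)
    also have "\<dots> = (\<Prod>z\<in>Sigma Xs Idx. (case z of (x, I) \<Rightarrow> M x I) ^ (p ^ v))"
      unfolding prod_power_distrib by (intro prod.cong) (auto simp: M_def)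
    finally show ?thesis .
  qed
  \<comment> \<open>Taking one product over the pairs (x, I) puts the generator into the form
    produced by the lemma on divisors.\<close>
  have ideal: "code_ideal N lam M Xs Idx \<Omega> =
      {residue_class N lam (x * (\<Prod>z\<in>Sigma Xs Idx. (case z of (x, I) \<Rightarrow> M x I) ^ (case z of (x, I) \<Rightarrow> \<Omega> x I))) | x. True}" for \<Omega>
  proof -
    have "(\<Prod>x\<in>Xs. \<Prod>I\<in>Idx x. M x I ^ \<Omega> x I) = (\<Prod>z\<in>Sigma Xs Idx. (case z of (x, I) \<Rightarrow> M x I) ^ (case z of (x, I) \<Rightarrow> \<Omega> x I))"
      using finXs finIdx by (subst prod.Sigma) (auto intro!: prod.cong)
    then show ?thesis unfolding code_ideal_def PIdl_residue_class by simp
  qed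
  have "(\<lambda>C. vec_class N lam ` C) ` {C. constacyclic_code N lam C} =
        {code_ideal N lam M Xs Idx \<Omega> | \<Omega>. \<forall>x\<in>Xs. \<forall>I\<in>Idx x. \<Omega> x I \<in> {0..p ^ v}}" (is "?L = ?R")
  proof (intro equalityI subsetI)
    fix K assume "K \<in> ?R"
    then obtain \<Omega> where K: "K = code_ideal N lam M Xs Idx \<Omega>" by blast
    have "\<exists>C. constacyclic_code N lam C \<and> vec_class N lam ` C = K"
      unfolding K ideal by (rule constacyclic_code_of_poly[OF N])
    then show "K \<in> ?L" by blast
  next
    fix K assume "K \<in> ?L"
    then obtain C where C: "constacyclic_code N lam C" "K = vec_class N lam ` C" by blast
    obtain d where d: "d dvd binomial_modulus N lam" "K = {residue_class N lam (x * d) | x. True}"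
      using constacyclic_code_generator[OF N C(1)] unfolding C(2)[symmetric] by blast
    have "d dvd (\<Prod>z\<in>Sigma Xs Idx. (case z of (x, I) \<Rightarrow> M x I) ^ (p ^ v))"
      using d(1) W_dvd by (rule dvd_trans)
    moreover have "prime_elem (case z of (x, I) \<Rightarrow> M x I)" for z
      unfolding M_def by (cases z) (simp only: prod.case polys.prime_elem_coset_poly)
    ultimately have "\<exists>\<Omega> w. (\<forall>z\<in>Sigma Xs Idx. \<Omega> z \<le> p ^ v) \<and> w dvd 1 \<and>
        d = w * (\<Prod>z\<in>Sigma Xs Idx. (case z of (x, I) \<Rightarrow> M x I) ^ \<Omega> z)"
      by (intro dvd_prod_prime_elem_powerD[where \<pi> = "\<lambda>z. case z of (x, I) \<Rightarrow> M x I", OF finS])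
    then obtain \<Omega> w where \<Omega>: "\<forall>z\<in>Sigma Xs Idx. \<Omega> z \<le> p ^ v" and w: "w dvd 1"
      and dw: "d = w * (\<Prod>z\<in>Sigma Xs Idx. (case z of (x, I) \<Rightarrow> M x I) ^ \<Omega> z)"
      by (elim exE conjE)
    define D where "D = (\<Prod>z\<in>Sigma Xs Idx. (case z of (x, I) \<Rightarrow> M x I) ^ \<Omega> z)"
    \<comment> \<open>The unit w only rescales the generator and leaves the ideal unchanged.\<close>
    obtain w' where "1 = w * w'" using w ..
    then have w': "w * w' = 1" ..
    have "K = {residue_class N lam (x * D) | x. True}"
    proof (intro Set.set_eqI iffI)
      fix L assume "L \<in> K"
      then obtain x where "L = residue_class N lam (x * d)" using d(2) by blast
      then have "L = residue_class N lam ((x * w) * D)" by (simp add: dw D_def mult.assoc)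
      then show "L \<in> {residue_class N lam (x * D) | x. True}" by blast
    next
      fix L assume "L \<in> {residue_class N lam (x * D) | x. True}"
      then obtain x where L: "L = residue_class N lam (x * D)" by blast
      have "x * D = x * (w * w') * D" using w' by simp
      also have "\<dots> = (x * w') * d" by (simp add: dw D_def mult_ac)
      finally have "L = residue_class N lam ((x * w') * d)" by (simp only: L)
      then show "L \<in> K" unfolding d(2) by blast
    qed
    also have "\<dots> = code_ideal N lam M Xs Idx (\<lambda>x I. \<Omega> (x, I))"
      unfolding ideal D_def by (simp add: case_prod_unfold)
    finally have "K = code_ideal N lam M Xs Idx (\<lambda>x I. \<Omega> (x, I))" .
    moreover have "\<forall>x\<in>Xs. \<forall>I\<in>Idx x. \<Omega> (x, I) \<in> {0..p ^ v}" using \<Omega> by auto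
    ultimately show "K \<in> ?R" by (intro CollectI exI conjI)
  qed
  then show ?thesis
    unfolding Let_def Xs_def Idx_def \<gamma>_def M_def .
qed

end
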